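(* Let $\mathfrak{g}$ be a Lie algebra and $\mathcal{V}=(\mathcal{V},\rho)$ a representation of it. Then the triple $$\Big(\bigoplus_{n\ge1}\big(\mathrm{Hom}(\wedge^n\mathfrak{g},\mathfrak{g})\oplus\mathrm{Hom}(\wedge^{n-1}\mathfrak{g}\otimes\mathcal{V},\mathcal{V})\big),\ \llbracket\,,\,\rrbracket,\ \mathbbm{d}\Big)$$ is a differential graded Lie algebra. A pair $\mathbf{T}=(\mathfrak{T},\mathcal{T})$ of linear maps $\mathfrak{T}:\mathfrak{g}\to\mathfrak{g}$ and $\mathcal{T}:\mathcal{V}\to\mathcal{V}$ is a $\lambda$-weighted Rota-Baxter paired operators if and only if $\mathbf{T}$ is a Maurer-Cartan element in this differential graded Lie algebra, i.e. $\mathbbm{d}\mathbf{T}+\tfrac12\llbracket\mathbf{T},\mathbf{T}\rrbracket=0$.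
   Context: All vector spaces and (multi)linear maps are over a field $\mathbf{k}$ of characteristic $0$; $\lambda\in\mathbf{k}$ is a fixed scalar. **Rota-Baxter paired operators.** A pair $(\mathfrak{T},\mathcal{T})$ of linear maps $\mathfrak{T}:\mathfrak{g}\to\mathfrak{g}$, $\mathcal{T}:\mathcal{V}\to\mathcal{V}$ is called a $\lambda$-weighted Rota-Baxter paired operators if for all $x,y\in\mathfrak{g}$, $u\in\mathcal{V}$: $[\mathfrak{T}(x),\mathfrak{T}(y)]=\mathfrak{T}([\mathfrak{T}(x),y]+[x,\mathfrak{T}(y)]+\lambda[x,y])$ and $\rho(\mathfrak{T}x)(\mathcal{T}u)=\mathcal{T}(\rho(\mathfrak{T}x)u+\rho(x)(\mathcal{T}u)+\lambda\rho(x)u)$. **The bracket and the differential.** Let $\mathfrak{g}'$, $\mathcal{V}'$ be further copies of $\mathfrak{g}$, $\mathcal{V}$, and $\mathfrak{l}=\mathfrak{g}\oplus\mathfrak{g}'\oplus\mathcal{V}\oplus\mathcal{V}'$. On $\bigoplus_{n\ge0}\mathrm{Hom}(\wedge^{n+1}\mathfrak{l},\mathfrak{l})$ (degree $n$ part $\mathrm{Hom}(\wedge^{n+1}\mathfrak{l},\mathfrak{l})$) consider the Nijenhuis-Richardson graded Lie bracket: for $f\in\mathrm{Hom}(\wedge^m\mathfrak{l},\mathfrak{l})$, $g\in\mathrm{Hom}(\wedge^n\mathfrak{l},\mathfrak{l})$, $[f,g]_{\mathsf{NR}}=f\diamond g-(-1)^{(m-1)(n-1)}g\diamond f$, where $$(f\diamond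 g)(l_1,\ldots,l_{m+n-1})=\sum_{\sigma\in\mathbb{S}_{(n,m-1)}}(-1)^{\sigma}f\big(g(l_{\sigma(1)},\ldots,l_{\sigma(n)}),l_{\sigma(n+1)},\ldots,l_{\sigma(m+n-1)}\big),$$ the sum being over $(n,m-1)$-shuffles, with $(-1)^\sigma$ the sign of $\sigma$. Skew-symmetric multilinear maps defined on sub-summands of $\mathfrak{l}$ are extended to $\mathfrak{l}$ by skew-symmetry and by zero on the other summands. Define $\theta=\mu+\mathrm{ad}'+\rho+\rho'+\varrho\in\mathrm{Hom}(\wedge^2\mathfrak{l},\mathfrak{l})$ where $\mu:\wedge^2\mathfrak{g}\to\mathfrak{g}$ is the bracket of $\mathfrak{g}$; $\mathrm{ad}':\mathfrak{g}\times\mathfrak{g}'\to\mathfrak{g}'$, $(x,y')\mapsto[x,y']$; $\rho:\mathfrak{g}\times\mathcal{V}\to\mathcal{V}$ and $\rho':\mathfrak{g}\times\mathcal{V}'\to\mathcal{V}'$ are the actions of $\mathfrak{g}$; and $\varrho:\mathfrak{g}'\times\mathcal{V}\to\mathcal{V}'$, $(x',v)\mapsto\rho(x')v$. Define $\theta'=-(\mu'+\varrho')\in\mathrm{Hom}(\wedge^2\mathfrak{l},\mathfrak{l})$ where $\mu':\wedge^2\mathfrak{g}'\to\mathfrak{g}'$, $(x',y')\mapsto\lambda[x',y']$, and $\varrho':\mathfrak{g}'\times\mathcal{V}'\to\mathcal{V}'$, $(x',v')\mapsto\lambda\rho(x')v'$. Identify $\bigoplus_{n\ge1}(\mathrm{Hom}(\wedge^n\mathfrak{g},\mathfrak{g})\oplus\mathrm{Hom}(\wedge^{n-1}\mathfrak{g}\otimes\mathcal{V},\mathcal{V}))$,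 whose $n$-th summand has degree $n$, with $\bigoplus_{n\ge1}(\mathrm{Hom}(\wedge^n\mathfrak{g}',\mathfrak{g})\oplus\mathrm{Hom}(\wedge^{n-1}\mathfrak{g}'\otimes\mathcal{V}',\mathcal{V}))\subset\bigoplus_{n\ge1}\mathrm{Hom}(\wedge^n\mathfrak{l},\mathfrak{l})$. For $\mathbf{P}$ of degree $m$ and $\mathbf{Q}$ of degree $n$ in this space, $$\llbracket\mathbf{P},\mathbf{Q}\rrbracket=(-1)^m[[\theta,\mathbf{P}]_{\mathsf{NR}},\mathbf{Q}]_{\mathsf{NR}},\qquad \mathbbm{d}\mathbf{P}=[\theta',\mathbf{P}]_{\mathsf{NR}}.$$ *)

theory Defs
  imports
    Complex_Main
    "HOL-Library.Function_Algebras"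
    "HOL-Library.Product_Plus"
    "HOL-Combinatorics.Permutations"
begin

section \<open>Lie algebras, representations, Rota-Baxter paired operators\<close>

locale lie_algebra = vector_space scale
  for scale :: "'k::field \<Rightarrow> 'g::ab_group_add \<Rightarrow> 'g" +
  fixes lie :: "'g \<Rightarrow> 'g \<Rightarrow> 'g"
  assumes lie_linear_left: "Vector_Spaces.linear scale scale (\<lambda>x. lie x y)"
    and lie_linear_right: "Vector_Spaces.linear scale scale (lie x)"
    and lie_alternating: "lie x x = 0"
    and lie_jacobi: "lie x (lie y z) + lie y (lie z x) + lie z (lie x y) = 0"

locale lie_representation = lie_algebra sg lie + V: vector_space sv
  for sg :: "'k::field \<Rightarrow> 'g::ab_group_add \<Rightarrow> 'g"
    and lie :: "'g \<Rightarrow> 'g \<Rightarrow> 'g"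
    and sv :: "'k \<Rightarrow> 'v::ab_group_add \<Rightarrow> 'v" +
  fixes \<rho> :: "'g \<Rightarrow> 'v \<Rightarrow> 'v"
  assumes rho_linear_left: "Vector_Spaces.linear sg sv (\<lambda>x. \<rho> x v)"
    and rho_linear_right: "Vector_Spaces.linear sv sv (\<rho> x)"
    and rho_lie: "\<rho> (lie x y) v = \<rho> x (\<rho> y v) - \<rho> y (\<rho> x v)"

definition rota_baxter_paired ::
  "('k::field \<Rightarrow> 'g::ab_group_add \<Rightarrow> 'g) \<Rightarrow> ('g \<Rightarrow> 'g \<Rightarrow> 'g) \<Rightarrow> ('k \<Rightarrow> 'v::ab_group_add \<Rightarrow> 'v)
    \<Rightarrow> ('g \<Rightarrow> 'v \<Rightarrow> 'v) \<Rightarrow> 'k \<Rightarrow> ('g \<Rightarrow> 'g) \<Rightarrow> ('v \<Rightarrow> 'v) \<Rightarrow> bool" where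
  "rota_baxter_paired sg lie sv \<rho> lam T T' \<longleftrightarrow>
     Vector_Spaces.linear sg sg T \<and> Vector_Spaces.linear sv sv T' \<and>
     (\<forall>x y. lie (T x) (T y) = T (lie (T x) y + lie x (T y) + sg lam (lie x y))) \<and>
     (\<forall>x u. \<rho> (T x) (T' u) = T' (\<rho> (T x) u + \<rho> x (T' u) + sv lam (\<rho> x u)))"

section \<open>Differential graded Lie algebras and Maurer-Cartan elements\<close>

text \<open>
  The graded vector space is the internal direct sum of subspaces \<open>L n\<close> of an ambient vector
  space, so its underlying space is \<open>span (\<Union>n. L n)\<close>. Only gradings by nonnegative
  degrees are covered. The values of \<open>br\<close> and \<open>d\<close> outside the direct sum are
  irrelevant.
\<close>

locale dg_lie_algebra = vector_space scale
  for scale :: "'k::field \<Rightarrow> 'a::ab_group_add \<Rightarrow> 'a" +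
  fixes L :: "nat \<Rightarrow> 'a set"
    and br :: "'a \<Rightarrow> 'a \<Rightarrow> 'a"
    and d :: "'a \<Rightarrow> 'a"
  assumes subspace_L: "subspace (L n)"
    and direct_sum: "\<lbrakk>finite I; \<And>i. i \<in> I \<Longrightarrow> w i \<in> L i; sum w I = 0; j \<in> I\<rbrakk> \<Longrightarrow> w j = 0"
    and br_add_left: "\<lbrakk>x \<in> span (\<Union>n. L n); y \<in> span (\<Union>n. L n); z \<in> span (\<Union>n. L n)\<rbrakk>
          \<Longrightarrow> br (x + y) z = br x z + br y z"
    and br_add_right: "\<lbrakk>x \<in> span (\<Union>n. L n); y \<in> span (\<Union>n. L n); z \<in> span (\<Union>n. L n)\<rbrakk>
          \<Longrightarrow> br x (y + z) = br x y + br x z"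
    and br_scale_left: "\<lbrakk>x \<in> span (\<Union>n. L n); y \<in> span (\<Union>n. L n)\<rbrakk>
          \<Longrightarrow> br (scale c x) y = scale c (br x y)"
    and br_scale_right: "\<lbrakk>x \<in> span (\<Union>n. L n); y \<in> span (\<Union>n. L n)\<rbrakk>
          \<Longrightarrow> br x (scale c y) = scale c (br x y)"
    and br_degree: "\<lbrakk>x \<in> L m; y \<in> L n\<rbrakk> \<Longrightarrow> br x y \<in> L (m + n)"
    and br_skew: "\<lbrakk>x \<in> L m; y \<in> L n\<rbrakk> \<Longrightarrow> br x y = - scale ((-1) ^ (m * n)) (br y x)"
    and br_jacobi: "\<lbrakk>x \<in> L m; y \<in> L n; z \<in> L p\<rbrakk>
          \<Longrightarrow> br x (br y z) = br (br x y) z + scale ((-1) ^ (m * n)) (br y (br x z))"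
    and d_add: "\<lbrakk>x \<in> span (\<Union>n. L n); y \<in> span (\<Union>n. L n)\<rbrakk> \<Longrightarrow> d (x + y) = d x + d y"
    and d_scale: "x \<in> span (\<Union>n. L n) \<Longrightarrow> d (scale c x) = scale c (d x)"
    and d_degree: "x \<in> L n \<Longrightarrow> d x \<in> L (Suc n)"
    and d_square: "x \<in> L n \<Longrightarrow> d (d x) = 0"
    and d_derivation: "\<lbrakk>x \<in> L m; y \<in> L n\<rbrakk>
          \<Longrightarrow> d (br x y) = br (d x) y + scale ((-1) ^ m) (br x (d y))"

definition maurer_cartan ::
  "('k::field \<Rightarrow> 'a::ab_group_add \<Rightarrow> 'a) \<Rightarrow> (nat \<Rightarrow> 'a set) \<Rightarrow> ('a \<Rightarrow> 'a \<Rightarrow> 'a) \<Rightarrow> ('a \<Rightarrow> 'a) \<Rightarrow> 'a \<Rightarrow> bool" where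
  "maurer_cartan scale L br d x \<longleftrightarrow> x \<in> L 1 \<and> d x + scale (1/2) (br x x) = 0"

section \<open>Cochains and the Nijenhuis-Richardson bracket\<close>

text \<open>
  A cochain of arity \<open>n\<close> is a function on lists that vanishes on all lists of length \<open>\<noteq> n\<close>.
  Thus cochains of all arities share one type and their direct sum is internal to it.
\<close>

definition Hom_wedge ::
  "('k::field \<Rightarrow> 'a::ab_group_add \<Rightarrow> 'a) \<Rightarrow> ('k \<Rightarrow> 'b::ab_group_add \<Rightarrow> 'b) \<Rightarrow> nat \<Rightarrow> ('a list \<Rightarrow> 'b) set" where
  "Hom_wedge s1 s2 n =
     {f. (\<forall>xs. length xs \<noteq> n \<longrightarrow> f xs = 0) \<and>
         (\<forall>xs i. length xs = n \<and> i < n \<longrightarrow> Vector_Spaces.linear s1 s2 (\<lambda>x. f (xs[i := x]))) \<and>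
         (\<forall>xs i j. length xs = n \<and> i < j \<and> j < n \<and> xs ! i = xs ! j \<longrightarrow> f xs = 0)}"

text \<open>\<open>Hom_wedge_tensor sg sv n\<close> is \<open>Hom (\<Lambda>\<^sup>n g \<otimes> V, V)\<close>.\<close>

definition Hom_wedge_tensor ::
  "('k::field \<Rightarrow> 'g::ab_group_add \<Rightarrow> 'g) \<Rightarrow> ('k \<Rightarrow> 'v::ab_group_add \<Rightarrow> 'v) \<Rightarrow> nat
    \<Rightarrow> ('g list \<Rightarrow> 'v \<Rightarrow> 'v) set" where
  "Hom_wedge_tensor sg sv n =
     {q. (\<forall>v. (\<lambda>xs. q xs v) \<in> Hom_wedge sg sv n) \<and> (\<forall>xs. Vector_Spaces.linear sv sv (q xs))}"

definition shuffle_perms :: "nat \<Rightarrow> nat \<Rightarrow> (nat \<Rightarrow> nat) set" where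
  "shuffle_perms p q =
     {\<sigma>. \<sigma> permutes {..<p + q} \<and> strict_mono_on {..<p} \<sigma> \<and> strict_mono_on {p..<p + q} \<sigma>}"

definition nr_comp ::
  "('k::field \<Rightarrow> 'l::ab_group_add \<Rightarrow> 'l) \<Rightarrow> nat \<Rightarrow> nat \<Rightarrow> ('l list \<Rightarrow> 'l) \<Rightarrow> ('l list \<Rightarrow> 'l) \<Rightarrow> 'l list \<Rightarrow> 'l" where
  "nr_comp scale m n f g = (\<lambda>ls.
     if length ls = m + n - 1
     then \<Sum>\<sigma>\<in>shuffle_perms n (m - 1).
            scale (of_int (sign \<sigma>))
              (f (g (map (\<lambda>i. ls ! \<sigma> i) [0..<n]) # map (\<lambda>i. ls ! \<sigma> i) [n..<m + n - 1]))
     else 0)"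

text \<open>The bracket of a cochain \<open>f\<close> of arity \<open>m \<ge> 1\<close> with a cochain \<open>g\<close> of arity \<open>n \<ge> 1\<close>.\<close>

definition nr_bracket ::
  "('k::field \<Rightarrow> 'l::ab_group_add \<Rightarrow> 'l) \<Rightarrow> nat \<Rightarrow> nat \<Rightarrow> ('l list \<Rightarrow> 'l) \<Rightarrow> ('l list \<Rightarrow> 'l) \<Rightarrow> 'l list \<Rightarrow> 'l" where
  "nr_bracket scale m n f g = (\<lambda>ls.
     nr_comp scale m n f g ls - scale ((-1) ^ ((m - 1) * (n - 1))) (nr_comp scale n m g f ls))"

section \<open>The space \<open>l = g \<oplus> g' \<oplus> V \<oplus> V'\<close> and the cochains \<open>\<theta>\<close>, \<open>\<theta>'\<close>\<close>

type_synonym ('g, 'v) quad = "'g \<times> 'g \<times> 'v \<times> 'v"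

fun pr_g :: "('g, 'v) quad \<Rightarrow> 'g" where "pr_g (x, x', v, v') = x"
fun pr_g' :: "('g, 'v) quad \<Rightarrow> 'g" where "pr_g' (x, x', v, v') = x'"
fun pr_V :: "('g, 'v) quad \<Rightarrow> 'v" where "pr_V (x, x', v, v') = v"
fun pr_V' :: "('g, 'v) quad \<Rightarrow> 'v" where "pr_V' (x, x', v, v') = v'"

definition in_g :: "'g \<Rightarrow> ('g::ab_group_add, 'v::ab_group_add) quad" where "in_g x = (x, 0, 0, 0)"
definition in_g' :: "'g \<Rightarrow> ('g::ab_group_add, 'v::ab_group_add) quad" where "in_g' x = (0, x, 0, 0)"
definition in_V :: "'v \<Rightarrow> ('g::ab_group_add, 'v::ab_group_add) quad" where "in_V v = (0, 0, v, 0)"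
definition in_V' :: "'v \<Rightarrow> ('g::ab_group_add, 'v::ab_group_add) quad" where "in_V' v = (0, 0, 0, v)"

definition quad_scale ::
  "('k \<Rightarrow> 'g \<Rightarrow> 'g) \<Rightarrow> ('k \<Rightarrow> 'v \<Rightarrow> 'v) \<Rightarrow> 'k \<Rightarrow> ('g, 'v) quad \<Rightarrow> ('g, 'v) quad" where
  "quad_scale sg sv c = (\<lambda>(x, x', v, v'). (sg c x, sg c x', sv c v, sv c v'))"

text \<open>
  Extension by zero of a skew-symmetric bilinear map on one summand of \<open>l\<close> (projection \<open>pr\<close>,
  the target summand having inclusion \<open>inc\<close>), and skew-symmetric extension by zero of a bilinear
  map on the product of two different summands (projections \<open>pr1\<close>, \<open>pr2\<close>).
\<close>

definition ext_same :: "('l \<Rightarrow> 'a) \<Rightarrow> ('c \<Rightarrow> 'l) \<Rightarrow> ('a \<Rightarrow> 'a \<Rightarrow> 'c) \<Rightarrow> 'l list \<Rightarrow> 'l::ab_group_add" where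
  "ext_same pr inc b ls = (if length ls = 2 then inc (b (pr (ls ! 0)) (pr (ls ! 1))) else 0)"

definition ext_mixed ::
  "('l \<Rightarrow> 'a) \<Rightarrow> ('l \<Rightarrow> 'b) \<Rightarrow> ('c \<Rightarrow> 'l) \<Rightarrow> ('a \<Rightarrow> 'b \<Rightarrow> 'c) \<Rightarrow> 'l list \<Rightarrow> 'l::ab_group_add" where
  "ext_mixed pr1 pr2 inc b ls =
     (if length ls = 2
      then inc (b (pr1 (ls ! 0)) (pr2 (ls ! 1))) - inc (b (pr1 (ls ! 1)) (pr2 (ls ! 0)))
      else 0)"

text \<open>The summands are, in order, \<open>\<mu>\<close>, \<open>ad'\<close>, \<open>\<rho>\<close>, \<open>\<rho>'\<close>, \<open>\<varrho>\<close>.\<close>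

definition theta ::
  "('g \<Rightarrow> 'g \<Rightarrow> 'g) \<Rightarrow> ('g \<Rightarrow> 'v \<Rightarrow> 'v) \<Rightarrow> ('g::ab_group_add, 'v::ab_group_add) quad list \<Rightarrow> ('g, 'v) quad" where
  "theta lie \<rho> =
     ext_same pr_g in_g lie + ext_mixed pr_g pr_g' in_g' lie + ext_mixed pr_g pr_V in_V \<rho>
     + ext_mixed pr_g pr_V' in_V' \<rho> + ext_mixed pr_g' pr_V in_V' \<rho>"

definition theta' ::
  "('k \<Rightarrow> 'g \<Rightarrow> 'g) \<Rightarrow> ('g \<Rightarrow> 'g \<Rightarrow> 'g) \<Rightarrow> ('k \<Rightarrow> 'v \<Rightarrow> 'v) \<Rightarrow> ('g \<Rightarrow> 'v \<Rightarrow> 'v) \<Rightarrow> 'k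
    \<Rightarrow> ('g::ab_group_add, 'v::ab_group_add) quad list \<Rightarrow> ('g, 'v) quad" where
  "theta' sg lie sv \<rho> lam =
     - (ext_same pr_g' in_g' (\<lambda>x y. sg lam (lie x y))
        + ext_mixed pr_g' pr_V' in_V' (\<lambda>x v. sv lam (\<rho> x v)))"

section \<open>The graded space of paired cochains\<close>

type_synonym ('g, 'v) paired = "('g list \<Rightarrow> 'g) \<times> ('g list \<Rightarrow> 'v \<Rightarrow> 'v)"

definition paired_scale ::
  "('k \<Rightarrow> 'g \<Rightarrow> 'g) \<Rightarrow> ('k \<Rightarrow> 'v \<Rightarrow> 'v) \<Rightarrow> 'k \<Rightarrow> ('g, 'v) paired \<Rightarrow> ('g, 'v) paired" where
  "paired_scale sg sv c P = (\<lambda>xs. sg c (fst P xs), \<lambda>xs v. sv c (snd P xs v))"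

definition paired_cochains ::
  "('k::field \<Rightarrow> 'g::ab_group_add \<Rightarrow> 'g) \<Rightarrow> ('k \<Rightarrow> 'v::ab_group_add \<Rightarrow> 'v) \<Rightarrow> nat \<Rightarrow> ('g, 'v) paired set" where
  "paired_cochains sg sv n =
     (if n = 0 then {0} else Hom_wedge sg sg n \<times> Hom_wedge_tensor sg sv (n - 1))"

definition paired_component :: "nat \<Rightarrow> ('g, 'v) paired \<Rightarrow> ('g::ab_group_add, 'v::ab_group_add) paired" where
  "paired_component n P =
     (\<lambda>xs. if length xs = n then fst P xs else 0,
      \<lambda>xs v. if length xs + 1 = n then snd P xs v else 0)"

definition paired_support :: "('g::ab_group_add, 'v::ab_group_add) paired \<Rightarrow> nat set" where
  "paired_support P = {n. paired_component n P \<noteq> 0}"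

text \<open>
  The identification with a subspace of the cochains on \<open>l\<close>. A pair \<open>(p, q)\<close> of degree \<open>n\<close> is sent
  to the sum of the extension by zero of \<open>p\<close>, read as a map from \<open>g'\<close> to \<open>g\<close>, and of the
  skew-symmetric extension by zero of \<open>q\<close>, read as a map from \<open>g'\<close> and \<open>V'\<close> to \<open>V\<close>. In the latter,
  the sign comes from moving the \<open>i\<close>-th of the \<open>n\<close> arguments (counted from 0) to the last position.
\<close>

definition paired_embed ::
  "('g::ab_group_add, 'v::ab_group_add) paired \<Rightarrow> ('g, 'v) quad list \<Rightarrow> ('g, 'v) quad" where
  "paired_embed P ls =
     in_g (fst P (map pr_g' ls)) +
     (\<Sum>i<length ls.
        let t = in_V (snd P (map pr_g' (take i ls @ drop (Suc i) ls)) (pr_V' (ls ! i)))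
        in if even (length ls - 1 - i) then t else - t)"

section \<open>The bracket and the differential\<close>

text \<open>
  For \<open>P\<close> of degree \<open>m\<close> and \<open>Q\<close> of degree \<open>n\<close>: first as cochains on \<open>l\<close>, then as paired cochains
  via the identification above.
\<close>

definition derived_bracket ::
  "('k::field \<Rightarrow> 'g::ab_group_add \<Rightarrow> 'g) \<Rightarrow> ('g \<Rightarrow> 'g \<Rightarrow> 'g) \<Rightarrow> ('k \<Rightarrow> 'v::ab_group_add \<Rightarrow> 'v)
    \<Rightarrow> ('g \<Rightarrow> 'v \<Rightarrow> 'v) \<Rightarrow> nat \<Rightarrow> nat \<Rightarrow> ('g, 'v) paired \<Rightarrow> ('g, 'v) paired
    \<Rightarrow> ('g, 'v) quad list \<Rightarrow> ('g, 'v) quad" where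
  "derived_bracket sg lie sv \<rho> m n P Q = (\<lambda>ls. quad_scale sg sv ((-1) ^ m)
     (nr_bracket (quad_scale sg sv) (m + 1) n
        (nr_bracket (quad_scale sg sv) 2 m (theta lie \<rho>) (paired_embed P)) (paired_embed Q) ls))"

definition derived_diff ::
  "('k::field \<Rightarrow> 'g::ab_group_add \<Rightarrow> 'g) \<Rightarrow> ('g \<Rightarrow> 'g \<Rightarrow> 'g) \<Rightarrow> ('k \<Rightarrow> 'v::ab_group_add \<Rightarrow> 'v)
    \<Rightarrow> ('g \<Rightarrow> 'v \<Rightarrow> 'v) \<Rightarrow> 'k \<Rightarrow> nat \<Rightarrow> ('g, 'v) paired \<Rightarrow> ('g, 'v) quad list \<Rightarrow> ('g, 'v) quad" where
  "derived_diff sg lie sv \<rho> lam n P =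
     nr_bracket (quad_scale sg sv) 2 n (theta' sg lie sv \<rho> lam) (paired_embed P)"

definition paired_bracket_homog ::
  "('k::field \<Rightarrow> 'g::ab_group_add \<Rightarrow> 'g) \<Rightarrow> ('g \<Rightarrow> 'g \<Rightarrow> 'g) \<Rightarrow> ('k \<Rightarrow> 'v::ab_group_add \<Rightarrow> 'v)
    \<Rightarrow> ('g \<Rightarrow> 'v \<Rightarrow> 'v) \<Rightarrow> nat \<Rightarrow> nat \<Rightarrow> ('g, 'v) paired \<Rightarrow> ('g, 'v) paired \<Rightarrow> ('g, 'v) paired" where
  "paired_bracket_homog sg lie sv \<rho> m n P Q =
     the_inv_into (paired_cochains sg sv (m + n)) paired_embed (derived_bracket sg lie sv \<rho> m n P Q)"

definition paired_diff_homog ::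
  "('k::field \<Rightarrow> 'g::ab_group_add \<Rightarrow> 'g) \<Rightarrow> ('g \<Rightarrow> 'g \<Rightarrow> 'g) \<Rightarrow> ('k \<Rightarrow> 'v::ab_group_add \<Rightarrow> 'v)
    \<Rightarrow> ('g \<Rightarrow> 'v \<Rightarrow> 'v) \<Rightarrow> 'k \<Rightarrow> nat \<Rightarrow> ('g, 'v) paired \<Rightarrow> ('g, 'v) paired" where
  "paired_diff_homog sg lie sv \<rho> lam n P =
     the_inv_into (paired_cochains sg sv (n + 1)) paired_embed (derived_diff sg lie sv \<rho> lam n P)"

text \<open>(Bi)linear extensions to the direct sum.\<close>

definition paired_bracket ::
  "('k::field \<Rightarrow> 'g::ab_group_add \<Rightarrow> 'g) \<Rightarrow> ('g \<Rightarrow> 'g \<Rightarrow> 'g) \<Rightarrow> ('k \<Rightarrow> 'v::ab_group_add \<Rightarrow> 'v)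
    \<Rightarrow> ('g \<Rightarrow> 'v \<Rightarrow> 'v) \<Rightarrow> ('g, 'v) paired \<Rightarrow> ('g, 'v) paired \<Rightarrow> ('g, 'v) paired" where
  "paired_bracket sg lie sv \<rho> P Q =
     (\<Sum>m\<in>paired_support P. \<Sum>n\<in>paired_support Q.
        paired_bracket_homog sg lie sv \<rho> m n (paired_component m P) (paired_component n Q))"

definition paired_diff ::
  "('k::field \<Rightarrow> 'g::ab_group_add \<Rightarrow> 'g) \<Rightarrow> ('g \<Rightarrow> 'g \<Rightarrow> 'g) \<Rightarrow> ('k \<Rightarrow> 'v::ab_group_add \<Rightarrow> 'v)
    \<Rightarrow> ('g \<Rightarrow> 'v \<Rightarrow> 'v) \<Rightarrow> 'k \<Rightarrow> ('g, 'v) paired \<Rightarrow> ('g, 'v) paired" where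
  "paired_diff sg lie sv \<rho> lam P =
     (\<Sum>n\<in>paired_support P. paired_diff_homog sg lie sv \<rho> lam n (paired_component n P))"

text \<open>A pair of maps \<open>g \<Rightarrow> g\<close> and \<open>V \<Rightarrow> V\<close>, as a paired cochain of degree 1.\<close>

definition paired_of_maps ::
  "('g \<Rightarrow> 'g) \<Rightarrow> ('v \<Rightarrow> 'v) \<Rightarrow> ('g::ab_group_add, 'v::ab_group_add) paired" where
  "paired_of_maps T T' =
     (\<lambda>xs. if length xs = 1 then T (hd xs) else 0, \<lambda>xs v. if xs = [] then T' v else 0)"

end

theory Submission
  imports Defs
begin

text \<open>
  Let \<open>h\<close> be the semidirect product of \<open>g\<close> and \<open>V\<close>. Then
  \<open>l = g \<oplus> g' \<oplus> V \<oplus> V'\<close> is \<open>h \<oplus> \<epsilon>h\<close>, the primed summands being the multiples of \<open>\<epsilon>\<close>. The cochain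
  \<open>\<theta>\<close> is the Lie bracket of \<open>h \<otimes> k[\<epsilon>]/(\<epsilon>\<^sup>2)\<close>, and \<open>\<theta> - \<theta>'\<close> is that of
  \<open>h \<otimes> k[\<epsilon>]/(\<epsilon>\<^sup>2 - \<lambda>\<epsilon>)\<close>. Hence \<open>[\<theta>,\<theta>] = [\<theta>,\<theta>'] = [\<theta>',\<theta>'] = 0\<close>, so that \<open>[\<theta>,-]\<close> and \<open>[\<theta>',-]\<close> are
  anticommuting odd derivations of square zero of the Nijenhuis-Richardson Lie algebra. Cochains
  with arguments in \<open>h' = g' \<oplus> V'\<close> and values in \<open>h\<close> have vanishing mutual brackets, because the
  values of one are inserted into the other, which vanishes on \<open>h\<close>. On such an abelian subalgebra the derived bracket
  \<open>(-1)\<^sup>m [[\<theta>,P],Q]\<close> is a graded Lie bracket of which \<open>[\<theta>',-]\<close> is a derivation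
  (\<open>dbracket_skew\<close>, \<open>dbracket_jacobi\<close>, \<open>differential_derivation\<close>), as soon as both operations
  preserve the subalgebra. On degree 1 the Maurer-Cartan equation, evaluated on \<open>g' \<times> g'\<close> and on
  \<open>V' \<times> g'\<close>, amounts to the two Rota-Baxter identities (\<open>mc_lhs_values\<close>).

  Two devices carry the work. The first is contraction, that is, fixing the first argument of a
  cochain. It is a graded derivation of the Nijenhuis-Richardson product
  (\<open>contract_nr_comp\<close>), and the signs of shuffles enter only there. Two cochains
  agree when all their contractions agree, so every further identity follows by induction on the
  arity: closure of the product, the graded pre-Lie identity \<open>associator_symmetric\<close>, and from it
  the graded Jacobi identity \<open>nr_bracket_jacobi\<close>.

  The second device is weights. In positive arity, the paired cochains are singled out by two equivariance
  conditions, under doubling the unprimed summands and under doubling \<open>V\<close> and \<open>V'\<close>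
  (\<open>embedded_is_image\<close>; here characteristic 0 enters). Weights multiply under the bracket
  (\<open>nr_bracket_has_weight\<close>), so that \<open>[[\<theta>,P],Q]\<close> and \<open>[\<theta>',P]\<close> are seen to be paired cochains again
  without computing them.
\<close>

section \<open>Splitting shuffles by the position of the first argument\<close>

text \<open>
  A permutation of \<open>{..<N}\<close> transported to \<open>{1..N}\<close> and fixing 0; the arguments after the first one
  are permuted.
\<close>

definition lift_perm :: "(nat \<Rightarrow> nat) \<Rightarrow> nat \<Rightarrow> nat" where
  "lift_perm \<sigma> i = (case i of 0 \<Rightarrow> 0 | Suc j \<Rightarrow> Suc (\<sigma> j))"

lemma lift_perm_simps [simp]:
  "lift_perm \<sigma> 0 = 0" "lift_perm \<sigma> (Suc j) = Suc (\<sigma> j)"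
  by (simp_all add: lift_perm_def)

lemma lift_perm_eq_map_permutation:
  assumes "\<sigma> permutes {..<N}"
  shows "lift_perm \<sigma> = map_permutation {..<N} Suc \<sigma>"
proof
  fix i
  show "lift_perm \<sigma> i = map_permutation {..<N} Suc \<sigma> i"
  proof (cases i)
    case 0
    then show ?thesis by (auto simp: map_permutation_def restrict_id_def)
  next
    case (Suc j)
    show ?thesis
    proof (cases "j < N")
      case True
      then show ?thesis using Suc map_permutation_apply[of Suc "{..<N}" j \<sigma>] by simp
    next
      case False
      then show ?thesis using Suc assms
        by (auto simp: map_permutation_def restrict_id_def permutes_not_in)
    qed
  qed
qed

lemma sign_lift_perm:
  assumes "\<sigma> permutes {..<N}"
  shows "sign (lift_perm \<sigma>) = sign \<sigma>"
  by (simp add: lift_perm_eq_map_permutation[OF assms] sign_map_permutation[OF _ assms])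

lemma lift_perm_permutes:
  assumes "\<sigma> permutes {..<N}"
  shows "lift_perm \<sigma> permutes {..<Suc N}"
proof -
  have "lift_perm \<sigma> permutes (Suc ` {..<N})"
    unfolding lift_perm_eq_map_permutation[OF assms]
    by (rule map_permutation_permutes[OF _ assms]) (simp add: bij_betw_def)
  then show ?thesis by (rule permutes_subset) auto
qed

lemma fixing_zero_is_lift_perm:
  assumes \<sigma>: "\<sigma> permutes {..<Suc N}" and 0: "\<sigma> 0 = 0"
  obtains \<tau> where "\<tau> permutes {..<N}" "\<sigma> = lift_perm \<tau>"
proof
  define \<tau> where "\<tau> j = \<sigma> (Suc j) - 1" for j
  have inj: "inj \<sigma>" using \<sigma> by (rule permutes_inj)
  have Suc_\<tau>: "Suc (\<tau> j) = \<sigma> (Suc j)" for j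
    using injD[OF inj, of "Suc j" 0] 0 unfolding \<tau>_def by (cases "\<sigma> (Suc j)") auto
  show "\<sigma> = lift_perm \<tau>"
  proof
    fix i show "\<sigma> i = lift_perm \<tau> i" by (cases i) (auto simp: 0 Suc_\<tau>)
  qed
  have "\<exists>!x. \<tau> x = y" for y
  proof -
    obtain x where x: "\<sigma> x = Suc y" using permutes_surj[OF \<sigma>] by (metis surjD)
    then obtain j where "x = Suc j" using 0 by (cases x) auto
    then have "\<tau> j = y" using x by (simp add: \<tau>_def)
    moreover have "j' = j" if "\<tau> j' = y" for j'
      using that \<open>\<tau> j = y\<close> Suc_\<tau>[of j'] Suc_\<tau>[of j] injD[OF inj, of "Suc j'" "Suc j"] by auto
    ultimately show ?thesis by blast
  qed
  moreover have "\<tau> j = j" if "j \<notin> {..<N}" for j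
    using that permutes_not_in[OF \<sigma>, of "Suc j"] by (simp add: \<tau>_def)
  ultimately show "\<tau> permutes {..<N}" unfolding permutes_def by blast
qed

text \<open>
  Precomposition with this cycle turns a permutation fixing 0 into one that takes the value 0 at the
  position \<open>p\<close>, while the order of the other values is kept.
\<close>

definition cycle_to_front :: "nat \<Rightarrow> nat \<Rightarrow> nat" where
  "cycle_to_front p i = (if i < p then Suc i else if i = p then 0 else i)"

lemma cycle_to_front_Suc: "cycle_to_front (Suc p) = cycle_to_front p \<circ> transpose p (Suc p)"
  by (auto simp: cycle_to_front_def transpose_def fun_eq_iff)

lemma cycle_to_front_permutes: "cycle_to_front p permutes {..p}"
proof (induction p)
  case 0
  have "cycle_to_front 0 = id" by (auto simp: cycle_to_front_def fun_eq_iff)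
  then show ?case by (simp only: permutes_id)
next
  case (Suc p)
  show ?case unfolding cycle_to_front_Suc
    by (rule permutes_compose[OF permutes_swap_id permutes_subset[OF Suc]]) auto
qed

lemma sign_cycle_to_front: "sign (cycle_to_front p) = (-1) ^ p"
proof (induction p)
  case 0
  have "cycle_to_front 0 = id" by (auto simp: cycle_to_front_def fun_eq_iff)
  then show ?case by simp
next
  case (Suc p)
  have "permutation (cycle_to_front p)"
    using cycle_to_front_permutes permutation_permutes by blast
  then have "sign (cycle_to_front (Suc p)) =
      sign (cycle_to_front p) * sign (transpose p (Suc p))"
    unfolding cycle_to_front_Suc by (intro sign_compose permutation_swap_id)
  then show ?case by (simp add: sign_swap_id Suc)
qed

lemma shuffle_perms_zero_in_first:
  "{\<sigma> \<in> shuffle_perms (Suc p) q. \<sigma> 0 = 0} = lift_perm ` shuffle_perms p q" (is "?L = ?R")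
proof
  show "?L \<subseteq> ?R"
  proof
    fix \<sigma> assume "\<sigma> \<in> ?L"
    then have \<sigma>: "\<sigma> permutes {..<Suc (p + q)}" "\<sigma> 0 = 0"
        "strict_mono_on {..<Suc p} \<sigma>" "strict_mono_on {Suc p..<Suc (p + q)} \<sigma>"
      by (auto simp: shuffle_perms_def)
    obtain \<tau> where \<tau>: "\<tau> permutes {..<p + q}" "\<sigma> = lift_perm \<tau>"
      using fixing_zero_is_lift_perm[OF \<sigma>(1,2)] .
    have "\<tau> i < \<tau> j" if "i < j" "j < p" for i j
      using strict_mono_onD[OF \<sigma>(3), of "Suc i" "Suc j"] that \<tau>(2) by simp
    moreover have "\<tau> i < \<tau> j" if "p \<le> i" "i < j" "j < p + q" for i j
      using strict_mono_onD[OF \<sigma>(4), of "Suc i" "Suc j"] that \<tau>(2) by simp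
    ultimately have "\<tau> \<in> shuffle_perms p q"
      using \<tau>(1) by (auto simp: shuffle_perms_def intro!: strict_mono_onI)
    then show "\<sigma> \<in> ?R" using \<tau>(2) by blast
  qed
  show "?R \<subseteq> ?L"
  proof (safe)
    fix \<tau> assume \<tau>: "\<tau> \<in> shuffle_perms p q"
    have "lift_perm \<tau> i < lift_perm \<tau> j" if "i < j" "j < Suc p" for i j
      using \<tau> that by (cases i; cases j) (auto simp: shuffle_perms_def strict_mono_on_def)
    moreover have "lift_perm \<tau> i < lift_perm \<tau> j" if "Suc p \<le> i" "i < j" "j < Suc (p + q)" for i j
      using \<tau> that by (cases i; cases j) (auto simp: shuffle_perms_def strict_mono_on_def)
    moreover have "lift_perm \<tau> permutes {..<Suc (p + q)}"
      using \<tau> by (intro lift_perm_permutes) (simp add: shuffle_perms_def)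
    ultimately show "lift_perm \<tau> \<in> shuffle_perms (Suc p) q"
      by (auto simp: shuffle_perms_def intro!: strict_mono_onI)
  qed simp
qed

text \<open>
  A shuffle that puts the first argument at the head of the second block arises from a shuffle of
  the other arguments by moving it past the \<open>p\<close> entries of the first block, which costs the
  sign \<open>(-1)\<^sup>p\<close> of the cycle.
\<close>

lemma shuffle_perms_zero_in_second:
  "{\<sigma> \<in> shuffle_perms p (Suc q). \<sigma> p = 0} =
     (\<lambda>\<tau>. lift_perm \<tau> \<circ> cycle_to_front p) ` shuffle_perms p q" (is "?L = ?R")
proof
  have cyc: "cycle_to_front p permutes {..<Suc (p + q)}"
    by (rule permutes_subset[OF cycle_to_front_permutes]) auto
  show "?L \<subseteq> ?R"
  proof
    fix \<sigma> assume "\<sigma> \<in> ?L"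
    then have \<sigma>: "\<sigma> permutes {..<Suc (p + q)}" "\<sigma> p = 0"
        "strict_mono_on {..<p} \<sigma>" "strict_mono_on {p..<Suc (p + q)} \<sigma>"
      by (auto simp: shuffle_perms_def)
    (* undoing the cycle brings the value 0 back to the position 0 *)
    define \<sigma>' where "\<sigma>' = \<sigma> \<circ> inv (cycle_to_front p)"
    have perm: "\<sigma>' permutes {..<Suc (p + q)}"
      unfolding \<sigma>'_def by (rule permutes_compose[OF permutes_inv[OF cyc] \<sigma>(1)])
    have eq: "\<sigma> = \<sigma>' \<circ> cycle_to_front p"
      using permutes_inv_o(2)[OF cyc] by (simp add: \<sigma>'_def o_assoc[symmetric])
    have "\<sigma>' 0 = 0"
      using \<sigma>(2) unfolding eq by (simp add: cycle_to_front_def)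
    then obtain \<tau> where \<tau>: "\<tau> permutes {..<p + q}" "\<sigma>' = lift_perm \<tau>"
      using fixing_zero_is_lift_perm[OF perm] by blast
    have "\<tau> i < \<tau> j" if "i < j" "j < p" for i j
      using strict_mono_onD[OF \<sigma>(3), of "i" "j"] that \<tau>(2) by (simp add: eq cycle_to_front_def)
    moreover have "\<tau> i < \<tau> j" if "p \<le> i" "i < j" "j < p + q" for i j
      using strict_mono_onD[OF \<sigma>(4), of "Suc i" "Suc j"] that \<tau>(2)
      by (simp add: eq cycle_to_front_def)
    ultimately have "\<tau> \<in> shuffle_perms p q"
      using \<tau>(1) by (auto simp: shuffle_perms_def intro!: strict_mono_onI)
    then show "\<sigma> \<in> ?R" using \<tau>(2) eq by blast
  qed
  show "?R \<subseteq> ?L"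
  proof (safe)
    fix \<tau> assume \<tau>: "\<tau> \<in> shuffle_perms p q"
    let ?s = "lift_perm \<tau> \<circ> cycle_to_front p"
    have "?s i < ?s j" if "i < j" "j < p" for i j
      using \<tau> that by (auto simp: shuffle_perms_def strict_mono_on_def cycle_to_front_def)
    moreover have "?s i < ?s j" if "p \<le> i" "i < j" "j < Suc (p + q)" for i j
      using \<tau> that
      by (cases i; cases j) (auto simp: shuffle_perms_def strict_mono_on_def cycle_to_front_def)
    moreover have "?s permutes {..<Suc (p + q)}"
      using \<tau> by (intro permutes_compose[OF cyc] lift_perm_permutes) (simp add: shuffle_perms_def)
    ultimately show "?s \<in> shuffle_perms p (Suc q)"
      by (auto simp: shuffle_perms_def intro!: strict_mono_onI)
  qed (simp add: cycle_to_front_def)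
qed

text \<open>
  A shuffle is increasing on both blocks, so its least value sits at the head of one of them.
\<close>

lemma shuffle_perms_zero:
  assumes "\<sigma> \<in> shuffle_perms p q" "0 < p + q"
  shows "0 < p \<and> \<sigma> 0 = 0 \<or> 0 < q \<and> \<sigma> p = 0"
proof -
  have \<sigma>: "\<sigma> permutes {..<p + q}" "strict_mono_on {..<p} \<sigma>" "strict_mono_on {p..<p + q} \<sigma>"
    using assms(1) by (auto simp: shuffle_perms_def)
  obtain j where j: "\<sigma> j = 0" using permutes_surj[OF \<sigma>(1)] by (metis surjD)
  then have "j < p + q" using assms(2) permutes_not_in[OF \<sigma>(1), of j] by auto
  show ?thesis
  proof (cases "j < p")
    case True
    then have "j = 0" using strict_mono_onD[OF \<sigma>(2), of 0 j] j by auto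
    then show ?thesis using j True by simp
  next
    case False
    then have "j = p" using strict_mono_onD[OF \<sigma>(3), of p j] j \<open>j < p + q\<close> by (cases "p = j") auto
    then show ?thesis using j \<open>j < p + q\<close> by simp
  qed
qed

lemma finite_shuffle_perms: "finite (shuffle_perms p q)"
  by (rule finite_subset[OF _ finite_permutations[of "{..<p+q}"]]) (auto simp: shuffle_perms_def)

lemma sum_shuffle_perms:
  fixes F :: "(nat \<Rightarrow> nat) \<Rightarrow> 'a::ab_group_add"
  assumes "0 < p + q"
  shows "(\<Sum>\<sigma>\<in>shuffle_perms p q. F \<sigma>) =
      (if p = 0 then 0 else \<Sum>\<tau>\<in>shuffle_perms (p - 1) q. F (lift_perm \<tau>)) +
      (if q = 0 then 0 else \<Sum>\<tau>\<in>shuffle_perms p (q - 1). F (lift_perm \<tau> \<circ> cycle_to_front p))"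
proof -
  have inj1: "inj lift_perm"
  proof (rule injI, rule ext)
    fix \<sigma> \<tau> :: "nat \<Rightarrow> nat" and i
    assume "lift_perm \<sigma> = lift_perm \<tau>"
    then show "\<sigma> i = \<tau> i" by (metis lift_perm_simps(2) nat.inject)
  qed
  have surj: "surj (cycle_to_front p)"
    using permutes_surj cycle_to_front_permutes by blast
  have inj2: "inj (\<lambda>\<tau>. lift_perm \<tau> \<circ> cycle_to_front p)"
  proof (rule injI)
    fix \<sigma> \<tau> assume eq: "lift_perm \<sigma> \<circ> cycle_to_front p = lift_perm \<tau> \<circ> cycle_to_front p"
    have "lift_perm \<sigma> i = lift_perm \<tau> i" for i
    proof -
      obtain j where "i = cycle_to_front p j" using surj by (metis surjD)
      then show ?thesis using fun_cong[OF eq, of j] by simp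
    qed
    then show "\<sigma> = \<tau>" using injD[OF inj1] by blast
  qed
  define A where "A = {\<sigma> \<in> shuffle_perms p q. 0 < p \<and> \<sigma> 0 = 0}"
  define B where "B = {\<sigma> \<in> shuffle_perms p q. 0 < q \<and> \<sigma> p = 0}"
  have "shuffle_perms p q = A \<union> B"
    using shuffle_perms_zero[OF _ assms] unfolding A_def B_def by blast
  moreover have "A \<inter> B = {}"
  proof -
    have False if "\<sigma> \<in> shuffle_perms p q" "0 < p" "\<sigma> 0 = 0" "\<sigma> p = 0" for \<sigma>
      using that permutes_inj[of \<sigma> "{..<p+q}"] injD[of \<sigma> 0 p] by (auto simp: shuffle_perms_def)
    then show ?thesis by (auto simp: A_def B_def)
  qed
  moreover have "finite A" "finite B"
    using finite_shuffle_perms by (auto simp: A_def B_def)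
  ultimately have "(\<Sum>\<sigma>\<in>shuffle_perms p q. F \<sigma>) = sum F A + sum F B"
    by (simp add: sum.union_disjoint)
  moreover have "sum F A = (if p = 0 then 0 else \<Sum>\<tau>\<in>shuffle_perms (p - 1) q. F (lift_perm \<tau>))"
  proof (cases p)
    case (Suc p')
    then have "A = lift_perm ` shuffle_perms p' q"
      using shuffle_perms_zero_in_first[of p' q] by (simp add: A_def)
    then show ?thesis
      using Suc by (simp add: sum.reindex[OF inj_on_subset[OF inj1]])
  qed (simp add: A_def)
  moreover have "sum F B =
      (if q = 0 then 0 else \<Sum>\<tau>\<in>shuffle_perms p (q - 1). F (lift_perm \<tau> \<circ> cycle_to_front p))"
  proof (cases q)
    case (Suc q')
    then have "B = (\<lambda>\<tau>. lift_perm \<tau> \<circ> cycle_to_front p) ` shuffle_perms p q'"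
      using shuffle_perms_zero_in_second[of p q'] by (simp add: B_def)
    then show ?thesis
      using Suc by (simp add: sum.reindex[OF inj_on_subset[OF inj2]])
  qed (simp add: B_def)
  ultimately show ?thesis by simp
qed

section \<open>Alternating maps through contraction\<close>

definition signed :: "nat \<Rightarrow> 'a::ab_group_add \<Rightarrow> 'a" where
  "signed k a = (if even k then a else - a)"

lemma signed_0 [simp]: "signed k 0 = 0"
  by (simp add: signed_def)

lemma signed_inject: "signed k a = signed k b \<longleftrightarrow> a = b"
  by (simp add: signed_def)

lemma signed_add: "signed k (a + b) = signed k a + signed k b"
  by (simp add: signed_def)

lemma signed_Suc: "signed (Suc k) a = - signed k a"
  by (simp add: signed_def)

lemma signed_apply: "signed k f x = signed k (f x)"
  by (simp add: signed_def)

lemma (in vector_space) scale_minus_one_power: "scale ((-1) ^ k) a = signed k a"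
  by (simp add: signed_def minus_one_power_iff)

lemma (in vector_space) scale_signed: "scale c (signed k a) = signed k (scale c a)"
  by (simp add: signed_def)

definition contract :: "'a \<Rightarrow> ('a list \<Rightarrow> 'b) \<Rightarrow> 'a list \<Rightarrow> 'b" where
  "contract x f = (\<lambda>xs. f (x # xs))"

lemma contract_apply [simp]: "contract x f xs = f (x # xs)"
  by (simp add: contract_def)

lemma contract_0 [simp]: "contract x 0 = 0"
  by (simp add: fun_eq_iff)

text \<open>
  The extensionality principle behind all inductions on the arity.
\<close>

lemma cochain_eqI:
  assumes "f [] = g []" and "\<And>x. contract x f = contract x g"
  shows "f = g"
proof
  fix xs show "f xs = g xs"
    using assms(1) fun_cong[OF assms(2)] by (cases xs) (auto simp: contract_def)
qed

lemma Hom_wedge_0_iff: "f \<in> Hom_wedge s1 s2 0 \<longleftrightarrow> (\<forall>xs. xs \<noteq> [] \<longrightarrow> f xs = 0)"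
  by (auto simp: Hom_wedge_def)

lemma Hom_wedge_length: "f \<in> Hom_wedge s1 s2 n \<Longrightarrow> length xs \<noteq> n \<Longrightarrow> f xs = 0"
  by (auto simp: Hom_wedge_def)

lemma Hom_wedge_linear:
  "f \<in> Hom_wedge s1 s2 n \<Longrightarrow> length xs = n \<Longrightarrow> i < n \<Longrightarrow>
    Vector_Spaces.linear s1 s2 (\<lambda>x. f (xs[i := x]))"
  by (auto simp: Hom_wedge_def)

lemma Hom_wedge_alternating:
  "f \<in> Hom_wedge s1 s2 n \<Longrightarrow> length xs = n \<Longrightarrow> i < j \<Longrightarrow> j < n \<Longrightarrow> xs ! i = xs ! j \<Longrightarrow> f xs = 0"
  unfolding Hom_wedge_def by blast

lemma Hom_wedgeI:
  assumes "\<And>xs. length xs \<noteq> n \<Longrightarrow> f xs = 0"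
    and "\<And>xs i. length xs = n \<Longrightarrow> i < n \<Longrightarrow> Vector_Spaces.linear s1 s2 (\<lambda>x. f (xs[i := x]))"
    and "\<And>xs i j. length xs = n \<Longrightarrow> i < j \<Longrightarrow> j < n \<Longrightarrow> xs ! i = xs ! j \<Longrightarrow> f xs = 0"
  shows "f \<in> Hom_wedge s1 s2 n"
  using assms unfolding Hom_wedge_def by blast

context vector_space_pair
begin

lemma linear_mapI:
  "(\<And>x y. f (x + y) = f x + f y) \<Longrightarrow> (\<And>c x. f (s1 c x) = s2 c (f x)) \<Longrightarrow> Vector_Spaces.linear s1 s2 f"
  using vs1.vector_space_axioms vs2.vector_space_axioms by (simp add: Vector_Spaces.linear_iff)

lemma linear_zero_map: "Vector_Spaces.linear s1 s2 (\<lambda>x. 0)"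
  by (rule linear_mapI) auto

lemma Hom_wedge_linear_head:
  assumes "f \<in> Hom_wedge s1 s2 n"
  shows "Vector_Spaces.linear s1 s2 (\<lambda>x. f (x # xs))"
proof (cases "Suc (length xs) = n")
  case True
  then show ?thesis using Hom_wedge_linear[OF assms, of "undefined # xs" 0] by auto
next
  case False
  then show ?thesis using Hom_wedge_length[OF assms] by (simp add: linear_zero_map)
qed

lemma Hom_wedge_repeat_head:
  assumes "f \<in> Hom_wedge s1 s2 n"
  shows "f (x # x # xs) = 0"
proof (cases "Suc (Suc (length xs)) = n")
  case True
  then show ?thesis using Hom_wedge_alternating[OF assms, of "x # x # xs" 0 1] by auto
next
  case False
  then show ?thesis using Hom_wedge_length[OF assms] by simp
qed

lemma contract_Hom_wedge:
  assumes "f \<in> Hom_wedge s1 s2 n"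
  shows "contract x f \<in> Hom_wedge s1 s2 (n - 1)"
proof (cases n)
  case 0
  then show ?thesis using assms by (auto simp: Hom_wedge_0_iff)
next
  case (Suc k)
  show ?thesis unfolding Suc diff_Suc_1
  proof (rule Hom_wedgeI)
    show "contract x f xs = 0" if "length xs \<noteq> k" for xs
      using Hom_wedge_length[OF assms] that Suc by simp
    show "Vector_Spaces.linear s1 s2 (\<lambda>y. contract x f (xs[i := y]))"
      if "length xs = k" "i < k" for xs i
      using Hom_wedge_linear[OF assms, of "x # xs" "Suc i"] that Suc by simp
    show "contract x f xs = 0" if "length xs = k" "i < j" "j < k" "xs ! i = xs ! j" for xs i j
      using Hom_wedge_alternating[OF assms, of "x # xs" "Suc i" "Suc j"] that Suc by simp
  qed
qed

text \<open>
  Polarization of \<open>f (x # x # xs) = 0\<close>. It is stated for maps not yet known to be alternating,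
  because it is needed in the proof of \<open>Hom_wedge_SucI\<close>.
\<close>

lemma swap_if_repeat_head:
  assumes "\<And>xs. Vector_Spaces.linear s1 s2 (\<lambda>x. f (x # xs))"
    and "\<And>z. Vector_Spaces.linear s1 s2 (\<lambda>x. f (z # x # xs))"
    and "\<And>x. f (x # x # xs) = 0"
  shows "f (x # y # xs) = - f (y # x # xs)"
proof -
  have "0 = f ((x + y) # (x + y) # xs)" using assms(3) by simp
  also have "\<dots> = f (x # x # xs) + f (x # y # xs) + (f (y # x # xs) + f (y # y # xs))"
    using linear_add[OF assms(1)] linear_add[OF assms(2)] by (simp add: algebra_simps)
  finally show ?thesis using assms(3) by (simp add: eq_neg_iff_add_eq_0)
qed

lemma Hom_wedge_swap_head:
  assumes "f \<in> Hom_wedge s1 s2 n"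
  shows "f (x # y # xs) = - f (y # x # xs)"
proof (rule swap_if_repeat_head)
  show "Vector_Spaces.linear s1 s2 (\<lambda>x. f (z # x # xs))" for z
    using Hom_wedge_linear_head[OF contract_Hom_wedge[OF assms]] by simp
qed (use Hom_wedge_linear_head[OF assms] Hom_wedge_repeat_head[OF assms] in auto)

text \<open>
  Alternation in all pairs of positions reduces to the first two positions: if the repeated argument
  occurs first and somewhere further on, exchanging the first two arguments leaves both
  occurrences among the arguments of a contraction, which is alternating by assumption.
\<close>

lemma Hom_wedge_SucI:
  assumes "f [] = 0" and lin: "\<And>xs. Vector_Spaces.linear s1 s2 (\<lambda>x. f (x # xs))"
    and con: "\<And>x. contract x f \<in> Hom_wedge s1 s2 n" and rep: "\<And>x xs. f (x # x # xs) = 0"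
  shows "f \<in> Hom_wedge s1 s2 (Suc n)"
proof (rule Hom_wedgeI)
  show "f xs = 0" if "length xs \<noteq> Suc n" for xs
    using that assms(1) Hom_wedge_length[OF con] by (cases xs) auto
  show "Vector_Spaces.linear s1 s2 (\<lambda>x. f (xs[i := x]))" if "length xs = Suc n" "i < Suc n" for xs i
  proof (cases i)
    case 0
    then show ?thesis using lin that by (cases xs) auto
  next
    case (Suc j)
    then show ?thesis using that Hom_wedge_linear[OF con, of "tl xs" j "hd xs"] by (cases xs) auto
  qed
  show "f xs = 0" if len: "length xs = Suc n" and ij: "i < j" "j < Suc n" "xs ! i = xs ! j" for xs i j
  proof -
    obtain x ys where xs: "xs = x # ys" using len by (cases xs) auto
    obtain k where k: "j = Suc k" using ij by (cases j) auto
    show ?thesis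
    proof (cases i)
      case (Suc i')
      then show ?thesis
        using Hom_wedge_alternating[OF con, of ys i' k x] len ij xs k by simp
    next
      case 0
      then have x: "ys ! k = x" "k < length ys" using ij len xs k by auto
      show ?thesis
      proof (cases k)
        case 0
        then show ?thesis using x rep xs by (cases ys) auto
      next
        case (Suc l)
        then obtain y zs where ys: "ys = y # zs" "zs ! l = x" "l < length zs"
          using x by (cases ys) auto
        have "f (x # y # zs) = - f (y # x # zs)"
        proof (rule swap_if_repeat_head)
          show "Vector_Spaces.linear s1 s2 (\<lambda>x. f (z # x # zs))" for z
            using Hom_wedge_linear_head[OF con] by simp
        qed (use lin rep in auto)
        also have "f (y # x # zs) = 0"
          using Hom_wedge_alternating[OF con, of "x # zs" 0 "Suc l" y] ys len xs by simp
        finally show ?thesis using xs ys by simp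
      qed
    qed
  qed
qed

lemma Hom_wedge_zero: "0 \<in> Hom_wedge s1 s2 n"
  by (auto intro!: Hom_wedgeI linear_zero_map)

lemma Hom_wedge_add:
  assumes "f \<in> Hom_wedge s1 s2 n" "g \<in> Hom_wedge s1 s2 n"
  shows "f + g \<in> Hom_wedge s1 s2 n"
proof (rule Hom_wedgeI)
  show "Vector_Spaces.linear s1 s2 (\<lambda>x. (f + g) (xs[i := x]))" if "length xs = n" "i < n" for xs i
    using linear_compose_add[OF assms[THEN Hom_wedge_linear, OF that]] by simp
  show "(f + g) xs = 0" if "length xs \<noteq> n" for xs
    using assms[THEN Hom_wedge_length, OF that] by simp
  show "(f + g) xs = 0" if "length xs = n" "i < j" "j < n" "xs ! i = xs ! j" for xs i j
    using assms[THEN Hom_wedge_alternating, OF that] by simp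
qed

lemma Hom_wedge_scale:
  assumes "f \<in> Hom_wedge s1 s2 n"
  shows "(\<lambda>xs. s2 c (f xs)) \<in> Hom_wedge s1 s2 n"
proof (rule Hom_wedgeI)
  show "Vector_Spaces.linear s1 s2 (\<lambda>x. s2 c (f (xs[i := x])))" if "length xs = n" "i < n" for xs i
    by (rule linear_compose_scale_right[OF Hom_wedge_linear[OF assms that]])
  show "s2 c (f xs) = 0" if "length xs \<noteq> n" for xs
    using Hom_wedge_length[OF assms that] by simp
  show "s2 c (f xs) = 0" if "length xs = n" "i < j" "j < n" "xs ! i = xs ! j" for xs i j
    using Hom_wedge_alternating[OF assms that] by simp
qed

lemma Hom_wedge_uminus: "f \<in> Hom_wedge s1 s2 n \<Longrightarrow> - f \<in> Hom_wedge s1 s2 n"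
proof -
  assume "f \<in> Hom_wedge s1 s2 n"
  moreover have "- f = (\<lambda>xs. s2 (- 1) (f xs))"
    by (simp add: fun_eq_iff)
  ultimately show ?thesis by (simp only: Hom_wedge_scale)
qed

lemma Hom_wedge_diff:
  "f \<in> Hom_wedge s1 s2 n \<Longrightarrow> g \<in> Hom_wedge s1 s2 n \<Longrightarrow> f - g \<in> Hom_wedge s1 s2 n"
  using Hom_wedge_add[OF _ Hom_wedge_uminus] by simp

lemma Hom_wedge_signed: "f \<in> Hom_wedge s1 s2 n \<Longrightarrow> signed k f \<in> Hom_wedge s1 s2 n"
  by (simp add: signed_def Hom_wedge_uminus)

end

section \<open>The Nijenhuis-Richardson product\<close>

lemma map_upt_Suc_Suc: "map h [Suc a..<Suc b] = map (\<lambda>i. h (Suc i)) [a..<b]"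
  by (simp add: map_Suc_upt[symmetric] o_def del: map_Suc_upt upt_Suc)

locale nr_cochains = vector_space scale for scale :: "'k::field \<Rightarrow> 'l::ab_group_add \<Rightarrow> 'l"
begin

sublocale self: vector_space_pair scale scale
  by unfold_locales

abbreviation cochains :: "nat \<Rightarrow> ('l list \<Rightarrow> 'l) set" where
  "cochains n \<equiv> Hom_wedge scale scale n"

lemmas cochain_head_add = self.linear_add[OF self.Hom_wedge_linear_head]
  and cochain_head_scale = self.linear_scale[OF self.Hom_wedge_linear_head]
  and cochain_head_0 = self.linear_0[OF self.Hom_wedge_linear_head]

lemma nr_comp_arity_0_left:
  assumes "f \<in> cochains 0"
  shows "nr_comp scale 0 n f g = 0"
  using assms by (simp add: nr_comp_def Hom_wedge_0_iff fun_eq_iff)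

lemma nr_comp_zero_left: "nr_comp scale m n 0 g = 0"
  by (simp add: nr_comp_def fun_eq_iff)

lemma nr_comp_zero_right:
  assumes "f \<in> cochains m"
  shows "nr_comp scale m n f 0 = 0"
  using cochain_head_0[OF assms] by (simp add: nr_comp_def fun_eq_iff)

lemma nr_comp_add_left: "nr_comp scale m n (f + f') g = nr_comp scale m n f g + nr_comp scale m n f' g"
  by (simp add: nr_comp_def fun_eq_iff scale_right_distrib sum.distrib)

lemma nr_comp_add_right:
  assumes "f \<in> cochains m"
  shows "nr_comp scale m n f (g + g') = nr_comp scale m n f g + nr_comp scale m n f g'"
  using cochain_head_add[OF assms] by (simp add: nr_comp_def fun_eq_iff scale_right_distrib sum.distrib)

lemma nr_comp_scale_left:
  "nr_comp scale m n (\<lambda>xs. scale c (f xs)) g = (\<lambda>xs. scale c (nr_comp scale m n f g xs))"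
  by (simp add: nr_comp_def fun_eq_iff scale_sum_right mult.commute[of c])

lemma nr_comp_scale_right:
  assumes "f \<in> cochains m"
  shows "nr_comp scale m n f (\<lambda>xs. scale c (g xs)) = (\<lambda>xs. scale c (nr_comp scale m n f g xs))"
  using cochain_head_scale[OF assms]
  by (simp add: nr_comp_def fun_eq_iff scale_sum_right mult.commute[of c])

lemma nr_comp_uminus_left: "nr_comp scale m n (- f) g = - nr_comp scale m n f g"
proof -
  have "- h = (\<lambda>xs. scale (- 1) (h xs))" for h :: "'l list \<Rightarrow> 'l"
    by (simp add: fun_eq_iff)
  then show ?thesis by (simp only: nr_comp_scale_left)
qed

lemma nr_comp_uminus_right:
  assumes "f \<in> cochains m"
  shows "nr_comp scale m n f (- g) = - nr_comp scale m n f g"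
proof -
  have "- h = (\<lambda>xs. scale (- 1) (h xs))" for h :: "'l list \<Rightarrow> 'l"
    by (simp add: fun_eq_iff)
  then show ?thesis by (simp only: nr_comp_scale_right[OF assms])
qed

lemma nr_comp_signed_left: "nr_comp scale m n (signed k f) g = signed k (nr_comp scale m n f g)"
  by (simp add: signed_def nr_comp_uminus_left)

lemma nr_comp_signed_right:
  "f \<in> cochains m \<Longrightarrow> nr_comp scale m n f (signed k g) = signed k (nr_comp scale m n f g)"
  by (simp add: signed_def nr_comp_uminus_right)

text \<open>
  A cochain of arity 0 is a vector, and inserting it is contraction with it. Admitting arity 0 on the
  right provides the base case of the inductions below.
\<close>

lemma nr_comp_arity_0_right:
  assumes "f \<in> cochains m"
  shows "nr_comp scale m 0 f g = contract (g []) f"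
proof
  fix ls :: "'l list"
  have single: "shuffle_perms 0 q = {id}" for q
  proof (intro equalityI subsetI)
    fix \<sigma> assume "\<sigma> \<in> shuffle_perms 0 q"
    then have \<sigma>: "\<sigma> permutes {..<q}" "strict_mono_on {0..<q} \<sigma>" by (auto simp: shuffle_perms_def)
    have ge: "i \<le> \<sigma> i" if "i < q" for i
      using that
    proof (induction i)
      case (Suc i)
      then show ?case using strict_mono_onD[OF \<sigma>(2), of i "Suc i"] by fastforce
    qed simp
    have "\<sigma> i = i" for i
    proof (cases "i < q")
      case True
      then show ?thesis
      using permutes_natset_ge[of \<sigma> "{..<q}"] \<sigma>(1) ge by (metis id_apply lessThan_iff)
    qed (use permutes_not_in[OF \<sigma>(1)] in auto)
    then show "\<sigma> \<in> {id}" by auto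
  next
    fix \<sigma> :: "nat \<Rightarrow> nat" assume "\<sigma> \<in> {id}"
    moreover have "id permutes {..<q}" by (rule permutes_id)
    ultimately show "\<sigma> \<in> shuffle_perms 0 q"
      by (auto simp: shuffle_perms_def intro!: strict_mono_onI)
  qed
  have ls: "map ((!) ls) [0..<length ls] = ls" by (rule map_nth)
  show "nr_comp scale m 0 f g ls = contract (g []) f ls"
  proof (cases "m = 0")
    case True
    then show ?thesis using assms by (simp add: nr_comp_arity_0_left Hom_wedge_0_iff)
  next
    case False
    then show ?thesis using Hom_wedge_length[OF assms, of "g [] # ls"] ls
      by (auto simp: nr_comp_def single)
  qed
qed

text \<open>
  Contraction is a graded derivation of the product: a shuffle gives the first argument \<open>x\<close> either to
  \<open>g\<close>, where it is again the first argument, or to \<open>f\<close>. In the second case \<open>x\<close> passes the \<open>n\<close>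
  arguments of \<open>g\<close> and then the value of \<open>g\<close> itself, whence the sign \<open>(-1)\<close> to the power \<open>n + 1\<close>.
  The truncated differences are harmless: contracting a cochain of arity 0 gives 0.
\<close>

lemma contract_nr_comp:
  assumes f: "f \<in> cochains m" and g: "g \<in> cochains n"
  shows "contract x (nr_comp scale m n f g) =
      nr_comp scale m (n - 1) f (contract x g) + signed (n + 1) (nr_comp scale (m - 1) n (contract x f) g)"
    (is "?L = ?R")
proof (cases m)
  case 0
  then have "contract x f = 0" using f by (simp add: Hom_wedge_0_iff fun_eq_iff)
  then show ?thesis using 0 f by (simp add: nr_comp_arity_0_left nr_comp_zero_left)
next
  case m: (Suc q)
  have first_0: "nr_comp scale m (n - 1) f (contract x g) = 0" if "n = 0"
  proof -
    have "contract x g = 0" using g that by (simp add: Hom_wedge_0_iff fun_eq_iff)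
    then show ?thesis by (simp add: nr_comp_zero_right[OF f])
  qed
  have second_0: "nr_comp scale (m - 1) n (contract x f) g = 0" if "q = 0"
    using self.contract_Hom_wedge[OF f, of x] that m by (simp add: nr_comp_arity_0_left)
  show ?thesis
  proof
    fix xs
    show "?L xs = ?R xs"
    proof (cases "Suc (length xs) = q + n")
      case False
      have "nr_comp scale m (n - 1) f (contract x g) xs = 0"
        using False first_0 m by (cases n) (auto simp: nr_comp_def)
      moreover have "nr_comp scale (m - 1) n (contract x f) g xs = 0"
        using False second_0 m by (cases q) (auto simp: nr_comp_def)
      moreover have "nr_comp scale m n f g (x # xs) = 0"
        using False m by (simp add: nr_comp_def)
      ultimately show ?thesis by (simp add: signed_apply)
    next
      case True
      define F where "F \<sigma> = scale (of_int (sign \<sigma>))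
        (f (g (map (\<lambda>i. (x # xs) ! \<sigma> i) [0..<n]) # map (\<lambda>i. (x # xs) ! \<sigma> i) [n..<q + n]))" for \<sigma>
      have "nr_comp scale m n f g (x # xs) = sum F (shuffle_perms n q)"
        using True m by (simp add: nr_comp_def F_def)
      also have "\<dots> = (if n = 0 then 0 else \<Sum>\<tau>\<in>shuffle_perms (n - 1) q. F (lift_perm \<tau>)) +
          (if q = 0 then 0 else \<Sum>\<tau>\<in>shuffle_perms n (q - 1). F (lift_perm \<tau> \<circ> cycle_to_front n))"
        by (rule sum_shuffle_perms) (use True in linarith)
      also have "(if n = 0 then 0 else \<Sum>\<tau>\<in>shuffle_perms (n - 1) q. F (lift_perm \<tau>)) =
          nr_comp scale m (n - 1) f (contract x g) xs"
      proof (cases n)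
        case 0
        then show ?thesis using first_0 by simp
      next
        case (Suc n')
        have "F (lift_perm \<tau>) = scale (of_int (sign \<tau>))
            (f (contract x g (map (\<lambda>i. xs ! \<tau> i) [0..<n']) # map (\<lambda>i. xs ! \<tau> i) [n'..<q + n']))"
          if "\<tau> \<in> shuffle_perms n' q" for \<tau>
        proof -
          have "sign (lift_perm \<tau>) = sign \<tau>"
            using that by (intro sign_lift_perm[of _ "n' + q"]) (simp add: shuffle_perms_def)
          moreover have "map (\<lambda>i. (x # xs) ! lift_perm \<tau> i) [0..<n] = x # map (\<lambda>i. xs ! \<tau> i) [0..<n']"
            unfolding Suc by (subst upt_conv_Cons) (simp_all add: map_upt_Suc_Suc del: upt_Suc)
          moreover have "map (\<lambda>i. (x # xs) ! lift_perm \<tau> i) [n..<q + n] =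
              map (\<lambda>i. xs ! \<tau> i) [n'..<q + n']"
            unfolding Suc by (simp add: map_upt_Suc_Suc del: upt_Suc)
          ultimately show ?thesis unfolding F_def by simp
        qed
        then show ?thesis using Suc m True by (simp add: nr_comp_def)
      qed
      also have "(if q = 0 then 0 else \<Sum>\<tau>\<in>shuffle_perms n (q - 1). F (lift_perm \<tau> \<circ> cycle_to_front n)) =
          signed (n + 1) (nr_comp scale (m - 1) n (contract x f) g xs)"
      proof (cases q)
        case 0
        then show ?thesis using second_0 by simp
      next
        case (Suc q')
        have "F (lift_perm \<tau> \<circ> cycle_to_front n) = scale (of_int (sign \<tau>)) (signed (n + 1)
            (contract x f (g (map (\<lambda>i. xs ! \<tau> i) [0..<n]) # map (\<lambda>i. xs ! \<tau> i) [n..<q' + n])))"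
          if "\<tau> \<in> shuffle_perms n q'" for \<tau>
        proof -
          have \<tau>: "\<tau> permutes {..<n + q'}" using that by (simp add: shuffle_perms_def)
          have sgn: "sign (lift_perm \<tau> \<circ> cycle_to_front n) = sign \<tau> * (-1) ^ n"
            using lift_perm_permutes[OF \<tau>] cycle_to_front_permutes[of n]
            by (subst sign_compose)
              (auto simp: permutation_permutes sign_lift_perm[OF \<tau>] sign_cycle_to_front)
          have first: "map (\<lambda>i. (x # xs) ! (lift_perm \<tau> \<circ> cycle_to_front n) i) [0..<n] =
              map (\<lambda>i. xs ! \<tau> i) [0..<n]"
            by (simp add: cycle_to_front_def)
          have second: "map (\<lambda>i. (x # xs) ! (lift_perm \<tau> \<circ> cycle_to_front n) i) [n..<q + n] =
              x # map (\<lambda>i. xs ! \<tau> i) [n..<q' + n]"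
            unfolding Suc
            by (subst upt_conv_Cons)
              (auto simp add: map_upt_Suc_Suc cycle_to_front_def simp del: upt_Suc)
          show ?thesis
            unfolding F_def sgn first second using self.Hom_wedge_swap_head[OF f, of _ x]
            by (simp add: signed_def minus_one_power_iff)
        qed
        then have "(\<Sum>\<tau>\<in>shuffle_perms n q'. F (lift_perm \<tau> \<circ> cycle_to_front n)) =
            signed (n + 1) (nr_comp scale (m - 1) n (contract x f) g xs)"
          using Suc m True by (simp add: nr_comp_def signed_def sum_negf)
        then show ?thesis using Suc by simp
      qed
      finally show ?thesis by (simp add: signed_apply contract_def)
    qed
  qed
qed

end

context nr_cochains
begin

lemma cochain_contract_0:
  assumes "g \<in> cochains 0"
  shows "contract x g = 0"
  using assms by (simp add: Hom_wedge_0_iff fun_eq_iff)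

lemma contract_add: "g \<in> cochains n \<Longrightarrow> contract (x + y) g = contract x g + contract y g"
  by (simp add: fun_eq_iff cochain_head_add)

lemma contract_scale: "g \<in> cochains n \<Longrightarrow> contract (scale c x) g = (\<lambda>xs. scale c (contract x g xs))"
  by (simp add: fun_eq_iff cochain_head_scale)

lemma contract_contract_0: "g \<in> cochains n \<Longrightarrow> contract x (contract x g) = 0"
  using self.Hom_wedge_repeat_head by (simp add: fun_eq_iff)

lemma contract_signed: "contract x (signed k f) = signed k (contract x f)"
  by (simp add: fun_eq_iff signed_def)

lemma contract_plus: "contract x (f + g) = contract x f + contract x g"
  by (simp add: fun_eq_iff)

lemma contract_minus: "contract x (f - g) = contract x f - contract x g"
  by (simp add: fun_eq_iff)

text \<open>
  In the twofold contraction the two mixed terms carry opposite signs, since contracting \<open>g\<close> lowers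
  its arity by one.
\<close>

lemma contract_twice_nr_comp:
  assumes f: "f \<in> cochains m" and g: "g \<in> cochains n"
  shows "contract x (contract x (nr_comp scale m n f g)) = 0"
proof -
  have cf: "contract x f \<in> cochains (m - 1)" and cg: "contract x g \<in> cochains (n - 1)"
    using self.contract_Hom_wedge f g by auto
  have "contract x (contract x (nr_comp scale m n f g)) =
      signed (n - 1 + 1) (nr_comp scale (m - 1) (n - 1) (contract x f) (contract x g))
      + signed (n + 1) (nr_comp scale (m - 1) (n - 1) (contract x f) (contract x g))"
    unfolding contract_nr_comp[OF f g] contract_plus contract_signed
      contract_nr_comp[OF f cg] contract_nr_comp[OF cf g]
      contract_contract_0[OF f] contract_contract_0[OF g]
    by (simp add: nr_comp_zero_left nr_comp_zero_right[OF f])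
  also have "\<dots> = 0"
  proof (cases n)
    case 0
    then have "contract x g = 0" using g by (simp add: cochain_contract_0)
    then show ?thesis by (simp only: nr_comp_zero_right[OF cf] signed_0 add_0)
  qed (simp add: signed_def)
  finally show ?thesis .
qed

lemma nr_comp_linear_head:
  assumes f: "f \<in> cochains m" and g: "g \<in> cochains n"
  shows "Vector_Spaces.linear scale scale (\<lambda>x. nr_comp scale m n f g (x # xs))"
proof (rule self.linear_mapI)
  have eq: "nr_comp scale m n f g (x # xs) = nr_comp scale m (n - 1) f (contract x g) xs
      + signed (n + 1) (nr_comp scale (m - 1) n (contract x f) g xs)" for x
    using fun_cong[OF contract_nr_comp[OF f g, of x], of xs] by (simp add: signed_apply)
  show "nr_comp scale m n f g ((x + y) # xs) = nr_comp scale m n f g (x # xs) + nr_comp scale m n f g (y # xs)" for x y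
    unfolding eq contract_add[OF f] contract_add[OF g]
    by (simp add: nr_comp_add_left nr_comp_add_right[OF f] signed_def)
  show "nr_comp scale m n f g (scale c x # xs) = scale c (nr_comp scale m n f g (x # xs))" for c x
    unfolding eq contract_scale[OF f] contract_scale[OF g]
    by (simp add: nr_comp_scale_left nr_comp_scale_right[OF f] scale_signed scale_right_distrib
        del: contract_apply)
qed

lemma nr_comp_closed:
  assumes "f \<in> cochains m" "g \<in> cochains n"
  shows "nr_comp scale m n f g \<in> cochains (m + n - 1)"
  using assms
proof (induction "m + n" arbitrary: m n f g rule: less_induct)
  case less
  note f = less.prems(1) and g = less.prems(2)
  show ?case
  proof (cases "m + n - 1")
    case 0
    then show ?thesis by (simp add: nr_comp_def Hom_wedge_0_iff)
  next
    case (Suc k)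
    show ?thesis unfolding Suc
    proof (rule self.Hom_wedge_SucI)
      show "nr_comp scale m n f g [] = 0" using Suc by (simp add: nr_comp_def)
      show "Vector_Spaces.linear scale scale (\<lambda>x. nr_comp scale m n f g (x # xs))" for xs
        by (rule nr_comp_linear_head[OF f g])
      show "nr_comp scale m n f g (x # x # xs) = 0" for x xs
        using fun_cong[OF contract_twice_nr_comp[OF f g, of x], of xs] by simp
      fix x
      have cf: "contract x f \<in> cochains (m - 1)" and cg: "contract x g \<in> cochains (n - 1)"
        using self.contract_Hom_wedge f g by auto
      have "nr_comp scale m (n - 1) f (contract x g) \<in> cochains k"
      proof (cases n)
        case 0
        then show ?thesis using g
          by (simp add: cochain_contract_0 nr_comp_zero_right[OF f] self.Hom_wedge_zero)
      next
        case (Suc n')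
        then show ?thesis using less.hyps[OF _ f cg] \<open>m + n - 1 = Suc k\<close> by simp
      qed
      moreover have "nr_comp scale (m - 1) n (contract x f) g \<in> cochains k"
      proof (cases m)
        case 0
        then show ?thesis using f by (simp add: cochain_contract_0 nr_comp_zero_left self.Hom_wedge_zero)
      next
        case (Suc m')
        then show ?thesis using less.hyps[OF _ cf g] \<open>m + n - 1 = Suc k\<close> by simp
      qed
      ultimately show "contract x (nr_comp scale m n f g) \<in> cochains k"
        unfolding contract_nr_comp[OF f g]
        by (intro self.Hom_wedge_add self.Hom_wedge_signed)
    qed
  qed
qed

section \<open>The graded pre-Lie identity and the graded Jacobi identity\<close>

text \<open>
  The sum over the terms in which \<open>g\<close> and \<open>h\<close> are both inserted into \<open>f\<close>. Reordering these two
  insertions should only change the sign, which is the graded pre-Lie identity.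
\<close>

definition associator where
  "associator m n p f g h =
     nr_comp scale (m + n - 1) p (nr_comp scale m n f g) h
     - nr_comp scale m (n + p - 1) f (nr_comp scale n p g h)"

lemma associator_arity_0_left:
  assumes "f \<in> cochains 0"
  shows "associator 0 n p f g h = 0"
  using assms by (simp add: associator_def nr_comp_arity_0_left nr_comp_zero_left)

text \<open>
  If \<open>h\<close> is a vector, the associator is the defect in the derivation rule for the contraction
  with \<open>h\<close>, thus given by \<open>contract_nr_comp\<close>.
\<close>

lemma associator_arity_0_right:
  assumes f: "f \<in> cochains m" and g: "g \<in> cochains n" and h: "h \<in> cochains 0"
  shows "associator m n 0 f g h = signed (n + 1) (associator m 0 n f h g)"
proof -
  have "associator m n 0 f g h = signed (n + 1) (nr_comp scale (m - 1) n (contract (h []) f) g)"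
    unfolding associator_def nr_comp_arity_0_right[OF g]
      nr_comp_arity_0_right[OF nr_comp_closed[OF f g]] contract_nr_comp[OF f g]
    by simp
  moreover have "associator m 0 n f h g = nr_comp scale (m - 1) n (contract (h []) f) g"
    unfolding associator_def nr_comp_arity_0_right[OF f] nr_comp_arity_0_left[OF h]
    by (simp add: nr_comp_zero_right[OF f])
  ultimately show ?thesis by simp
qed

lemma contract_associator:
  assumes f: "f \<in> cochains (Suc a)" and g: "g \<in> cochains (Suc b)" and h: "h \<in> cochains (Suc c)"
  shows "contract x (associator (Suc a) (Suc b) (Suc c) f g h) =
      associator (Suc a) (Suc b) c f g (contract x h)
      + signed c (associator (Suc a) b (Suc c) f (contract x g) h)
      + signed (b + c) (associator a (Suc b) (Suc c) (contract x f) g h)"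
proof -
  have cf: "contract x f \<in> cochains a" and cg: "contract x g \<in> cochains b"
    and fg: "nr_comp scale (Suc a) (Suc b) f g \<in> cochains (Suc (a + b))"
    and gh: "nr_comp scale (Suc b) (Suc c) g h \<in> cochains (Suc (b + c))"
    using self.contract_Hom_wedge[OF f, of x] self.contract_Hom_wedge[OF g, of x]
      nr_comp_closed[OF f g] nr_comp_closed[OF g h] by auto
  show ?thesis
    using contract_nr_comp[OF f g, of x] contract_nr_comp[OF g h, of x]
      contract_nr_comp[OF fg h, of x] contract_nr_comp[OF f gh, of x]
    by (simp add: associator_def contract_minus nr_comp_add_left nr_comp_add_right[OF f]
        nr_comp_signed_left nr_comp_signed_right[OF f])
      (simp add: signed_def)
qed

text \<open>
  Induction on the total arity. If \<open>g\<close> or \<open>h\<close> is a vector, \<open>associator_arity_0_right\<close> applies.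
  Otherwise, as contraction is a derivation, each contraction of the associator is a signed sum of
  associators of smaller total arity, and the signs on both sides match term by term.
\<close>

theorem associator_symmetric:
  assumes "f \<in> cochains m" "g \<in> cochains n" "h \<in> cochains p"
  shows "associator m n p f g h = signed ((n + 1) * (p + 1)) (associator m p n f h g)"
  using assms
proof (induction "m + n + p" arbitrary: m n p f g h rule: less_induct)
  case less
  note f = less.prems(1) and g = less.prems(2) and h = less.prems(3)
  consider "p = 0" | "n = 0" | "m = 0" | a b c where "m = Suc a" "n = Suc b" "p = Suc c"
    by (metis not0_implies_Suc)
  then show ?case
  proof cases
    case 1
    then show ?thesis using associator_arity_0_right[OF f g, of h] h by simp
  next
    case 2
    then have "associator m p n f h g = signed (p + 1) (associator m n p f g h)"
      using associator_arity_0_right[OF f h, of g] g by simp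
    then show ?thesis using 2 by (simp add: signed_def)
  next
    case 3
    then show ?thesis using f by (simp add: associator_arity_0_left)
  next
    case 4
    show ?thesis
    proof (rule cochain_eqI)
      show "associator m n p f g h [] = signed ((n + 1) * (p + 1)) (associator m p n f h g) []"
        using 4 by (simp add: associator_def nr_comp_def signed_apply)
      fix x
      have f': "f \<in> cochains (Suc a)" and g': "g \<in> cochains (Suc b)" and h': "h \<in> cochains (Suc c)"
        using f g h 4 by auto
      have cf: "contract x f \<in> cochains a" and cg: "contract x g \<in> cochains b"
        and ch: "contract x h \<in> cochains c"
        using self.contract_Hom_wedge[OF f', of x] self.contract_Hom_wedge[OF g', of x]
          self.contract_Hom_wedge[OF h', of x] by auto
      show "contract x (associator m n p f g h) =
          contract x (signed ((n + 1) * (p + 1)) (associator m p n f h g))"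
        using less.hyps[OF _ f' g' ch] less.hyps[OF _ f' cg h'] less.hyps[OF _ cf g' h']
        unfolding contract_signed 4 contract_associator[OF f' g' h'] contract_associator[OF f' h' g']
        by (auto simp: signed_def)
    qed
  qed
qed

abbreviation nrb where "nrb \<equiv> nr_bracket scale"

lemma nr_bracket_eq: "nrb m n f g =
    nr_comp scale m n f g - signed ((m - 1) * (n - 1)) (nr_comp scale n m g f)"
  by (simp add: nr_bracket_def fun_eq_iff scale_minus_one_power signed_apply)

lemma nr_bracket_closed:
  assumes "f \<in> cochains m" "g \<in> cochains n"
  shows "nrb m n f g \<in> cochains (m + n - 1)"
  unfolding nr_bracket_eq using nr_comp_closed[OF assms] nr_comp_closed[OF assms(2,1)]
  by (intro self.Hom_wedge_diff self.Hom_wedge_signed) (simp_all add: add.commute)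

lemma nr_bracket_skew: "nrb m n f g = - signed ((m - 1) * (n - 1)) (nrb n m g f)"
  by (simp add: nr_bracket_eq signed_def mult.commute)

text \<open>
  In the twelve iterated products of the Jacobi identity the terms pair up to associators, and each of
  \<open>f\<close>, \<open>g\<close>, \<open>h\<close> in the outer position accounts for one instance of the pre-Lie identity. The arities
  are written as successors because the degrees are \<open>a\<close>, \<open>b\<close>, \<open>c\<close>.
\<close>

lemma nr_bracket_jacobi:
  assumes f: "f \<in> cochains (Suc a)" and g: "g \<in> cochains (Suc b)" and h: "h \<in> cochains (Suc c)"
  shows "nrb (Suc a) (Suc (b + c)) f (nrb (Suc b) (Suc c) g h) =
    nrb (Suc (a + b)) (Suc c) (nrb (Suc a) (Suc b) f g) h
    + signed (a * b) (nrb (Suc b) (Suc (a + c)) g (nrb (Suc a) (Suc c) f h))"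
proof -
  let ?c = "nr_comp scale"
  note closed = nr_comp_closed[OF f g] nr_comp_closed[OF g f] nr_comp_closed[OF f h]
    nr_comp_closed[OF h f] nr_comp_closed[OF g h] nr_comp_closed[OF h g]
  have diff_left: "?c m n (f - f') g = ?c m n f g - ?c m n f' g" for m n f f' g
    using nr_comp_add_left[of m n f "- f'" g] by (simp add: nr_comp_uminus_left)
  have diff_right: "?c m n f (g - g') = ?c m n f g - ?c m n f g'" if "f \<in> cochains m" for m n f g g'
    using nr_comp_add_right[OF that, of n g "- g'"] by (simp add: nr_comp_uminus_right[OF that])
  note pre_lie = associator_symmetric[OF f g h] associator_symmetric[OF g f h] associator_symmetric[OF h f g]
  show ?thesis
    using pre_lie unfolding associator_def nr_bracket_eq
    by (auto simp: diff_left diff_right[OF f] diff_right[OF g] diff_right[OF h]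
        nr_comp_signed_left nr_comp_signed_right[OF f] nr_comp_signed_right[OF g]
        nr_comp_signed_right[OF h] nr_comp_uminus_left nr_comp_uminus_right[OF f]
        nr_comp_uminus_right[OF g] nr_comp_uminus_right[OF h] signed_def add.commute algebra_simps)
qed

lemma nr_bracket_add_left:
  "g \<in> cochains n \<Longrightarrow> nrb m n (f + f') g = nrb m n f g + nrb m n f' g"
  by (simp add: nr_bracket_eq nr_comp_add_left nr_comp_add_right signed_def)

lemma nr_bracket_add_right:
  "f \<in> cochains m \<Longrightarrow> nrb m n f (g + g') = nrb m n f g + nrb m n f g'"
  by (simp add: nr_bracket_eq nr_comp_add_left nr_comp_add_right signed_def)

lemma nr_bracket_scale_left:
  "g \<in> cochains n \<Longrightarrow> nrb m n (\<lambda>xs. scale c (f xs)) g = (\<lambda>xs. scale c (nrb m n f g xs))"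
  by (simp add: nr_bracket_eq nr_comp_scale_left nr_comp_scale_right fun_eq_iff signed_apply
      scale_signed scale_right_diff_distrib)

lemma nr_bracket_scale_right:
  "f \<in> cochains m \<Longrightarrow> nrb m n f (\<lambda>xs. scale c (g xs)) = (\<lambda>xs. scale c (nrb m n f g xs))"
  by (simp add: nr_bracket_eq nr_comp_scale_left nr_comp_scale_right fun_eq_iff signed_apply
      scale_signed scale_right_diff_distrib)

section \<open>Weights\<close>

text \<open>
  If \<open>\<phi>\<close> is diagonalizable with powers of 2 as eigenvalues, this says that \<open>f\<close> is homogeneous: the
  number of arguments counted by \<open>\<phi>\<close> exceeds that of the value by a fixed amount, whose
  power of 2 is \<open>a\<close>.
\<close>

definition has_weight :: "('l \<Rightarrow> 'l) \<Rightarrow> 'k \<Rightarrow> ('l list \<Rightarrow> 'l) \<Rightarrow> bool" where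
  "has_weight \<phi> a f \<longleftrightarrow> (\<forall>xs. f (map \<phi> xs) = scale a (\<phi> (f xs)))"

lemma nr_comp_has_weight:
  assumes f: "f \<in> cochains m" and \<phi>: "Vector_Spaces.linear scale scale \<phi>"
    and wf: "has_weight \<phi> a f" and wg: "has_weight \<phi> b g"
  shows "has_weight \<phi> (a * b) (nr_comp scale m n f g)"
  unfolding has_weight_def
proof
  fix ls
  show "nr_comp scale m n f g (map \<phi> ls) = scale (a * b) (\<phi> (nr_comp scale m n f g ls))"
  proof (cases "m = 0 \<or> length ls \<noteq> m + n - 1")
    case True
    then show ?thesis
      using f self.linear_0[OF \<phi>] by (auto simp: nr_comp_arity_0_left) (auto simp: nr_comp_def)
  next
    case False
    have "f (g (map (\<lambda>i. map \<phi> ls ! \<sigma> i) [0..<n]) # map (\<lambda>i. map \<phi> ls ! \<sigma> i) [n..<m + n - 1]) =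
        scale (a * b) (\<phi> (f (g (map (\<lambda>i. ls ! \<sigma> i) [0..<n]) # map (\<lambda>i. ls ! \<sigma> i) [n..<m + n - 1])))"
      if \<sigma>: "\<sigma> \<in> shuffle_perms n (m - 1)" for \<sigma>
    proof -
      have "\<sigma> i < length ls" if "i < m + n - 1" for i
        using permutes_in_image[of \<sigma> "{..<n + (m - 1)}" i] \<sigma> that False
        by (auto simp: shuffle_perms_def)
      then have "map (\<lambda>i. map \<phi> ls ! \<sigma> i) [0..<n] = map \<phi> (map (\<lambda>i. ls ! \<sigma> i) [0..<n])"
        "map (\<lambda>i. map \<phi> ls ! \<sigma> i) [n..<m + n - 1] = map \<phi> (map (\<lambda>i. ls ! \<sigma> i) [n..<m + n - 1])"
        using False by auto
      then have "f (g (map (\<lambda>i. map \<phi> ls ! \<sigma> i) [0..<n]) # map (\<lambda>i. map \<phi> ls ! \<sigma> i) [n..<m + n - 1]) =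
        scale b (f (map \<phi> (g (map (\<lambda>i. ls ! \<sigma> i) [0..<n]) # map (\<lambda>i. ls ! \<sigma> i) [n..<m + n - 1])))"
        using wg cochain_head_scale[OF f] by (simp only: has_weight_def list.map)
      then show ?thesis using wf by (simp only: has_weight_def scale_scale mult.commute)
    qed
    then show ?thesis
      using False by (simp add: nr_comp_def self.linear_sum[OF \<phi>] self.linear_scale[OF \<phi>]
          scale_sum_right mult.commute)
  qed
qed

lemma nr_bracket_has_weight:
  assumes "f \<in> cochains m" "g \<in> cochains n" and \<phi>: "Vector_Spaces.linear scale scale \<phi>"
    and "has_weight \<phi> a f" "has_weight \<phi> b g"
  shows "has_weight \<phi> (a * b) (nrb m n f g)"
proof -
  have signed_map: "\<phi> (signed k v) = signed k (\<phi> v)" for k v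
    by (simp add: signed_def self.linear_neg[OF \<phi>])
  show ?thesis
    using nr_comp_has_weight[OF assms(1,3,4,5), of n] nr_comp_has_weight[OF assms(2,3,5,4), of m]
    by (simp add: has_weight_def nr_bracket_eq signed_apply mult.commute[of b] scale_signed
        scale_right_diff_distrib self.linear_diff[OF \<phi>] signed_map)
qed

end

text \<open>
  Doubling separates eigenspaces because 2 has infinite order in the multiplicative group of a field
  of characteristic 0.
\<close>

lemma half_power_neq_1: "(1 / 2 :: 'k::field_char_0) ^ Suc k \<noteq> 1"
proof
  assume "(1 / 2 :: 'k) ^ Suc k = 1"
  then have "(2 :: 'k) ^ Suc k = 1" by (simp only: power_one_over) simp
  then have "of_nat (2 ^ Suc k) = (of_nat 1 :: 'k)" by simp
  then have "(2::nat) ^ Suc k = 1" by (simp only: of_nat_eq_iff)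
  then show False by simp
qed

locale nr_cochains_char_0 = nr_cochains scale
  for scale :: "'k::field_char_0 \<Rightarrow> 'l::ab_group_add \<Rightarrow> 'l"
begin

lemma double_eq: "v + v = scale 2 v"
  using scale_left_distrib[of 1 1 v] by simp

lemma eq_scale_imp_0: "v = scale c v \<Longrightarrow> c \<noteq> 1 \<Longrightarrow> v = 0"
  using scale_left_imp_eq scale_right_imp_eq[of v 1 c] by force

lemma eq_0_if_double_eq_0: "(v::'l) + v = 0 \<Longrightarrow> v = 0"
  unfolding double_eq by simp

text \<open>
  For a projection \<open>e\<close>, the map that doubles the image of \<open>e\<close> and fixes the kernel.
\<close>

definition doubling :: "('l \<Rightarrow> 'l) \<Rightarrow> 'l \<Rightarrow> 'l" where
  "doubling e x = x + e x"

lemma linear_doubling: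
  assumes "Vector_Spaces.linear scale scale e"
  shows "Vector_Spaces.linear scale scale (doubling e)"
  using self.linear_add[OF assms] self.linear_scale[OF assms]
  by (intro self.linear_mapI) (auto simp: doubling_def algebra_simps)

lemma has_weight_contract_fixed:
  assumes "has_weight (doubling e) a G" "e x = 0"
  shows "has_weight (doubling e) a (contract x G)"
  unfolding has_weight_def
proof
  fix xs
  show "contract x G (map (doubling e) xs) = scale a (doubling e (contract x G xs))"
    using assms(1)[unfolded has_weight_def, rule_format, of "x # xs"] assms(2)
    by (simp add: doubling_def)
qed

lemma has_weight_contract_doubled:
  assumes "G \<in> cochains n" "has_weight (doubling e) a G" "e x = x"
  shows "has_weight (doubling e) (a / 2) (contract x G)"
  unfolding has_weight_def
proof
  fix xs
  have "scale 2 (G (x # map (doubling e) xs)) = scale a (doubling e (G (x # xs)))"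
    using assms(2)[unfolded has_weight_def, rule_format, of "x # xs"] assms(3)
      cochain_head_add[OF assms(1), of x x]
    by (simp add: doubling_def double_eq[symmetric])
  then have "scale (1/2) (scale 2 (G (x # map (doubling e) xs))) =
      scale (1/2) (scale a (doubling e (G (x # xs))))"
    by simp
  then show "contract x G (map (doubling e) xs) = scale (a / 2) (doubling e (contract x G xs))"
    by simp
qed

context
  fixes e :: "'l \<Rightarrow> 'l"
  assumes linear_e: "Vector_Spaces.linear scale scale e"
    and idempotent_e: "\<And>x. e (e x) = e x"
begin

lemma e_remainder: "e (x - e x) = 0"
  by (simp add: self.linear_diff[OF linear_e] idempotent_e)

lemma contract_split:
  assumes "G \<in> cochains n"
  shows "contract x G = contract (e x) G + contract (x - e x) G"
  using contract_add[OF assms, of "e x" "x - e x"] by simp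

text \<open>
  Let \<open>B\<close> be the image of \<open>e\<close>. Weight \<open>(1/2)\<^sup>j\<close> means that the value lies in degree \<open>j\<close> higher, counted in \<open>B\<close>,
  than its arguments together. Values have degree 0 or 1, so for \<open>j \<ge> 2\<close> nothing is left. In the
  induction, contraction with an element of \<open>B\<close> only increases \<open>j\<close>.
\<close>

lemma small_weight_imp_0:
  assumes "G \<in> cochains n" "has_weight (doubling e) ((1/2) ^ (k + 2)) G"
  shows "G = 0"
  using assms
proof (induction n arbitrary: G k)
  case 0
  define y where "y = G []"
  define c :: 'k where "c = (1/2) ^ (k + 2)"
  have y: "y = scale c (y + e y)"
    using 0(2) by (auto simp: has_weight_def y_def c_def doubling_def dest: spec[of _ "[]"])
  (* in arity 0 the weight condition is an eigenvalue equation for the value *)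
  have "e y = scale c (e y + e y)"
    using arg_cong[OF y, of e] self.linear_scale[OF linear_e] self.linear_add[OF linear_e] idempotent_e
    by simp
  then have "e y = scale ((1/2) ^ Suc k) (e y)"
    by (simp add: double_eq c_def)
  then have "e y = 0" using eq_scale_imp_0 half_power_neq_1 by blast
  then have "y = scale c y" using y by simp
  moreover have "c \<noteq> 1" unfolding c_def using half_power_neq_1[of "k + 1"] by simp
  ultimately have "y = 0" using eq_scale_imp_0 by blast
  then have "G xs = 0" for xs using Hom_wedge_length[OF 0(1)] by (cases xs) (auto simp: y_def)
  then show ?case by (simp add: fun_eq_iff)
next
  case (Suc n)
  have con: "contract x G \<in> cochains n" for x using self.contract_Hom_wedge[OF Suc.prems(1)] by simp
  show ?case
  proof (rule cochain_eqI)
    show "G [] = 0 []" using Hom_wedge_length[OF Suc.prems(1)] by simp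
    fix x
    (* the component of x in the image of e is doubled, so contraction with it halves the weight *)
    have "has_weight (doubling e) ((1/2) ^ ((k + 1) + 2)) (contract (e x) G)"
      using has_weight_contract_doubled[OF Suc.prems idempotent_e, of x] by simp
    then have "contract (e x) G = 0" using Suc.IH con by blast
    moreover have "contract (x - e x) G = 0"
      using Suc.IH[OF con] has_weight_contract_fixed[OF Suc.prems(2) e_remainder] by blast
    ultimately show "contract x G = contract x 0"
      using contract_split[OF Suc.prems(1), of x] by simp
  qed
qed

text \<open>
  Weight \<open>1/2\<close> leaves one possibility: no argument in \<open>B\<close>, and the value in \<open>B\<close>
  (\<open>weight_half_values\<close>).
\<close>

lemma weight_half_contract:
  assumes "G \<in> cochains n" "has_weight (doubling e) (1/2) G" "e x = x"
  shows "contract x G = 0"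
  using small_weight_imp_0[of "contract x G" "n - 1" 0] has_weight_contract_doubled[OF assms]
    self.contract_Hom_wedge[OF assms(1)] by (simp add: power2_eq_square)

lemma weight_half_values:
  assumes "G \<in> cochains n" "has_weight (doubling e) (1/2) G"
  shows "e (G xs) = G xs"
  using assms
proof (induction xs arbitrary: G n)
  case Nil
  define y where "y = G []"
  have "y = scale (1/2) (y + e y)"
    using Nil(2) by (auto simp: has_weight_def y_def doubling_def dest: spec[of _ "[]"])
  then have "scale 2 y = scale 2 (scale (1/2) (y + e y))" by simp
  then have "y + y = y + e y" by (simp add: double_eq)
  then show ?case by (simp add: y_def)
next
  case (Cons x xs)
  have "contract x G = contract (x - e x) G"
    using contract_split[OF Cons.prems(1), of x] weight_half_contract[OF Cons.prems idempotent_e]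
    by simp
  then have "has_weight (doubling e) (1/2) (contract x G)"
    using has_weight_contract_fixed[OF Cons.prems(2) e_remainder] by simp
  then show ?case using Cons.IH[OF self.contract_Hom_wedge[OF Cons.prems(1)]] by fastforce
qed

end

end

section \<open>Paired cochains inside the cochains on \<open>l\<close>\<close>

lemma Hom_wedge_compose:
  assumes f: "f \<in> Hom_wedge s1 s2 n" and A: "Vector_Spaces.linear s0 s1 A"
    and B: "Vector_Spaces.linear s2 s3 B"
  shows "(\<lambda>ls. B (f (map A ls))) \<in> Hom_wedge s0 s3 n"
proof -
  interpret B: Vector_Spaces.linear s2 s3 B by (rule B)
  show ?thesis
  proof (rule Hom_wedgeI)
    show "B (f (map A xs)) = 0" if "length xs \<noteq> n" for xs
      using Hom_wedge_length[OF f] that B.zero by simp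
    show "B (f (map A xs)) = 0" if "length xs = n" "i < j" "j < n" "xs ! i = xs ! j" for xs i j
      using Hom_wedge_alternating[OF f, of "map A xs" i j] that B.zero by simp
    show "Vector_Spaces.linear s0 s3 (\<lambda>x. B (f (map A (xs[i := x]))))" if "length xs = n" "i < n" for xs i
      using Vector_Spaces.linear_compose[OF Vector_Spaces.linear_compose[OF A
            Hom_wedge_linear[OF f, of "map A xs" i]] B] that
      by (simp add: o_def map_update)
  qed
qed

definition proj_unprimed :: "('g::ab_group_add, 'v::ab_group_add) quad \<Rightarrow> ('g, 'v) quad" where
  "proj_unprimed = (\<lambda>(x, x', v, v'). (x, 0, v, 0))"

definition proj_module :: "('g::ab_group_add, 'v::ab_group_add) quad \<Rightarrow> ('g, 'v) quad" where
  "proj_module = (\<lambda>(x, x', v, v'). (0, 0, v, v'))"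

lemmas quad_simps = proj_unprimed_def proj_module_def quad_scale_def in_g_def in_g'_def in_V_def in_V'_def
  zero_prod_def

lemma inclusion_0 [simp]: "in_g 0 = 0" "in_g' 0 = 0" "in_V 0 = 0" "in_V' 0 = 0"
  by (simp_all add: quad_simps)

lemma inclusion_add:
  "in_g (x + y) = in_g x + in_g y" "in_g' (x + y) = in_g' x + in_g' y"
  "in_V (v + w) = in_V v + in_V w" "in_V' (v + w) = in_V' v + in_V' w"
  by (simp_all add: quad_simps)

lemma projection_inclusion [simp]:
  "pr_g' (in_g' x) = x" "pr_V' (in_g' x) = 0" "pr_g' (in_V' v) = 0" "pr_V' (in_V' v) = v"
  by (simp_all add: quad_simps)

lemma map_projection_inclusion [simp]: "map (pr_g' \<circ> in_g') xs = xs"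
  by (simp add: map_idI)

text \<open>
  With the signs collected in \<open>signed\<close>, the summands can be rewritten without case distinctions.
\<close>

lemma paired_embed_eq_sum:
  "paired_embed P ls = in_g (fst P (map pr_g' ls)) +
     (\<Sum>i<length ls. signed (length ls - 1 - i)
        (in_V (snd P (map pr_g' (take i ls @ drop (Suc i) ls)) (pr_V' (ls ! i)))))"
  by (simp add: paired_embed_def Let_def signed_def)

text \<open>
  Contracting an embedded pair with \<open>l\<close> contracts both parts with the \<open>g'\<close>-component of \<open>l\<close>. The extra term
  arises from the \<open>V'\<close>-component, which has to travel past all other arguments to the last position.
\<close>

lemma paired_embed_Cons:
  "paired_embed P (l # ls) =
     paired_embed (contract (pr_g' l) (fst P), contract (pr_g' l) (snd P)) ls
     + signed (length ls) (in_V (snd P (map pr_g' ls) (pr_V' l)))"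
  unfolding paired_embed_eq_sum
  by (simp add: sum.lessThan_Suc_shift del: sum.lessThan_Suc)

lemma paired_embed_0: "paired_embed 0 = 0"
proof
  fix ls :: "('a, 'b) quad list"
  have "paired_embed (0 :: ('a, 'b) paired) ls = 0"
    by (simp add: paired_embed_eq_sum)
  then show "paired_embed (0 :: ('a, 'b) paired) ls = 0 ls" by simp
qed

lemma paired_embed_add: "paired_embed (P + Q) = paired_embed P + paired_embed Q"
  by (simp add: paired_embed_eq_sum fun_eq_iff inclusion_add signed_add sum.distrib)

locale paired_spaces = G: vector_space sg + V: vector_space sv
  for sg :: "'k::field_char_0 \<Rightarrow> 'g::ab_group_add \<Rightarrow> 'g"
    and sv :: "'k \<Rightarrow> 'v::ab_group_add \<Rightarrow> 'v"
begin

abbreviation qs where "qs \<equiv> quad_scale sg sv"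

sublocale L: nr_cochains_char_0 qs
  by unfold_locales (auto simp: quad_scale_def G.scale_right_distrib V.scale_right_distrib
      G.scale_left_distrib V.scale_left_distrib)

sublocale GG: vector_space_pair sg sg by unfold_locales
sublocale GV: vector_space_pair sg sv by unfold_locales
sublocale VV: vector_space_pair sv sv by unfold_locales
sublocale GL: vector_space_pair sg qs by unfold_locales
sublocale VL: vector_space_pair sv qs by unfold_locales
sublocale LG: vector_space_pair qs sg by unfold_locales
sublocale LV: vector_space_pair qs sv by unfold_locales

lemma linear_projections:
  "Vector_Spaces.linear qs sg pr_g" "Vector_Spaces.linear qs sg pr_g'"
  "Vector_Spaces.linear qs sv pr_V" "Vector_Spaces.linear qs sv pr_V'"
  by (auto intro!: LG.linear_mapI LV.linear_mapI simp: quad_scale_def)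

lemma linear_inclusions:
  "Vector_Spaces.linear sg qs in_g" "Vector_Spaces.linear sg qs in_g'"
  "Vector_Spaces.linear sv qs in_V" "Vector_Spaces.linear sv qs in_V'"
  by (auto intro!: GL.linear_mapI VL.linear_mapI simp: quad_simps)

lemma linear_proj_unprimed: "Vector_Spaces.linear qs qs proj_unprimed"
  and linear_proj_module: "Vector_Spaces.linear qs qs proj_module"
  by (auto intro!: L.self.linear_mapI simp: quad_simps)

lemma idempotent_projections:
  "proj_unprimed (proj_unprimed x) = proj_unprimed x" "proj_module (proj_module x) = proj_module x"
  by (auto simp: quad_simps split: prod.splits)

text \<open>
  The components of an element of \<open>paired_cochains sg sv n\<close>, except that arity 0 allows an arbitrary
  \<open>p\<close>. Unlike the spaces of paired cochains, this is stable under contraction down to arity 0.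
\<close>

definition paired_parts :: "nat \<Rightarrow> ('g list \<Rightarrow> 'g) \<Rightarrow> ('g list \<Rightarrow> 'v \<Rightarrow> 'v) \<Rightarrow> bool" where
  "paired_parts n p q \<longleftrightarrow> p \<in> Hom_wedge sg sg n \<and>
     (if n = 0 then q = 0 else q \<in> Hom_wedge_tensor sg sv (n - 1))"

lemma paired_parts_if_mem: "P \<in> paired_cochains sg sv n \<Longrightarrow> paired_parts n (fst P) (snd P)"
  by (auto simp: paired_cochains_def paired_parts_def GG.Hom_wedge_zero split: if_splits)

lemma paired_parts_linear: "paired_parts n p q \<Longrightarrow> Vector_Spaces.linear sv sv (q xs)"
  by (auto simp: paired_parts_def Hom_wedge_tensor_def VV.linear_zero_map zero_fun_def split: if_splits)

lemma paired_parts_contract: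
  assumes "paired_parts (Suc n) p q"
  shows "paired_parts n (contract x p) (contract x q)"
proof -
  have p: "p \<in> Hom_wedge sg sg (Suc n)" and q: "\<And>v. (\<lambda>xs. q xs v) \<in> Hom_wedge sg sv n"
    and l: "\<And>xs. Vector_Spaces.linear sv sv (q xs)"
    using assms by (auto simp: paired_parts_def Hom_wedge_tensor_def)
  have "contract x p \<in> Hom_wedge sg sg n" using GG.contract_Hom_wedge[OF p] by simp
  moreover have "contract x q = 0" if "n = 0"
    using q[unfolded that Hom_wedge_0_iff] by (simp add: fun_eq_iff)
  moreover have "contract x q \<in> Hom_wedge_tensor sg sv (n - 1)"
    using GV.contract_Hom_wedge[OF q, of x] l by (simp add: Hom_wedge_tensor_def contract_def)
  ultimately show ?thesis by (simp add: paired_parts_def)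
qed

lemma paired_parts_head:
  assumes "paired_parts n p q"
  shows "contract (x + y) p = contract x p + contract y p"
    and "contract (x + y) q = contract x q + contract y q"
    and "contract (sg c x) p = (\<lambda>xs. sg c (contract x p xs))"
    and "contract (sg c x) q = (\<lambda>xs v. sv c (contract x q xs v))"
    and "p (x # x # xs) = 0" "q (x # x # xs) v = 0"
proof -
  have p: "p \<in> Hom_wedge sg sg n" using assms by (auto simp: paired_parts_def)
  have q: "(\<lambda>xs. q xs v) \<in> Hom_wedge sg sv (n - 1)" for v
    using assms GV.Hom_wedge_zero
    by (auto simp: paired_parts_def Hom_wedge_tensor_def zero_fun_def split: if_splits)
  show "contract (x + y) p = contract x p + contract y p"
    "contract (sg c x) p = (\<lambda>xs. sg c (contract x p xs))"
    "p (x # x # xs) = 0"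
    using GG.linear_add[OF GG.Hom_wedge_linear_head[OF p]] GG.linear_scale[OF GG.Hom_wedge_linear_head[OF p]]
      GG.Hom_wedge_repeat_head[OF p] by (auto simp: fun_eq_iff)
  show "contract (x + y) q = contract x q + contract y q"
    "contract (sg c x) q = (\<lambda>xs v. sv c (contract x q xs v))"
    "q (x # x # xs) v = 0"
    using GV.linear_add[OF GV.Hom_wedge_linear_head[OF q]] GV.linear_scale[OF GV.Hom_wedge_linear_head[OF q]]
      GV.Hom_wedge_repeat_head[OF q] by (auto simp: fun_eq_iff)
qed

lemma paired_embed_scale: "paired_embed (paired_scale sg sv c P) = (\<lambda>ls. qs c (paired_embed P ls))"
proof
  fix ls :: "('g, 'v) quad list"
  have "(if b then in_V (sv c x) else - in_V (sv c x)) = qs c (if b then in_V x else - in_V x)" for b x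
    by (simp add: quad_simps)
  moreover have "in_g (sg c x) = qs c (in_g x)" for x by (simp add: quad_simps)
  ultimately show "paired_embed (paired_scale sg sv c P) ls = qs c (paired_embed P ls)"
    by (simp add: paired_embed_def paired_scale_def Let_def L.scale_right_distrib L.scale_sum_right)
qed

text \<open>
  Only alternation is not evident. In the twofold contraction with the same vector the extra terms of
  \<open>paired_embed_Cons\<close> cancel, as they are moved past a different number of arguments.
\<close>

lemma paired_embed_cochain_pre:
  assumes "paired_parts n p q"
  shows "paired_embed (p, q) \<in> L.cochains n"
  using assms
proof (induction n arbitrary: p q)
  case 0
  then have "p \<in> Hom_wedge sg sg 0" "q = 0" by (auto simp: paired_parts_def)
  then show ?case
    by (simp add: Hom_wedge_0_iff paired_embed_eq_sum)
next
  case (Suc n)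
  note cons = paired_embed_Cons[of "(p, q)", unfolded fst_conv snd_conv]
  note q_lin = paired_parts_linear[OF Suc.prems]
  have p: "p \<in> Hom_wedge sg sg (Suc n)" and q: "(\<lambda>xs. q xs v) \<in> Hom_wedge sg sv n" for v
    using Suc.prems by (auto simp: paired_parts_def Hom_wedge_tensor_def)
  show ?case
  proof (rule L.self.Hom_wedge_SucI)
    show "paired_embed (p, q) [] = 0"
      using Hom_wedge_length[OF p, of "[]"] by (simp add: paired_embed_def quad_simps)
    show "Vector_Spaces.linear qs qs (\<lambda>x. paired_embed (p, q) (x # xs))" for xs
    proof (rule L.self.linear_mapI)
      fix x y c
      have pr: "pr_g' (x + y) = pr_g' x + pr_g' y" "pr_V' (x + y) = pr_V' x + pr_V' y"
        "pr_g' (qs c x) = sg c (pr_g' x)" "pr_V' (qs c x) = sv c (pr_V' x)"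
        using linear_projections by (auto simp: LG.linear_add LG.linear_scale LV.linear_add LV.linear_scale)
      show "paired_embed (p, q) ((x + y) # xs) = paired_embed (p, q) (x # xs) + paired_embed (p, q) (y # xs)"
        unfolding cons pr paired_parts_head[OF Suc.prems] VV.linear_add[OF q_lin]
          VL.linear_add[OF linear_inclusions(3)] plus_prod_def[symmetric] add_Pair[symmetric]
          paired_embed_add
        by (simp add: signed_def)
      have "paired_embed (\<lambda>xs. sg c (contract (pr_g' x) p xs), \<lambda>xs v. sv c (contract (pr_g' x) q xs v)) =
          (\<lambda>ls. qs c (paired_embed (contract (pr_g' x) p, contract (pr_g' x) q) ls))"
        using paired_embed_scale[of c "(contract (pr_g' x) p, contract (pr_g' x) q)"]
        by (simp only: paired_scale_def fst_conv snd_conv)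
      then show "paired_embed (p, q) (qs c x # xs) = qs c (paired_embed (p, q) (x # xs))"
        unfolding cons pr paired_parts_head[OF Suc.prems] VV.linear_scale[OF q_lin]
          VL.linear_scale[OF linear_inclusions(3)]
        by (simp add: L.scale_signed L.scale_right_distrib)
    qed
    show "paired_embed (p, q) (x # x # xs) = 0" for x xs
    proof -
      have "(contract (pr_g' x) (contract (pr_g' x) p), contract (pr_g' x) (contract (pr_g' x) q)) = 0"
        using paired_parts_head(5,6)[OF Suc.prems] by (simp add: zero_prod_def fun_eq_iff)
      then show ?thesis
        unfolding paired_embed_Cons by (simp add: paired_embed_0 signed_def)
    qed
    fix x
    have "contract x (paired_embed (p, q)) = paired_embed (contract (pr_g' x) p, contract (pr_g' x) q)
        + signed n (\<lambda>ls. in_V (q (map pr_g' ls) (pr_V' x)))"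
    proof
      fix ls :: "('g, 'v) quad list"
      have sgn: "signed (length ls) (in_V (q (map pr_g' ls) (pr_V' x))) =
          signed n (in_V (q (map pr_g' ls) (pr_V' x)))"
        using Hom_wedge_length[OF q, of "map pr_g' ls" "pr_V' x"] VL.linear_0[OF linear_inclusions(3)]
        by (cases "length ls = n") auto
      show "contract x (paired_embed (p, q)) ls = (paired_embed (contract (pr_g' x) p, contract (pr_g' x) q)
          + signed n (\<lambda>ls. in_V (q (map pr_g' ls) (pr_V' x)))) ls"
        by (simp only: contract_apply cons plus_fun_apply signed_apply sgn)
    qed
    moreover have "(\<lambda>ls. in_V (q (map pr_g' ls) (pr_V' x))) \<in> L.cochains n"
      by (rule Hom_wedge_compose[OF q linear_projections(2) linear_inclusions(3)])
    ultimately show "contract x (paired_embed (p, q)) \<in> L.cochains n"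
      using Suc.IH[OF paired_parts_contract[OF Suc.prems]]
      by (simp only: L.self.Hom_wedge_add L.self.Hom_wedge_signed)
  qed
qed

abbreviation wt_unprimed where "wt_unprimed \<equiv> L.has_weight (L.doubling proj_unprimed)"
abbreviation wt_module where "wt_module \<equiv> L.has_weight (L.doubling proj_module)"

lemma paired_embed_weights:
  assumes "\<And>xs. Vector_Spaces.linear sv sv (q xs)"
  shows "paired_embed (p, q) (map (L.doubling proj_unprimed) ls) = paired_embed (p, q) ls"
    and "paired_embed (p, q) (map (L.doubling proj_module) ls) = L.doubling proj_module (paired_embed (p, q) ls)"
    and "proj_unprimed (paired_embed (p, q) ls) = paired_embed (p, q) ls"
  using assms
proof (induction ls arbitrary: p q)
  case Nil
  {
    case 1 show ?case by (simp add: paired_embed_def)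
  next
    case 2 show ?case by (simp add: paired_embed_def L.doubling_def quad_simps)
  next
    case 3 show ?case by (simp add: paired_embed_def quad_simps)
  }
next
  case (Cons l ls)
  have pr: "pr_g' (L.doubling proj_unprimed x) = pr_g' x" "pr_V' (L.doubling proj_unprimed x) = pr_V' x"
    "pr_g' (L.doubling proj_module x) = pr_g' x" "pr_V' (L.doubling proj_module x) = pr_V' x + pr_V' x"
    for x by (auto simp: L.doubling_def quad_simps split: prod.splits)
  have prs: "map (pr_g' \<circ> L.doubling proj_unprimed) ls = map pr_g' ls"
    "map (pr_g' \<circ> L.doubling proj_module) ls = map pr_g' ls"
    using pr by auto
  have dbl: "L.doubling proj_module (signed k (in_V v)) = signed k (in_V (v + v))"
    "proj_unprimed (signed k (in_V v)) = signed k (in_V v)" for k v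
    by (auto simp: signed_def L.doubling_def quad_simps)
  {
    case 1
    then have con: "\<And>xs. Vector_Spaces.linear sv sv (contract (pr_g' l) q xs)" by simp
    show ?case using Cons.IH(1)[of "contract (pr_g' l) q" "contract (pr_g' l) p", OF con] 1
      by (simp add: paired_embed_Cons pr prs del: contract_apply)
  next
    case 2
    then have con: "\<And>xs. Vector_Spaces.linear sv sv (contract (pr_g' l) q xs)" by simp
    show ?case using Cons.IH(2)[of "contract (pr_g' l) q" "contract (pr_g' l) p", OF con] 2
      L.self.linear_add[OF L.linear_doubling[OF linear_proj_module]]
      by (simp add: paired_embed_Cons pr prs dbl VV.linear_add del: contract_apply)
  next
    case 3
    then have con: "\<And>xs. Vector_Spaces.linear sv sv (contract (pr_g' l) q xs)" by simp
    show ?case using Cons.IH(3)[of "contract (pr_g' l) q" "contract (pr_g' l) p", OF con] 3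
      L.self.linear_add[OF linear_proj_unprimed]
      by (simp add: paired_embed_Cons dbl del: contract_apply)
  }
qed

lemma paired_embed_on_primed:
  assumes "\<And>xs. Vector_Spaces.linear sv sv (q xs)"
  shows "paired_embed (p, q) (map in_g' xs) = in_g (p xs)"
  using assms
proof (induction xs arbitrary: p q)
  case Nil
  then show ?case by (simp add: paired_embed_def)
next
  case (Cons x xs)
  then show ?case
    using Cons.IH[of "contract x q" "contract x p"] VV.linear_0[OF Cons.prems]
    by (simp add: paired_embed_Cons)
qed

lemma paired_embed_on_primed_V:
  assumes "paired_parts n p q"
  shows "paired_embed (p, q) (in_V' v # map in_g' xs) = signed (length xs) (in_V (q xs v))"
proof -
  have "contract 0 p = 0" "contract 0 q = 0"
    using paired_parts_head(1,2)[OF assms, of 0 0] by auto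
  moreover have "paired_embed (0, 0) = (0 :: ('g, 'v) quad list \<Rightarrow> _)"
    using paired_embed_0 by (simp only: zero_prod_def)
  ultimately show ?thesis by (simp add: paired_embed_Cons)
qed

text \<open>
  The intrinsic description, in positive arity, of the image of \<open>paired_embed\<close> (see \<open>embedded_is_image\<close>). Weight \<open>1/2\<close> for
  the unprimed summands says that all arguments are primed and the value is unprimed; weight 1
  for the module summands says that the value lies in \<open>V\<close> if exactly one argument is in \<open>V'\<close>, lies in \<open>g\<close> if
  none is, and vanishes otherwise. Both conditions are preserved by brackets up to a known factor.
\<close>

definition embedded :: "nat \<Rightarrow> (('g, 'v) quad list \<Rightarrow> ('g, 'v) quad) set" where
  "embedded n = {F \<in> L.cochains n. wt_unprimed (1/2) F \<and> wt_module 1 F}"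

lemma paired_embed_embedded:
  assumes "P \<in> paired_cochains sg sv n"
  shows "paired_embed P \<in> embedded n"
proof -
  obtain p q where P: "P = (p, q)" by (cases P)
  have pre: "paired_parts n p q" using paired_parts_if_mem[OF assms] P by simp
  note w = paired_embed_weights[OF paired_parts_linear[OF pre], where p = p]
  have "qs (1/2) (L.doubling proj_unprimed (paired_embed (p, q) xs)) = paired_embed (p, q) xs" for xs
    by (simp add: L.doubling_def w(3) L.double_eq)
  then show ?thesis
    using w paired_embed_cochain_pre[OF pre] by (simp add: embedded_def P L.has_weight_def)
qed

lemma paired_embed_inj: "inj_on paired_embed (paired_cochains sg sv n)"
proof (rule inj_onI)
  fix P Q assume P: "P \<in> paired_cochains sg sv n" and Q: "Q \<in> paired_cochains sg sv n"
    and eq: "paired_embed P = paired_embed Q"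
  note preP = paired_parts_if_mem[OF P] and preQ = paired_parts_if_mem[OF Q]
  have "in_g (fst P xs) = (in_g (fst Q xs) :: ('g, 'v) quad)" for xs
    using fun_cong[OF eq, of "map in_g' xs"]
      paired_embed_on_primed[of "snd P" "fst P", OF paired_parts_linear[OF preP]]
      paired_embed_on_primed[of "snd Q" "fst Q", OF paired_parts_linear[OF preQ]] by simp
  moreover have "signed (length xs) (in_V (snd P xs v)) = (signed (length xs) (in_V (snd Q xs v)) :: ('g, 'v) quad)" for xs v
    using fun_cong[OF eq, of "in_V' v # map in_g' xs"]
      paired_embed_on_primed_V[OF preP] paired_embed_on_primed_V[OF preQ] by simp
  ultimately have "fst P xs = fst Q xs" "snd P xs v = snd Q xs v" for xs v
    unfolding signed_inject by (simp_all add: in_g_def in_V_def)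
  then show "P = Q" by (simp add: prod_eq_iff fun_eq_iff)
qed

lemma cochain_0_eqI: "G \<in> Hom_wedge s1 s2 0 \<Longrightarrow> G [] = 0 \<Longrightarrow> G = 0"
  unfolding Hom_wedge_0_iff by (metis ext zero_fun_apply)

lemma quad_decompose: "l = in_g (pr_g l) + in_g' (pr_g' l) + in_V (pr_V l) + in_V' (pr_V' l)"
  by (cases l) (simp add: quad_simps)

text \<open>
  By weight, such a cochain has values in \<open>V\<close> and vanishes as soon as one argument lies in \<open>V'\<close>. It is the
  form taken by an embedded cochain after contraction with one element of \<open>V'\<close>.
\<close>

lemma module_half_vanishing:
  assumes "G \<in> L.cochains n" "wt_unprimed (1/2) G" "wt_module (1/2) G"
    and "\<And>xs. G (map in_g' xs) = 0"
  shows "G = 0"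
  using assms
proof (induction n arbitrary: G)
  case 0
  then show ?case using Hom_wedge_length[OF 0(1)] 0(4)[of "[]"]
    by (auto simp: fun_eq_iff) (metis length_0_conv list.size(3))
next
  case (Suc n)
  have con: "contract x G \<in> L.cochains n" for x using L.self.contract_Hom_wedge[OF Suc.prems(1)] by simp
  have e: "proj_unprimed (in_g x) = in_g x" "proj_unprimed (in_V v) = in_V v" "proj_unprimed (in_g' x) = 0"
     "proj_module (in_g' x) = 0" "proj_module (in_V' v) = in_V' v" for x v
    by (auto simp: quad_simps)
  show ?case
  proof (rule cochain_eqI)
    show "G [] = 0 []" using Suc.prems(4)[of "[]"] by simp
    fix l :: "('g, 'v) quad"
    note half = L.weight_half_contract[OF linear_proj_unprimed idempotent_projections(1) Suc.prems(1,2)]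
    have "contract (in_V' (pr_V' l)) G = 0"
      by (rule L.weight_half_contract[OF linear_proj_module idempotent_projections(2) Suc.prems(1,3) e(5)])
    moreover have "contract (in_g' (pr_g' l)) G = 0"
    proof (rule Suc.IH[OF con])
      show "contract (in_g' (pr_g' l)) G (map in_g' xs) = 0" for xs
        using Suc.prems(4)[of "pr_g' l # xs"] by simp
    qed (intro L.has_weight_contract_fixed Suc.prems e)+
    moreover have "contract l G = contract (in_g (pr_g l)) G + contract (in_g' (pr_g' l)) G
        + contract (in_V (pr_V l)) G + contract (in_V' (pr_V' l)) G"
      unfolding L.contract_add[OF Suc.prems(1), symmetric] by (rule arg_cong[OF quad_decompose])
    ultimately show "contract l G = contract l 0"
      unfolding half[OF e(1)] half[OF e(2)] contract_0 by (simp only: add_0_right)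
  qed
qed

text \<open>
  Uniqueness: an embedded cochain is determined by its values on \<open>g'\<close> alone and on one argument
  from \<open>V'\<close> followed by arguments from \<open>g'\<close>. All other values vanish by weight.
\<close>

lemma embedded_eq_0I:
  assumes "G \<in> embedded n" and "\<And>xs. G (map in_g' xs) = 0" and "\<And>v xs. G (in_V' v # map in_g' xs) = 0"
  shows "G = 0"
proof -
  have "G \<in> L.cochains n" "wt_unprimed (1/2) G" "wt_module 1 G"
    using assms(1) by (auto simp: embedded_def)
  then show ?thesis using assms(2,3)
  proof (induction n arbitrary: G)
    case 0
    then show ?case using 0(4)[of "[]"] by (intro cochain_0_eqI[OF 0(1)]) simp
  next
    case (Suc n)
    have con: "contract x G \<in> L.cochains n" for x using L.self.contract_Hom_wedge[OF Suc.prems(1)] by simp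
    have e: "proj_unprimed (in_g x) = in_g x" "proj_unprimed (in_V v) = in_V v"
      "proj_unprimed (in_g' x) = 0" "proj_unprimed (in_V' v) = 0"
      "proj_module (in_g' x) = 0" "proj_module (in_V' v) = in_V' v" for x v
      by (auto simp: quad_simps)
    show ?case
    proof (rule cochain_eqI)
      show "G [] = 0 []" using Suc.prems(4)[of "[]"] by simp
      fix l :: "('g, 'v) quad"
      note half = L.weight_half_contract[OF linear_proj_unprimed idempotent_projections(1) Suc.prems(1,2)]
      have "contract (in_V' (pr_V' l)) G = 0"
      proof (rule module_half_vanishing[OF con])
        show "wt_unprimed (1/2) (contract (in_V' (pr_V' l)) G)"
          by (intro L.has_weight_contract_fixed Suc.prems e)
        show "wt_module (1/2) (contract (in_V' (pr_V' l)) G)"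
          by (rule L.has_weight_contract_doubled[OF Suc.prems(1,3) e(6)])
      qed (use Suc.prems(5) in simp)
      moreover have "contract (in_g' (pr_g' l)) G = 0"
      proof (rule Suc.IH[OF con])
        show "contract (in_g' (pr_g' l)) G (map in_g' xs) = 0" for xs
          using Suc.prems(4)[of "pr_g' l # xs"] by simp
        show "contract (in_g' (pr_g' l)) G (in_V' v # map in_g' xs) = 0" for v xs
          using Suc.prems(5)[of v "pr_g' l # xs"]
            L.self.Hom_wedge_swap_head[OF Suc.prems(1), of "in_g' (pr_g' l)" "in_V' v" "map in_g' xs"]
          by simp
      qed (intro L.has_weight_contract_fixed Suc.prems e)+
      moreover have "contract l G = contract (in_g (pr_g l)) G + contract (in_g' (pr_g' l)) G
          + contract (in_V (pr_V l)) G + contract (in_V' (pr_V' l)) G"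
        unfolding L.contract_add[OF Suc.prems(1), symmetric] by (rule arg_cong[OF quad_decompose])
      ultimately show "contract l G = contract l 0"
        unfolding half[OF e(1)] half[OF e(2)] contract_0 by (simp only: add_0_right)
    qed
  qed
qed

lemma has_weight_diff:
  assumes "Vector_Spaces.linear qs qs \<phi>" "L.has_weight \<phi> a F" "L.has_weight \<phi> a G"
  shows "L.has_weight \<phi> a (F - G)"
  using assms(2,3) by (simp add: L.has_weight_def L.self.linear_diff[OF assms(1)] L.scale_right_diff_distrib)

lemma embedded_diff:
  assumes "F \<in> embedded n" "G \<in> embedded n"
  shows "F - G \<in> embedded n"
  using assms has_weight_diff[OF L.linear_doubling[OF linear_proj_unprimed]]
    has_weight_diff[OF L.linear_doubling[OF linear_proj_module]]
  by (simp add: embedded_def L.self.Hom_wedge_diff)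

text \<open>
  The candidate preimage of \<open>F\<close> reads off \<open>p\<close> and \<open>q\<close> from the values that determine an embedded
  cochain. The argument from \<open>V'\<close> is fed in first rather than last, since contractions act on the
  first argument; this accounts for the sign in \<open>q\<close>.
\<close>

theorem embedded_is_image:
  assumes "n > 0"
  shows "embedded n = paired_embed ` paired_cochains sg sv n"
proof
  show "paired_embed ` paired_cochains sg sv n \<subseteq> embedded n"
    using paired_embed_embedded by blast
  show "embedded n \<subseteq> paired_embed ` paired_cochains sg sv n"
  proof
    fix F assume F: "F \<in> embedded n"
    then have Fc: "F \<in> L.cochains n" and w: "wt_unprimed (1/2) F" "wt_module 1 F"
      by (auto simp: embedded_def)
    define p where "p xs = pr_g (F (map in_g' xs))" for xs
    define q where "q xs v = signed (length xs) (pr_V (F (in_V' v # map in_g' xs)))" for xs v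
    have unprimed: "proj_unprimed (F ls) = F ls" for ls
      by (rule L.weight_half_values[OF linear_proj_unprimed idempotent_projections(1) Fc w(1)])
    (* arguments from g' are fixed by the module doubling, so the value is fixed as well, that is, in g *)
    have fix_g': "map (L.doubling proj_module) (map in_g' xs) = map in_g' xs" for xs
      by (simp add: L.doubling_def quad_simps)
    have val_g: "F (map in_g' xs) = in_g (p xs)" for xs
    proof -
      have "F (map in_g' xs) = L.doubling proj_module (F (map in_g' xs))"
        using w(2)[unfolded L.has_weight_def, rule_format, of "map in_g' xs"] unfolding fix_g' by simp
      then have "proj_module (F (map in_g' xs)) = 0" by (simp add: L.doubling_def)
      then show ?thesis unfolding p_def using unprimed[of "map in_g' xs"]
        by (cases "F (map in_g' xs)") (simp add: quad_simps)
    qed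
    have val_V: "F (in_V' v # map in_g' xs) = signed (length xs) (in_V (q xs v))" for xs v
    proof -
      (* one argument from V' is doubled, so the value is doubled, that is, in V *)
      have "F (in_V' v # map in_g' xs) + F (in_V' v # map in_g' xs) =
          F (L.doubling proj_module (in_V' v) # map (L.doubling proj_module) (map in_g' xs))"
        unfolding fix_g' using L.cochain_head_add[OF Fc, of "in_V' v" "in_V' v" "map in_g' xs"]
        by (simp add: L.doubling_def quad_simps)
      also have "\<dots> = L.doubling proj_module (F (in_V' v # map in_g' xs))"
        using w(2)[unfolded L.has_weight_def, rule_format, of "in_V' v # map in_g' xs"] by simp
      finally have "proj_module (F (in_V' v # map in_g' xs)) = F (in_V' v # map in_g' xs)"
        by (simp add: L.doubling_def)
      then show ?thesis using unprimed[of "in_V' v # map in_g' xs"]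
        by (cases "F (in_V' v # map in_g' xs)") (simp add: q_def signed_def quad_simps)
    qed
    have p: "p \<in> Hom_wedge sg sg n"
      using Hom_wedge_compose[OF Fc linear_inclusions(2) linear_projections(1)]
      by (simp only: p_def[abs_def])
    have q: "q \<in> Hom_wedge_tensor sg sv (n - 1)"
      unfolding Hom_wedge_tensor_def
    proof (safe)
      fix v xs
      have "contract (in_V' v) F \<in> L.cochains (n - 1)" by (rule L.self.contract_Hom_wedge[OF Fc])
      note comp = Hom_wedge_compose[OF this linear_inclusions(2) linear_projections(3)]
      have "(\<lambda>xs. q xs v) = signed (n - 1) (\<lambda>xs. pr_V (contract (in_V' v) F (map in_g' xs)))"
      proof
        fix xs
        show "q xs v = signed (n - 1) (\<lambda>xs. pr_V (contract (in_V' v) F (map in_g' xs))) xs"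
          using Hom_wedge_length[OF comp, of xs]
          by (cases "length xs = n - 1") (simp_all add: q_def signed_apply)
      qed
      then show "(\<lambda>xs. q xs v) \<in> Hom_wedge sg sv (n - 1)"
        using GV.Hom_wedge_signed[OF comp] by simp
      have "Vector_Spaces.linear sv sv (\<lambda>v. pr_V (F (in_V' v # map in_g' xs)))"
        using Vector_Spaces.linear_compose[OF Vector_Spaces.linear_compose[OF linear_inclusions(4)
              L.self.Hom_wedge_linear_head[OF Fc]] linear_projections(3)]
        by (simp add: o_def)
      then show "Vector_Spaces.linear sv sv (q xs)"
        unfolding q_def[abs_def] signed_def using VV.linear_compose_neg by (cases "even (length xs)") auto
    qed
    have mem: "(p, q) \<in> paired_cochains sg sv n"
      using p q assms by (simp add: paired_cochains_def)
    note pre = paired_parts_if_mem[OF mem, unfolded fst_conv snd_conv]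
    have "F - paired_embed (p, q) = 0"
    proof (rule embedded_eq_0I)
      show "F - paired_embed (p, q) \<in> embedded n"
        by (rule embedded_diff[OF F paired_embed_embedded[OF mem]])
      show "(F - paired_embed (p, q)) (map in_g' xs) = 0" for xs
        by (simp add: val_g paired_embed_on_primed[OF paired_parts_linear[OF pre]])
      show "(F - paired_embed (p, q)) (in_V' v # map in_g' xs) = 0" for v xs
        by (simp add: val_V paired_embed_on_primed_V[OF pre])
    qed
    then show "F \<in> paired_embed ` paired_cochains sg sv n" using mem by force
  qed
qed

end

lemma (in vector_space) scale_2: "scale 2 x = x + x"
  using scale_left_distrib[of 1 1 x] by simp

context nr_cochains
begin

text \<open>
  The product on cochains of arity at most 2, obtained by contracting until vectors remain. These
  formulas suffice for the square of \<open>\<theta>\<close> and for the Maurer-Cartan equation.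
\<close>

lemma nr_comp_1_1:
  assumes f: "f \<in> cochains 1" and g: "g \<in> cochains 1"
  shows "nr_comp scale 1 1 f g [a] = f [g [a]]"
proof -
  have "contract a f \<in> cochains 0" using self.contract_Hom_wedge[OF f, of a] by simp
  then show ?thesis
    using fun_cong[OF contract_nr_comp[OF f g, of a], of "[]"]
      nr_comp_arity_0_right[OF f, of "contract a g"] nr_comp_arity_0_left[of "contract a f" 1 g]
    by (simp add: contract_def)
qed

lemma nr_comp_1_2:
  assumes f: "f \<in> cochains 1" and g: "g \<in> cochains 2"
  shows "nr_comp scale 1 2 f g [a, b] = f [g [a, b]]"
proof -
  have "contract a f \<in> cochains 0" "contract a g \<in> cochains 1"
    using self.contract_Hom_wedge[OF f, of a] self.contract_Hom_wedge[OF g, of a] by auto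
  then show ?thesis
    using fun_cong[OF contract_nr_comp[OF f g, of a], of "[b]"]
      nr_comp_1_1[OF f, of "contract a g" b] nr_comp_arity_0_left[of "contract a f" 2 g]
    by (simp add: contract_def)
qed

lemma nr_comp_2_1:
  assumes f: "f \<in> cochains 2" and g: "g \<in> cochains 1"
  shows "nr_comp scale 2 1 f g [a, b] = f [g [a], b] + f [a, g [b]]"
proof -
  have "contract a f \<in> cochains 1" using self.contract_Hom_wedge[OF f, of a] by simp
  then show ?thesis
    using fun_cong[OF contract_nr_comp[OF f g, of a], of "[b]"]
      nr_comp_arity_0_right[OF f, of "contract a g"] nr_comp_1_1[of "contract a f" g b] g
    by (simp add: contract_def signed_def)
qed

lemma nr_comp_2_2:
  assumes f: "f \<in> cochains 2" and g: "g \<in> cochains 2"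
  shows "nr_comp scale 2 2 f g [a, b, c] = f [g [a, b], c] + f [b, g [a, c]] - f [a, g [b, c]]"
proof -
  have "contract a f \<in> cochains 1" "contract a g \<in> cochains 1"
    using self.contract_Hom_wedge[OF f, of a] self.contract_Hom_wedge[OF g, of a] by auto
  then show ?thesis
    using fun_cong[OF contract_nr_comp[OF f g, of a], of "[b, c]"]
      nr_comp_2_1[OF f, of "contract a g" b c] nr_comp_1_2[of "contract a f" g b c] g
    by (simp add: contract_def signed_def)
qed

lemma nr_bracket_2_1:
  assumes f: "f \<in> cochains 2" and g: "g \<in> cochains 1"
  shows "nrb 2 1 f g [a, b] = f [g [a], b] + f [a, g [b]] - g [f [a, b]]"
  using nr_comp_2_1[OF assms] nr_comp_1_2[OF g f] by (simp add: nr_bracket_eq signed_def)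

definition binary :: "('l \<Rightarrow> 'l \<Rightarrow> 'l) \<Rightarrow> 'l list \<Rightarrow> 'l" where
  "binary \<beta> ls = (if length ls = 2 then \<beta> (ls ! 0) (ls ! 1) else 0)"

lemma binary_apply [simp]: "binary \<beta> [a, b] = \<beta> a b"
  by (simp add: binary_def)

lemma binary_cochain:
  assumes "\<And>b. Vector_Spaces.linear scale scale (\<lambda>a. \<beta> a b)"
    and "\<And>a. Vector_Spaces.linear scale scale (\<beta> a)" and "\<And>a. \<beta> a a = 0"
  shows "binary \<beta> \<in> cochains 2"
proof (rule Hom_wedgeI)
  show "binary \<beta> xs = 0" if "length xs \<noteq> 2" for xs using that by (simp add: binary_def)
  show "Vector_Spaces.linear scale scale (\<lambda>x. binary \<beta> (xs[i := x]))" if "length xs = 2" "i < 2" for xs i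
    using that assms(1,2) by (cases i) (auto simp: binary_def less_2_cases_iff)
  show "binary \<beta> xs = 0" if "length xs = 2" "i < j" "j < 2" "xs ! i = xs ! j" for xs i j
    using that assms(3) by (auto simp: binary_def less_2_cases_iff)
qed

lemma binary_has_weight:
  assumes "Vector_Spaces.linear scale scale \<phi>" "\<And>a b. \<beta> (\<phi> a) (\<phi> b) = scale c (\<phi> (\<beta> a b))"
  shows "has_weight \<phi> c (binary \<beta>)"
  using assms(2) self.linear_0[OF assms(1)] by (auto simp: has_weight_def binary_def)

text \<open>
  The Jacobi identity read as: the bracket with a cochain of degree 1 is an odd derivation.
\<close>

lemma nr_bracket_derivation:
  assumes t: "t \<in> cochains 2" and F: "F \<in> cochains (Suc a)" and G: "G \<in> cochains (Suc b)"
  shows "nrb 2 (Suc (a + b)) t (nrb (Suc a) (Suc b) F G) =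
    nrb (Suc (Suc a)) (Suc b) (nrb 2 (Suc a) t F) G
    + signed a (nrb (Suc a) (Suc (Suc b)) F (nrb 2 (Suc b) t G))"
proof -
  have "t \<in> cochains (Suc 1)" using t by (simp add: numeral_2_eq_2)
  from nr_bracket_jacobi[OF this F G] show ?thesis by (simp add: numeral_2_eq_2)
qed

lemma nr_bracket_zero_left: "g \<in> cochains n \<Longrightarrow> nrb m n 0 g = 0"
  by (simp add: nr_bracket_eq nr_comp_zero_left nr_comp_zero_right)

lemma nr_bracket_zero_right: "f \<in> cochains m \<Longrightarrow> nrb m n f 0 = 0"
  by (simp add: nr_bracket_eq nr_comp_zero_left nr_comp_zero_right)

lemma nr_bracket_uminus_left: "g \<in> cochains n \<Longrightarrow> nrb m n (- f) g = - nrb m n f g"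
  by (simp add: nr_bracket_eq nr_comp_uminus_left nr_comp_uminus_right signed_def)

lemma nr_bracket_uminus_right: "f \<in> cochains m \<Longrightarrow> nrb m n f (- g) = - nrb m n f g"
  by (simp add: nr_bracket_eq nr_comp_uminus_left nr_comp_uminus_right signed_def)

lemma nr_bracket_signed_left: "g \<in> cochains n \<Longrightarrow> nrb m n (signed k f) g = signed k (nrb m n f g)"
  by (simp add: signed_def nr_bracket_uminus_left)

lemma nr_bracket_signed_right: "f \<in> cochains m \<Longrightarrow> nrb m n f (signed k g) = signed k (nrb m n f g)"
  by (simp add: signed_def nr_bracket_uminus_right)

lemma nr_bracket_2_closed:
  assumes "t \<in> cochains 2" "F \<in> cochains (Suc a)"
  shows "nrb 2 (Suc a) t F \<in> cochains (Suc (Suc a))"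
  using nr_bracket_closed[OF assms] by simp

text \<open>
  By the derivation property, \<open>[t,[s,F]] + [s,[t,F]] = [[t,s],F]\<close>.
\<close>

lemma anticommuting_derivations:
  assumes t: "t \<in> cochains 2" and s: "s \<in> cochains 2" and F: "F \<in> cochains (Suc a)"
    and ts: "nr_comp scale 2 2 t s + nr_comp scale 2 2 s t = 0"
  shows "nrb 2 (Suc (Suc a)) t (nrb 2 (Suc a) s F) = - nrb 2 (Suc (Suc a)) s (nrb 2 (Suc a) t F)"
proof -
  have s': "s \<in> cochains (Suc 1)" using s by (simp add: numeral_2_eq_2)
  have "nrb 2 2 t s = 0" using ts by (simp add: nr_bracket_eq signed_def)
  then show ?thesis
    using nr_bracket_derivation[OF t s' F] F
    by (simp add: numeral_2_eq_2 signed_def nr_bracket_zero_left)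
qed

end

lemma (in nr_cochains_char_0) square_zero_derivation:
  assumes t: "t \<in> cochains 2" and F: "F \<in> cochains (Suc a)"
    and tt: "nr_comp scale 2 2 t t = 0"
  shows "nrb 2 (Suc (Suc a)) t (nrb 2 (Suc a) t F) = 0"
proof -
  let ?v = "nrb 2 (Suc (Suc a)) t (nrb 2 (Suc a) t F)"
  (* t is odd, so anticommuting with itself says twice the square is 0 *)
  have "?v = - ?v" by (rule anticommuting_derivations[OF t t F]) (simp add: tt)
  then have "?v + ?v = 0" by (simp only: eq_neg_iff_add_eq_0)
  from fun_cong[OF this] have "?v xs + ?v xs = 0" for xs by simp
  then have "?v xs = 0" for xs by (rule eq_0_if_double_eq_0)
  then show ?thesis by (simp add: fun_eq_iff)
qed

section \<open>The structure cochains and their brackets\<close>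

locale lie_representation_char_0 = lie_representation sg lie sv \<rho>
  for sg :: "'k::field_char_0 \<Rightarrow> 'g::ab_group_add \<Rightarrow> 'g"
    and lie :: "'g \<Rightarrow> 'g \<Rightarrow> 'g"
    and sv :: "'k \<Rightarrow> 'v::ab_group_add \<Rightarrow> 'v"
    and \<rho> :: "'g \<Rightarrow> 'v \<Rightarrow> 'v" +
  fixes lam :: 'k
begin

sublocale paired_spaces sg sv by unfold_locales

lemmas lie_bilinear = GG.linear_add[OF lie_linear_left] GG.linear_add[OF lie_linear_right]
  GG.linear_diff[OF lie_linear_left] GG.linear_diff[OF lie_linear_right]
  GG.linear_neg[OF lie_linear_left] GG.linear_neg[OF lie_linear_right]
  GG.linear_scale[OF lie_linear_left] GG.linear_scale[OF lie_linear_right]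
  GG.linear_0[OF lie_linear_left] GG.linear_0[OF lie_linear_right]

lemmas rho_bilinear = GV.linear_add[OF rho_linear_left] VV.linear_add[OF rho_linear_right]
  GV.linear_diff[OF rho_linear_left] VV.linear_diff[OF rho_linear_right]
  GV.linear_neg[OF rho_linear_left] VV.linear_neg[OF rho_linear_right]
  GV.linear_scale[OF rho_linear_left] VV.linear_scale[OF rho_linear_right]
  GV.linear_0[OF rho_linear_left] VV.linear_0[OF rho_linear_right]

lemma lie_skew: "lie x y = - lie y x"
proof -
  have "0 = lie (x + y) (x + y)" by (simp add: lie_alternating)
  also have "\<dots> = lie x y + lie y x"
    unfolding lie_bilinear by (simp add: lie_alternating)
  finally have "lie x y + lie y x = 0" by (rule sym)
  then show ?thesis by (simp only: eq_neg_iff_add_eq_0)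
qed

lemma lie_lie: "lie (lie x y) z = lie x (lie y z) - lie y (lie x z)"
proof -
  have "- (lie x (lie y z) + lie y (lie z x)) = lie z (lie x y)"
    by (rule add.inverse_unique[OF lie_jacobi])
  moreover have "lie (lie x y) z = - lie z (lie x y)" by (rule lie_skew)
  moreover have "lie y (lie z x) = - lie y (lie x z)"
    using lie_skew[of z x] by (simp only: lie_bilinear)
  ultimately show ?thesis by (metis add.inverse_inverse add_uminus_conv_diff)
qed

abbreviation \<theta> where "\<theta> \<equiv> theta lie \<rho>"
abbreviation \<theta>' where "\<theta>' \<equiv> theta' sg lie sv \<rho> lam"

text \<open>
  The bracket of \<open>h \<otimes> k[\<epsilon>]/(\<epsilon>\<^sup>2)\<close>, where \<open>h\<close> is the semidirect product of \<open>g\<close> and \<open>V\<close>.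
\<close>

definition theta_op :: "('g, 'v) quad \<Rightarrow> ('g, 'v) quad \<Rightarrow> ('g, 'v) quad" where
  "theta_op = (\<lambda>(x, x', v, v') (y, y', w, w').
     (lie x y, lie x y' - lie y x', \<rho> x w - \<rho> y v, \<rho> x w' - \<rho> y v' + (\<rho> x' w - \<rho> y' v)))"

text \<open>
  The correction, up to sign, that replaces the relation \<open>\<epsilon>\<^sup>2 = 0\<close> by \<open>\<epsilon>\<^sup>2 = \<lambda>\<epsilon>\<close>: it is supported on pairs of primed
  arguments.
\<close>

definition theta'_op :: "('g, 'v) quad \<Rightarrow> ('g, 'v) quad \<Rightarrow> ('g, 'v) quad" where
  "theta'_op = (\<lambda>(x, x', v, v') (y, y', w, w').
     (0, - sg lam (lie x' y'), 0, - sv lam (\<rho> x' w' - \<rho> y' v')))"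

lemma theta_eq: "\<theta> = L.binary theta_op"
proof
  fix ls
  show "\<theta> ls = L.binary theta_op ls"
    by (cases "ls ! 0"; cases "ls ! 1")
      (simp add: theta_def L.binary_def ext_same_def ext_mixed_def theta_op_def quad_simps)
qed

lemma theta'_eq: "\<theta>' = L.binary theta'_op"
proof
  fix ls
  show "\<theta>' ls = L.binary theta'_op ls"
    by (cases "ls ! 0"; cases "ls ! 1")
      (simp add: theta'_def L.binary_def ext_same_def ext_mixed_def theta'_op_def quad_simps
        V.scale_right_diff_distrib)
qed

lemmas scale_simps = scale_right_distrib V.scale_right_distrib scale_right_diff_distrib
  V.scale_right_diff_distrib

lemma theta_op_linear:
  "Vector_Spaces.linear qs qs (\<lambda>a. theta_op a b)" "Vector_Spaces.linear qs qs (theta_op a)"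
  "Vector_Spaces.linear qs qs (\<lambda>a. theta'_op a b)" "Vector_Spaces.linear qs qs (theta'_op a)"
proof -
  note simps = theta_op_def theta'_op_def quad_scale_def lie_bilinear rho_bilinear scale_simps
    mult.commute algebra_simps
  show "Vector_Spaces.linear qs qs (\<lambda>a. theta_op a b)"
    by (cases b, rule L.self.linear_mapI) (auto simp: simps)
  show "Vector_Spaces.linear qs qs (theta_op a)"
    by (cases a, rule L.self.linear_mapI) (auto simp: simps)
  show "Vector_Spaces.linear qs qs (\<lambda>a. theta'_op a b)"
    by (cases b, rule L.self.linear_mapI) (auto simp: simps)
  show "Vector_Spaces.linear qs qs (theta'_op a)"
    by (cases a, rule L.self.linear_mapI) (auto simp: simps)
qed

lemma theta_cochain: "\<theta> \<in> L.cochains 2"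
  unfolding theta_eq
proof (rule L.binary_cochain[OF theta_op_linear(1,2)])
  show "theta_op a a = 0" for a
    by (cases a) (simp add: theta_op_def lie_alternating zero_prod_def)
qed

lemma theta'_cochain: "\<theta>' \<in> L.cochains 2"
  unfolding theta'_eq
proof (rule L.binary_cochain[OF theta_op_linear(3,4)])
  show "theta'_op a a = 0" for a
    by (cases a) (simp add: theta'_op_def lie_alternating zero_prod_def)
qed

text \<open>
  Every bracket in \<open>\<theta>\<close> uses up one unprimed argument more than it returns, and \<open>\<theta>'\<close> as many as
  it returns; both return as many module elements as they take.
\<close>

lemma theta_weights:
  "wt_unprimed 2 \<theta>" "wt_module 1 \<theta>" "wt_unprimed 1 \<theta>'" "wt_module 1 \<theta>'"
proof -
  note weight_unprimed = L.binary_has_weight[OF L.linear_doubling[OF linear_proj_unprimed]]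
  note weight_module = L.binary_has_weight[OF L.linear_doubling[OF linear_proj_module]]
  note simps = theta_op_def theta'_op_def L.doubling_def proj_unprimed_def proj_module_def quad_scale_def
    lie_bilinear rho_bilinear scale_2 V.scale_2 scale_simps algebra_simps
  show "wt_unprimed 2 \<theta>" unfolding theta_eq
  proof (rule weight_unprimed)
    show "theta_op (L.doubling proj_unprimed a) (L.doubling proj_unprimed b) =
        qs 2 (L.doubling proj_unprimed (theta_op a b))" for a b
      by (cases a; cases b) (simp add: simps)
  qed
  show "wt_module 1 \<theta>" unfolding theta_eq
  proof (rule weight_module)
    show "theta_op (L.doubling proj_module a) (L.doubling proj_module b) =
        qs 1 (L.doubling proj_module (theta_op a b))" for a b
      by (cases a; cases b) (simp add: simps)
  qed
  show "wt_unprimed 1 \<theta>'" unfolding theta'_eq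
  proof (rule weight_unprimed)
    show "theta'_op (L.doubling proj_unprimed a) (L.doubling proj_unprimed b) =
        qs 1 (L.doubling proj_unprimed (theta'_op a b))" for a b
      by (cases a; cases b) (simp add: simps)
  qed
  show "wt_module 1 \<theta>'" unfolding theta'_eq
  proof (rule weight_module)
    show "theta'_op (L.doubling proj_module a) (L.doubling proj_module b) =
        qs 1 (L.doubling proj_module (theta'_op a b))" for a b
      by (cases a; cases b) (simp add: simps)
  qed
qed

text \<open>
  The form of the Jacobi identity in which no bracket stands in the first argument. It is not covered by
  the rewriting with \<open>lie_lie\<close>, which only removes brackets from the first argument.
\<close>

lemma lie_rotate: "lie y' (lie z x') = lie x' (lie z y') - lie z (lie x' y')"
  using lie_skew[of y' "lie z x'"] by (simp add: lie_lie)

text \<open>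
  The components, by powers of \<open>\<lambda>\<close>, of the Jacobi identity of \<open>h \<otimes> k[\<epsilon>]/(\<epsilon>\<^sup>2 - \<lambda>\<epsilon>)\<close>. After expanding on three
  vectors, everything reduces to the Jacobi identity of \<open>g\<close> and to the representation property.
\<close>

lemma theta_square: "nr_comp qs 2 2 \<theta> \<theta> = 0"
  and theta_theta': "nr_comp qs 2 2 \<theta> \<theta>' + nr_comp qs 2 2 \<theta>' \<theta> = 0"
  and theta'_square: "nr_comp qs 2 2 \<theta>' \<theta>' = 0"
proof -
  have vanish: "F = 0" if "F \<in> L.cochains 3" "\<And>a b c. F [a, b, c] = 0" for F
  proof
    fix ls
    show "F ls = 0 ls"
    proof (cases "length ls = 3")
      case True
      then obtain a b c where "ls = [a, b, c]" by (auto simp: numeral_3_eq_3 length_Suc_conv)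
      then show ?thesis using that(2) by simp
    qed (use Hom_wedge_length[OF that(1)] in simp)
  qed
  have closed: "nr_comp qs 2 2 f g \<in> L.cochains 3" if "f \<in> L.cochains 2" "g \<in> L.cochains 2" for f g
    using L.nr_comp_closed[OF that] by simp
  note ops = theta_op_def theta'_op_def lie_bilinear rho_bilinear lie_lie rho_lie scale_simps zero_prod_def
  show "nr_comp qs 2 2 \<theta> \<theta> = 0"
  proof (rule vanish[OF closed[OF theta_cochain theta_cochain]])
    fix a b c :: "('g, 'v) quad"
    show "nr_comp qs 2 2 \<theta> \<theta> [a, b, c] = 0"
      unfolding L.nr_comp_2_2[OF theta_cochain theta_cochain] unfolding theta_eq L.binary_apply
      by (cases a; cases b; cases c) (simp add: ops algebra_simps)
  qed
  show "nr_comp qs 2 2 \<theta>' \<theta>' = 0"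
  proof (rule vanish[OF closed[OF theta'_cochain theta'_cochain]])
    fix a b c :: "('g, 'v) quad"
    show "nr_comp qs 2 2 \<theta>' \<theta>' [a, b, c] = 0"
      unfolding L.nr_comp_2_2[OF theta'_cochain theta'_cochain] unfolding theta'_eq L.binary_apply
      by (cases a; cases b; cases c) (simp add: ops algebra_simps)
  qed
  show "nr_comp qs 2 2 \<theta> \<theta>' + nr_comp qs 2 2 \<theta>' \<theta> = 0"
  proof (rule vanish[OF L.self.Hom_wedge_add[OF closed[OF theta_cochain theta'_cochain]
          closed[OF theta'_cochain theta_cochain]]])
    fix a b c :: "('g, 'v) quad"
    obtain x x' v v' y y' w w' z z' u u' where abc: "a = (x, x', v, v')" "b = (y, y', w, w')" "c = (z, z', u, u')"
      by (metis surj_pair)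
    show "(nr_comp qs 2 2 \<theta> \<theta>' + nr_comp qs 2 2 \<theta>' \<theta>) [a, b, c] = 0"
      unfolding plus_fun_apply L.nr_comp_2_2[OF theta_cochain theta'_cochain]
        L.nr_comp_2_2[OF theta'_cochain theta_cochain]
      unfolding theta_eq theta'_eq L.binary_apply abc
      (* the mixed terms in g' have one unprimed and two primed entries, one instance for each
         choice of the unprimed one *)
      using arg_cong[OF lie_rotate[of y' z x'], of "sg lam"]
        arg_cong[OF lie_rotate[of z' y x'], of "sg lam"] arg_cong[OF lie_rotate[of z' x y'], of "sg lam"]
      by (simp add: ops algebra_simps)
  qed
qed

end

context lie_representation_char_0
begin

section \<open>The derived bracket on the embedded cochains\<close>

definition dbracket where
  "dbracket m n F G = signed m (L.nrb (m + 1) n (L.nrb 2 m \<theta> F) G)"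

lemma derived_bracket_eq:
  "derived_bracket sg lie sv \<rho> m n P Q = dbracket m n (paired_embed P) (paired_embed Q)"
  by (simp add: derived_bracket_def dbracket_def fun_eq_iff L.scale_minus_one_power signed_apply)

lemma embedded_cochain: "F \<in> embedded n \<Longrightarrow> F \<in> L.cochains n"
  by (simp add: embedded_def)

lemma has_weight_signed:
  assumes "Vector_Spaces.linear qs qs \<phi>" "L.has_weight \<phi> a f"
  shows "L.has_weight \<phi> a (signed k f)"
  using assms(2) by (auto simp: L.has_weight_def signed_def L.self.linear_neg[OF assms(1)])

lemma embedded_signed: "F \<in> embedded n \<Longrightarrow> signed k F \<in> embedded n"
  by (simp add: embedded_def L.self.Hom_wedge_signed
      has_weight_signed[OF L.linear_doubling[OF linear_proj_unprimed]]
      has_weight_signed[OF L.linear_doubling[OF linear_proj_module]])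

text \<open>
  The inner cochain has unprimed values, and the outer one vanishes on unprimed arguments.
\<close>

lemma embedded_abelian:
  assumes F: "F \<in> embedded m" and G: "G \<in> embedded n"
  shows "L.nrb m n F G = 0"
proof -
  have comp: "nr_comp qs m n F G = 0" if F: "F \<in> embedded m" and G: "G \<in> embedded n" for m n F G
  proof -
    have wF: "F \<in> L.cochains m" "wt_unprimed (1/2) F" and wG: "G \<in> L.cochains n" "wt_unprimed (1/2) G"
      using F G by (auto simp: embedded_def)
    have zero: "contract (G xs) F = 0" for xs
      by (rule L.weight_half_contract[OF linear_proj_unprimed idempotent_projections(1) wF
            L.weight_half_values[OF linear_proj_unprimed idempotent_projections(1) wG]])
    have "F (G xs # ys) = 0" for xs ys using fun_cong[OF zero, of xs ys] by simp
    then show ?thesis by (simp add: nr_comp_def fun_eq_iff)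
  qed
  show ?thesis by (simp add: L.nr_bracket_eq comp[OF F G] comp[OF G F])
qed

text \<open>
  The weights of \<open>\<theta>\<close> and of the two arguments multiply: \<open>2 \<cdot> 1/2 \<cdot> 1/2 = 1/2\<close> for the unprimed
  summands, and 1 for the module summands.
\<close>

lemma dbracket_closed:
  assumes F: "F \<in> embedded (Suc a)" and G: "G \<in> embedded (Suc b)"
  shows "dbracket (Suc a) (Suc b) F G \<in> embedded (Suc a + Suc b)"
proof -
  note up = L.linear_doubling[OF linear_proj_unprimed] and md = L.linear_doubling[OF linear_proj_module]
  have f: "F \<in> L.cochains (Suc a)" "wt_unprimed (1/2) F" "wt_module 1 F"
    and g: "G \<in> L.cochains (Suc b)" "wt_unprimed (1/2) G" "wt_module 1 G"
    using F G by (auto simp: embedded_def)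
  let ?D = "L.nrb 2 (Suc a) \<theta> F"
  have D: "?D \<in> L.cochains (Suc (Suc a))" by (rule L.nr_bracket_2_closed[OF theta_cochain f(1)])
  have "wt_unprimed 1 ?D" "wt_module 1 ?D"
    using L.nr_bracket_has_weight[OF theta_cochain f(1) up theta_weights(1) f(2)]
      L.nr_bracket_has_weight[OF theta_cochain f(1) md theta_weights(2) f(3)] by auto
  then have "L.nrb (Suc (Suc a)) (Suc b) ?D G \<in> embedded (Suc a + Suc b)"
    using L.nr_bracket_closed[OF D g(1)] L.nr_bracket_has_weight[OF D g(1) up _ g(2), of 1]
      L.nr_bracket_has_weight[OF D g(1) md _ g(3), of 1] by (simp add: embedded_def)
  then show ?thesis by (simp add: dbracket_def embedded_signed)
qed

lemma differential_closed:
  assumes F: "F \<in> embedded (Suc a)"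
  shows "L.nrb 2 (Suc a) \<theta>' F \<in> embedded (Suc (Suc a))"
proof -
  note up = L.linear_doubling[OF linear_proj_unprimed] and md = L.linear_doubling[OF linear_proj_module]
  have f: "F \<in> L.cochains (Suc a)" "wt_unprimed (1/2) F" "wt_module 1 F"
    using F by (auto simp: embedded_def)
  show ?thesis
    using L.nr_bracket_2_closed[OF theta'_cochain f(1)]
      L.nr_bracket_has_weight[OF theta'_cochain f(1) up theta_weights(3) f(2)]
      L.nr_bracket_has_weight[OF theta'_cochain f(1) md theta_weights(4) f(3)]
    by (simp add: embedded_def)
qed

text \<open>
  Apply the derivation \<open>[\<theta>,-]\<close> to \<open>[F,G] = 0\<close>.
\<close>

lemma dbracket_skew:
  assumes F: "F \<in> embedded (Suc a)" and G: "G \<in> embedded (Suc b)"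
  shows "dbracket (Suc a) (Suc b) F G = - signed (Suc a * Suc b) (dbracket (Suc b) (Suc a) G F)"
proof -
  note f = embedded_cochain[OF F] and g = embedded_cochain[OF G]
  let ?DF = "L.nrb 2 (Suc a) \<theta> F" and ?DG = "L.nrb 2 (Suc b) \<theta> G"
  have "L.nrb (Suc (Suc a)) (Suc b) ?DF G + signed a (L.nrb (Suc a) (Suc (Suc b)) F ?DG) = 0"
    unfolding L.nr_bracket_derivation[OF theta_cochain f g, symmetric] embedded_abelian[OF F G]
    by (rule L.nr_bracket_zero_right[OF theta_cochain])
  then have "L.nrb (Suc (Suc a)) (Suc b) ?DF G = - signed a (L.nrb (Suc a) (Suc (Suc b)) F ?DG)"
    by (simp only: eq_neg_iff_add_eq_0)
  also have "L.nrb (Suc a) (Suc (Suc b)) F ?DG = - signed (a * Suc b) (L.nrb (Suc (Suc b)) (Suc a) ?DG F)"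
    using L.nr_bracket_skew[of "Suc a" "Suc (Suc b)" F ?DG] by simp
  finally show ?thesis by (auto simp: dbracket_def signed_def)
qed

text \<open>
  With \<open>D = [\<theta>,-]\<close>, the Jacobi identity of the cochains \<open>D F\<close>, \<open>D G\<close>, \<open>H\<close> is the claim once \<open>[D F, D G]\<close>
  is recognized as \<open>D [D F, G]\<close> up to sign, which uses \<open>D D F = 0\<close>. The grading by arity instead of
  arity minus 1 is what makes the signs those of a graded Lie algebra.
\<close>

lemma dbracket_jacobi:
  assumes F: "F \<in> embedded (Suc a)" and G: "G \<in> embedded (Suc b)" and H: "H \<in> embedded (Suc c)"
  shows "dbracket (Suc a) (Suc b + Suc c) F (dbracket (Suc b) (Suc c) G H) =
    dbracket (Suc a + Suc b) (Suc c) (dbracket (Suc a) (Suc b) F G) H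
    + signed (Suc a * Suc b) (dbracket (Suc b) (Suc a + Suc c) G (dbracket (Suc a) (Suc c) F H))"
proof -
  note f = embedded_cochain[OF F] and g = embedded_cochain[OF G] and h = embedded_cochain[OF H]
  let ?DF = "L.nrb 2 (Suc a) \<theta> F" and ?DG = "L.nrb 2 (Suc b) \<theta> G"
  have DF: "?DF \<in> L.cochains (Suc (Suc a))" and DG: "?DG \<in> L.cochains (Suc (Suc b))"
    using L.nr_bracket_2_closed[OF theta_cochain] f g by auto
  (* the derivation rule for [D F, G] then has a single term *)
  have DDF: "L.nrb 2 (Suc (Suc a)) \<theta> ?DF = 0"
    by (rule L.square_zero_derivation[OF theta_cochain f theta_square])
  have D_bracket: "L.nrb 2 (Suc (Suc (a + b))) \<theta> (L.nrb (Suc (Suc a)) (Suc b) ?DF G) =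
      signed (Suc a) (L.nrb (Suc (Suc a)) (Suc (Suc b)) ?DF ?DG)"
    using L.nr_bracket_derivation[OF theta_cochain DF g]
    by (simp add: DDF L.nr_bracket_zero_left[OF g])
  have jacobi: "L.nrb (Suc (Suc a)) (Suc (Suc (b + c))) ?DF (L.nrb (Suc (Suc b)) (Suc c) ?DG H) =
      L.nrb (Suc (Suc (Suc (a + b)))) (Suc c) (L.nrb (Suc (Suc a)) (Suc (Suc b)) ?DF ?DG) H
      + signed (Suc a * Suc b)
          (L.nrb (Suc (Suc b)) (Suc (Suc (a + c))) ?DG (L.nrb (Suc (Suc a)) (Suc c) ?DF H))"
    using L.nr_bracket_jacobi[OF DF DG h] by simp
  show ?thesis
    unfolding dbracket_def
    by (simp add: L.nr_bracket_signed_right[OF DF] L.nr_bracket_signed_right[OF DG]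
        L.nr_bracket_signed_right[OF theta_cochain] L.nr_bracket_signed_left[OF h] D_bracket jacobi)
      (simp add: signed_def)
qed

lemma differential_square:
  assumes F: "F \<in> embedded (Suc a)"
  shows "L.nrb 2 (Suc (Suc a)) \<theta>' (L.nrb 2 (Suc a) \<theta>' F) = 0"
  by (rule L.square_zero_derivation[OF theta'_cochain embedded_cochain[OF F] theta'_square])

text \<open>
  The derivation \<open>[\<theta>',-]\<close> acts on both arguments of \<open>[[\<theta>,F],G]\<close>, and passing it through \<open>[\<theta>,-]\<close>
  produces the sign by which the degree of the first argument has grown.
\<close>

lemma differential_derivation:
  assumes F: "F \<in> embedded (Suc a)" and G: "G \<in> embedded (Suc b)"
  shows "L.nrb 2 (Suc a + Suc b) \<theta>' (dbracket (Suc a) (Suc b) F G) =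
    dbracket (Suc (Suc a)) (Suc b) (L.nrb 2 (Suc a) \<theta>' F) G
    + signed (Suc a) (dbracket (Suc a) (Suc (Suc b)) F (L.nrb 2 (Suc b) \<theta>' G))"
proof -
  note f = embedded_cochain[OF F] and g = embedded_cochain[OF G]
  let ?DF = "L.nrb 2 (Suc a) \<theta> F"
  have DF: "?DF \<in> L.cochains (Suc (Suc a))"
    by (rule L.nr_bracket_2_closed[OF theta_cochain f])
  have "L.nrb 2 (Suc (Suc a)) \<theta>' ?DF = - L.nrb 2 (Suc (Suc a)) \<theta> (L.nrb 2 (Suc a) \<theta>' F)"
    by (rule L.anticommuting_derivations[OF theta'_cochain theta_cochain f])
      (use theta_theta' in \<open>simp add: add.commute\<close>)
  then have "L.nrb 2 (Suc (Suc (a + b))) \<theta>' (L.nrb (Suc (Suc a)) (Suc b) ?DF G) =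
      - L.nrb (Suc (Suc (Suc a))) (Suc b) (L.nrb 2 (Suc (Suc a)) \<theta> (L.nrb 2 (Suc a) \<theta>' F)) G
      + signed (Suc a) (L.nrb (Suc (Suc a)) (Suc (Suc b)) ?DF (L.nrb 2 (Suc b) \<theta>' G))"
    using L.nr_bracket_derivation[OF theta'_cochain DF g]
    by (simp add: L.nr_bracket_uminus_left[OF g])
  then show ?thesis
    unfolding dbracket_def
    by (simp add: L.nr_bracket_signed_right[OF theta'_cochain]) (simp add: signed_def)
qed

section \<open>The bracket and the differential of paired cochains\<close>

abbreviation ps where "ps \<equiv> paired_scale sg sv"
abbreviation C where "C \<equiv> paired_cochains sg sv"
abbreviation pbr where "pbr \<equiv> paired_bracket sg lie sv \<rho>"
abbreviation pd where "pd \<equiv> paired_diff sg lie sv \<rho> lam"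
abbreviation pbr_homog where "pbr_homog \<equiv> paired_bracket_homog sg lie sv \<rho>"
abbreviation pd_homog where "pd_homog \<equiv> paired_diff_homog sg lie sv \<rho> lam"

sublocale P: vector_space ps
  by unfold_locales (auto simp: paired_scale_def fun_eq_iff prod_eq_iff scale_right_distrib
      V.scale_right_distrib scale_left_distrib V.scale_left_distrib)

lemma zero_mem [simp]: "0 \<in> C n"
proof -
  have "0 \<in> Hom_wedge_tensor sg sv k" for k
    by (simp add: Hom_wedge_tensor_def zero_fun_def GV.Hom_wedge_zero[unfolded zero_fun_def]
        VV.linear_zero_map)
  then show ?thesis by (simp add: paired_cochains_def zero_prod_def GG.Hom_wedge_zero)
qed

lemma paired_cochains_0 [simp]: "C 0 = {0}"
  by (simp add: paired_cochains_def)

lemma paired_embed_signed: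
  fixes P :: "('g, 'v) paired"
  shows "paired_embed (signed k P) = signed k (paired_embed P)"
proof -
  have "paired_embed (signed k P) = (\<lambda>ls. qs ((-1) ^ k) (paired_embed P ls))"
    unfolding P.scale_minus_one_power[symmetric] by (rule paired_embed_scale)
  then show ?thesis by (simp add: fun_eq_iff L.scale_minus_one_power signed_apply)
qed

lemma C_subspace: "P.subspace (C n)"
proof (cases "n = 0")
  case False
  have tensor: "q + r \<in> Hom_wedge_tensor sg sv k" "(\<lambda>xs v. sv c (q xs v)) \<in> Hom_wedge_tensor sg sv k"
    if "q \<in> Hom_wedge_tensor sg sv k" "r \<in> Hom_wedge_tensor sg sv k" for q r k c
    using that GV.Hom_wedge_add[of "\<lambda>xs. q xs v" k "\<lambda>xs. r xs v" for v]
      GV.Hom_wedge_scale[of "\<lambda>xs. q xs v" k c for v]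
    by (auto simp: Hom_wedge_tensor_def plus_fun_def VV.linear_compose_add VV.linear_compose_scale_right)
  have "0 \<in> Hom_wedge sg sg n \<times> Hom_wedge_tensor sg sv (n - 1)"
    using zero_mem[of n] False by (simp add: paired_cochains_def)
  then show ?thesis
    unfolding P.subspace_def
    using False tensor by (auto simp: paired_cochains_def paired_scale_def GG.Hom_wedge_add
        GG.Hom_wedge_scale)
qed (simp add: P.subspace_0 P.subspace_single_0)

lemmas C_add = P.subspace_add[OF C_subspace] and C_scale = P.subspace_scale[OF C_subspace]
  and C_neg = P.subspace_neg[OF C_subspace]

lemma C_signed: "P \<in> C n \<Longrightarrow> signed k P \<in> C n"
  by (simp add: signed_def C_neg)

lemma embed_cochain: "P \<in> C n \<Longrightarrow> paired_embed P \<in> L.cochains n"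
  using paired_embed_embedded embedded_cochain by blast

lemma embed_inject: "P \<in> C n \<Longrightarrow> Q \<in> C n \<Longrightarrow> paired_embed P = paired_embed Q \<Longrightarrow> P = Q"
  using paired_embed_inj[of n] by (auto dest: inj_onD)

text \<open>
  In degree 0 the only paired cochain is 0, so this case is separate from \<open>dbracket_closed\<close>.
\<close>

lemma derived_bracket_mem:
  assumes P: "P \<in> C m" and Q: "Q \<in> C n"
  shows "derived_bracket sg lie sv \<rho> m n P Q \<in> paired_embed ` C (m + n)"
proof (cases "m = 0 \<or> n = 0")
  case True
  have "L.nrb 2 m \<theta> (paired_embed P) \<in> L.cochains (m + 1)"
    using L.nr_bracket_closed[OF theta_cochain embed_cochain[OF P]] by simp
  then have "dbracket m n (paired_embed P) (paired_embed Q) = 0"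
    using True P Q embed_cochain[OF Q] unfolding dbracket_def
    by (auto simp: paired_embed_0 L.nr_bracket_zero_right theta_cochain L.nr_bracket_zero_left)
  then show ?thesis
    unfolding derived_bracket_eq using zero_mem paired_embed_0 by (metis image_eqI)
next
  case False
  then obtain a b where ab: "m = Suc a" "n = Suc b" by (meson not0_implies_Suc)
  then show ?thesis
    using dbracket_closed[of "paired_embed P" a "paired_embed Q" b] P Q
      embedded_is_image[of "Suc a + Suc b"] paired_embed_embedded
    by (auto simp: derived_bracket_eq)
qed

lemma derived_diff_mem:
  assumes P: "P \<in> C n"
  shows "derived_diff sg lie sv \<rho> lam n P \<in> paired_embed ` C (n + 1)"
proof (cases n)
  case 0
  then have "derived_diff sg lie sv \<rho> lam n P = paired_embed 0"
    using P by (simp add: derived_diff_def paired_embed_0 L.nr_bracket_zero_right[OF theta'_cochain])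
  then show ?thesis using zero_mem by blast
next
  case (Suc a)
  then show ?thesis
    using differential_closed[of "paired_embed P" a] P embedded_is_image[of "Suc (Suc a)"]
      paired_embed_embedded by (auto simp: derived_diff_def)
qed

text \<open>
  From here on, identities between paired cochains are checked after applying the
  injective map \<open>paired_embed\<close>.
\<close>

lemma pbr_homog:
  assumes "P \<in> C m" "Q \<in> C n"
  shows "pbr_homog m n P Q \<in> C (m + n)"
    and "paired_embed (pbr_homog m n P Q) = dbracket m n (paired_embed P) (paired_embed Q)"
  using derived_bracket_mem[OF assms] paired_embed_inj
  unfolding paired_bracket_homog_def derived_bracket_eq
  by (auto intro: the_inv_into_into f_the_inv_into_f)

lemma pd_homog:
  assumes "P \<in> C n"
  shows "pd_homog n P \<in> C (n + 1)"
    and "paired_embed (pd_homog n P) = L.nrb 2 n \<theta>' (paired_embed P)"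
  using derived_diff_mem[OF assms] paired_embed_inj
  unfolding paired_diff_homog_def derived_diff_def
  by (auto intro: the_inv_into_into f_the_inv_into_f)

lemma pbr_homog_bilinear:
  assumes "P \<in> C m" "P' \<in> C m" "Q \<in> C n" "Q' \<in> C n"
  shows "pbr_homog m n (P + P') Q = pbr_homog m n P Q + pbr_homog m n P' Q"
    and "pbr_homog m n P (Q + Q') = pbr_homog m n P Q + pbr_homog m n P Q'"
    and "pbr_homog m n (ps c P) Q = ps c (pbr_homog m n P Q)"
    and "pbr_homog m n P (ps c Q) = ps c (pbr_homog m n P Q)"
proof -
  have D: "L.nrb 2 m \<theta> (paired_embed P) \<in> L.cochains (m + 1)"
    using L.nr_bracket_closed[OF theta_cochain embed_cochain[OF assms(1)]] by simp
  note E = paired_embed_add paired_embed_scale pbr_homog C_add C_scale assms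
    L.nr_bracket_add_right[OF theta_cochain] L.nr_bracket_scale_right[OF theta_cochain]
    L.nr_bracket_add_left[OF embed_cochain[OF assms(3)]] L.nr_bracket_scale_left[OF embed_cochain[OF assms(3)]]
    L.nr_bracket_add_right[OF D, simplified] L.nr_bracket_scale_right[OF D, simplified]
  show "pbr_homog m n (P + P') Q = pbr_homog m n P Q + pbr_homog m n P' Q"
    by (rule embed_inject[of _ "m + n"]) (simp_all add: E dbracket_def signed_add)
  show "pbr_homog m n P (Q + Q') = pbr_homog m n P Q + pbr_homog m n P Q'"
    by (rule embed_inject[of _ "m + n"]) (simp_all add: E dbracket_def signed_add)
  show "pbr_homog m n (ps c P) Q = ps c (pbr_homog m n P Q)"
    by (rule embed_inject[of _ "m + n"])
      (simp_all add: E dbracket_def fun_eq_iff signed_apply L.scale_signed)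
  show "pbr_homog m n P (ps c Q) = ps c (pbr_homog m n P Q)"
    by (rule embed_inject[of _ "m + n"])
      (simp_all add: E dbracket_def fun_eq_iff signed_apply L.scale_signed)
qed

lemma pd_homog_linear:
  assumes "P \<in> C n" "Q \<in> C n"
  shows "pd_homog n (P + Q) = pd_homog n P + pd_homog n Q"
    and "pd_homog n (ps c P) = ps c (pd_homog n P)"
proof -
  note E = paired_embed_add paired_embed_scale pd_homog C_add C_scale assms
    L.nr_bracket_add_right[OF theta'_cochain] L.nr_bracket_scale_right[OF theta'_cochain]
    pd_homog(1)[simplified]
  show "pd_homog n (P + Q) = pd_homog n P + pd_homog n Q"
    by (rule embed_inject[of _ "n + 1"]) (simp_all add: E)
  show "pd_homog n (ps c P) = ps c (pd_homog n P)"
    by (rule embed_inject[of _ "n + 1"]) (simp_all add: E)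
qed

lemma pbr_homog_0:
  assumes "P \<in> C m" "Q \<in> C n"
  shows "pbr_homog m n 0 Q = 0" "pbr_homog m n P 0 = 0"
  using pbr_homog_bilinear(1)[of 0 m 0 Q n Q] pbr_homog_bilinear(2)[of P m P 0 n 0] assms by auto

lemma pd_homog_0: "pd_homog n 0 = 0"
  using pd_homog_linear(1)[of 0 n 0] by simp

subsection \<open>Homogeneous components\<close>

lemma component_add: "paired_component n (P + Q) = paired_component n P + paired_component n Q"
  by (simp add: paired_component_def fun_eq_iff prod_eq_iff)

lemma component_scale: "paired_component n (ps c P) = ps c (paired_component n P)"
  by (simp add: paired_component_def paired_scale_def fun_eq_iff)

lemma component_0 [simp]: "paired_component n 0 = 0"
  by (simp add: paired_component_def fun_eq_iff prod_eq_iff)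

lemma component_sum: "paired_component n (sum w I) = (\<Sum>i\<in>I. paired_component n (w i))"
  by (induction I rule: infinite_finite_induct) (simp_all add: component_add)

lemma component_homog:
  assumes "P \<in> C m"
  shows "paired_component n P = (if n = m then P else 0)"
proof (cases "m = 0")
  case True
  then show ?thesis using assms by simp
next
  case False
  then have p: "fst P \<in> Hom_wedge sg sg m" and q: "\<And>v. (\<lambda>xs. snd P xs v) \<in> Hom_wedge sg sv (m - 1)"
    using assms by (auto simp: paired_cochains_def Hom_wedge_tensor_def)
  have "fst P xs = 0" if "length xs \<noteq> m" for xs using Hom_wedge_length[OF p that] .
  moreover have "snd P xs v = 0" if "length xs + 1 \<noteq> m" for xs v
    using Hom_wedge_length[OF q, of xs v] that False by simp
  ultimately show ?thesis
    by (auto simp: paired_component_def fun_eq_iff prod_eq_iff)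
qed

abbreviation cochain_sum where "cochain_sum \<equiv> P.span (\<Union>n. C n)"

text \<open>
  On the direct sum the bilinear extensions are finite sums over homogeneous components; elements
  outside it may have infinite support.
\<close>

lemma cochain_sum_components:
  assumes "x \<in> cochain_sum"
  shows "finite (paired_support x) \<and> (\<forall>n. paired_component n x \<in> C n)"
proof -
  let ?S = "{x. finite (paired_support x) \<and> (\<forall>n. paired_component n x \<in> C n)}"
  have "P.subspace ?S"
    unfolding P.subspace_def
  proof (intro conjI ballI allI)
    show "0 \<in> ?S" by (simp add: paired_support_def)
    fix x y c assume x: "x \<in> ?S" and y: "y \<in> ?S"
    have "paired_support (x + y) \<subseteq> paired_support x \<union> paired_support y"
      by (auto simp: paired_support_def component_add)
    then show "x + y \<in> ?S" using x y by (auto simp: component_add C_add dest: finite_subset)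
    have "paired_support (ps c x) \<subseteq> paired_support x"
      by (auto simp: paired_support_def component_scale)
    then show "ps c x \<in> ?S" using x by (auto simp: component_scale C_scale dest: finite_subset)
  qed
  moreover have "(\<Union>n. C n) \<subseteq> ?S"
  proof safe
    fix x n assume x: "x \<in> C n"
    have "paired_support x \<subseteq> {n}" using x by (auto simp: paired_support_def component_homog)
    then show "finite (paired_support x)" by (rule finite_subset) simp
    show "paired_component k x \<in> C k" for k using x by (simp add: component_homog)
  qed
  ultimately show ?thesis using P.span_minimal assms by blast
qed

text \<open>
  Enlarging the index sets to common finite supersets makes additivity a matter of distributing sums:
  the supports of \<open>x\<close>, \<open>y\<close> and \<open>x + y\<close> may differ.
\<close>

lemma pbr_sum:
  assumes "x \<in> cochain_sum" "y \<in> cochain_sum" "finite S" "finite T" "paired_support x \<subseteq> S" "paired_support y \<subseteq> T"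
  shows "pbr x y = (\<Sum>m\<in>S. \<Sum>n\<in>T. pbr_homog m n (paired_component m x) (paired_component n y))"
proof -
  have C: "paired_component n x \<in> C n" "paired_component n y \<in> C n" for n
    using cochain_sum_components assms by auto
  have "pbr x y = (\<Sum>m\<in>paired_support x. \<Sum>n\<in>T. pbr_homog m n (paired_component m x) (paired_component n y))"
    unfolding paired_bracket_def
    by (intro sum.cong refl sum.mono_neutral_left)
      (use assms pbr_homog_0(2)[OF C(1) zero_mem] in \<open>auto simp: paired_support_def\<close>)
  also have "\<dots> = (\<Sum>m\<in>S. \<Sum>n\<in>T. pbr_homog m n (paired_component m x) (paired_component n y))"
    by (intro sum.mono_neutral_left)
      (use assms pbr_homog_0(1)[OF zero_mem C(2)] in \<open>auto simp: paired_support_def\<close>)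
  finally show ?thesis .
qed

lemma pd_sum:
  assumes "finite S" "paired_support x \<subseteq> S"
  shows "pd x = (\<Sum>n\<in>S. pd_homog n (paired_component n x))"
  unfolding paired_diff_def
  by (intro sum.mono_neutral_left) (use assms pd_homog_0 in \<open>auto simp: paired_support_def\<close>)

lemma homog_cochain_sum: "x \<in> C n \<Longrightarrow> x \<in> cochain_sum"
  by (intro P.span_base) auto

lemma homog_support: "x \<in> C n \<Longrightarrow> paired_support x \<subseteq> {n}"
  by (auto simp: paired_support_def component_homog)

lemma pbr_eq_homog: "x \<in> C m \<Longrightarrow> y \<in> C n \<Longrightarrow> pbr x y = pbr_homog m n x y"
  by (subst pbr_sum[of x y "{m}" "{n}"]) (simp_all add: homog_cochain_sum homog_support component_homog)

lemma pd_eq_homog: "x \<in> C n \<Longrightarrow> pd x = pd_homog n x"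
  by (subst pd_sum[of "{n}" x]) (simp_all add: homog_support component_homog)

lemma pbr_mem: "x \<in> C m \<Longrightarrow> y \<in> C n \<Longrightarrow> pbr x y \<in> C (m + n)"
  and embed_pbr: "x \<in> C m \<Longrightarrow> y \<in> C n \<Longrightarrow>
    paired_embed (pbr x y) = dbracket m n (paired_embed x) (paired_embed y)"
  by (simp_all add: pbr_eq_homog pbr_homog)

lemma pd_mem: "x \<in> C n \<Longrightarrow> pd x \<in> C (Suc n)"
  and embed_pd: "x \<in> C n \<Longrightarrow> paired_embed (pd x) = L.nrb 2 n \<theta>' (paired_embed x)"
  using pd_homog by (simp_all add: pd_eq_homog)

lemma pbr_0: "pbr 0 y = 0" "pbr x 0 = 0" and pd_0: "pd 0 = 0"
  by (simp_all add: paired_bracket_def paired_diff_def paired_support_def)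

end

context lie_representation_char_0
begin

text \<open>
  Degree 0 contains only 0, where all axioms are trivial; the identities for \<open>dbracket\<close> concern positive
  degrees.
\<close>

lemma homog_cases:
  assumes "x \<in> C m"
  obtains "x = 0" | a where "m = Suc a" "paired_embed x \<in> embedded (Suc a)"
  using assms paired_embed_embedded by (cases m) auto

lemma pbr_skew:
  assumes x: "x \<in> C m" and y: "y \<in> C n"
  shows "pbr x y = - signed (m * n) (pbr y x)"
proof (cases rule: homog_cases[OF x]; cases rule: homog_cases[OF y])
  fix a b assume mn: "m = Suc a" "n = Suc b"
    and E: "paired_embed x \<in> embedded (Suc a)" "paired_embed y \<in> embedded (Suc b)"
  have "- signed (m * n) (pbr y x) = signed (m * n + 1) (pbr y x)" by (simp add: signed_def)
  moreover have "pbr x y = signed (m * n + 1) (pbr y x)"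
  proof (rule embed_inject)
    show "pbr x y \<in> C (m + n)" by (rule pbr_mem[OF x y])
    show "signed (m * n + 1) (pbr y x) \<in> C (m + n)"
      using C_signed[OF pbr_mem[OF y x]] by (simp add: add.commute)
    have "paired_embed (signed (m * n + 1) (pbr y x)) =
        signed (Suc (m * n)) (dbracket n m (paired_embed y) (paired_embed x))"
      by (simp only: paired_embed_signed embed_pbr[OF y x] Suc_eq_plus1)
    then show "paired_embed (pbr x y) = paired_embed (signed (m * n + 1) (pbr y x))"
      using dbracket_skew[OF E] unfolding mn[symmetric] by (simp only: embed_pbr[OF x y] signed_Suc)
  qed
  ultimately show ?thesis by simp
qed (simp_all add: pbr_0)

lemma pbr_jacobi:
  assumes x: "x \<in> C m" and y: "y \<in> C n" and z: "z \<in> C p"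
  shows "pbr x (pbr y z) = pbr (pbr x y) z + signed (m * n) (pbr y (pbr x z))"
proof (cases rule: homog_cases[OF x]; cases rule: homog_cases[OF y]; cases rule: homog_cases[OF z])
  fix a b c assume mn: "m = Suc a" "n = Suc b" "p = Suc c"
    and E: "paired_embed x \<in> embedded (Suc a)" "paired_embed y \<in> embedded (Suc b)"
      "paired_embed z \<in> embedded (Suc c)"
  note xy = pbr_mem[OF x y] and yz = pbr_mem[OF y z] and xz = pbr_mem[OF x z]
  show ?thesis
  proof (rule embed_inject)
    show "pbr x (pbr y z) \<in> C (m + (n + p))" by (rule pbr_mem[OF x yz])
    have "pbr (pbr x y) z \<in> C (m + (n + p))"
      using pbr_mem[OF xy z] by (simp add: add.assoc)
    moreover have "pbr y (pbr x z) \<in> C (m + (n + p))"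
      using pbr_mem[OF y xz] by (simp add: add.left_commute)
    ultimately show "pbr (pbr x y) z + signed (m * n) (pbr y (pbr x z)) \<in> C (m + (n + p))"
      by (intro C_add C_signed)
    show "paired_embed (pbr x (pbr y z)) =
        paired_embed (pbr (pbr x y) z + signed (m * n) (pbr y (pbr x z)))"
      using dbracket_jacobi[OF E] unfolding mn[symmetric]
      by (simp only: paired_embed_add paired_embed_signed embed_pbr[OF x yz] embed_pbr[OF xy z]
          embed_pbr[OF y xz] embed_pbr[OF x y] embed_pbr[OF y z] embed_pbr[OF x z])
  qed
qed (simp_all add: pbr_0)

lemma pd_square:
  assumes x: "x \<in> C n"
  shows "pd (pd x) = 0"
proof (cases rule: homog_cases[OF x])
  case (2 a)
  show ?thesis
  proof (rule embed_inject)
    show "pd (pd x) \<in> C (Suc (Suc n))" by (intro pd_mem x)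
    show "paired_embed (pd (pd x)) = paired_embed 0"
      using differential_square[OF 2(2)] 2(1)
      by (simp add: embed_pd[OF pd_mem[OF x]] embed_pd[OF x] paired_embed_0)
  qed simp
qed (simp add: pd_0)

lemma pd_derivation:
  assumes x: "x \<in> C m" and y: "y \<in> C n"
  shows "pd (pbr x y) = pbr (pd x) y + signed m (pbr x (pd y))"
proof (cases rule: homog_cases[OF x]; cases rule: homog_cases[OF y])
  fix a b assume mn: "m = Suc a" "n = Suc b"
    and E: "paired_embed x \<in> embedded (Suc a)" "paired_embed y \<in> embedded (Suc b)"
  note dx = pd_mem[OF x] and dy = pd_mem[OF y]
  show ?thesis
  proof (rule embed_inject)
    show "pd (pbr x y) \<in> C (Suc (m + n))" by (rule pd_mem[OF pbr_mem[OF x y]])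
    have "pbr (pd x) y \<in> C (Suc (m + n))" "pbr x (pd y) \<in> C (Suc (m + n))"
      using pbr_mem[OF dx y] pbr_mem[OF x dy] by auto
    then show "pbr (pd x) y + signed m (pbr x (pd y)) \<in> C (Suc (m + n))"
      by (intro C_add C_signed)
    show "paired_embed (pd (pbr x y)) = paired_embed (pbr (pd x) y + signed m (pbr x (pd y)))"
      using differential_derivation[OF E] unfolding mn[symmetric]
      by (simp only: paired_embed_add paired_embed_signed embed_pd[OF pbr_mem[OF x y]]
          embed_pbr[OF x y] embed_pbr[OF dx y] embed_pbr[OF x dy] embed_pd[OF x] embed_pd[OF y])
  qed
qed (simp_all add: pbr_0 pd_0)

theorem paired_dg_lie_algebra: "dg_lie_algebra ps C pbr pd"
proof (intro dg_lie_algebra.intro dg_lie_algebra_axioms.intro P.vector_space_axioms)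
  show "P.subspace (C n)" for n by (rule C_subspace)
  show "w j = 0" if "finite I" "\<And>i. i \<in> I \<Longrightarrow> w i \<in> C i" "sum w I = 0" "j \<in> I" for I w j
  proof -
    have "0 = paired_component j (sum w I)" using that(3) by simp
    also have "\<dots> = (\<Sum>i\<in>I. if i = j then w i else 0)"
      unfolding component_sum by (intro sum.cong refl) (simp add: component_homog[OF that(2)])
    also have "\<dots> = w j" using that(1,4) by simp
    finally show ?thesis by simp
  qed
  show "pbr (x + y) z = pbr x z + pbr y z"
    if x: "x \<in> cochain_sum" and y: "y \<in> cochain_sum" and z: "z \<in> cochain_sum" for x y z
  proof -
    define S where "S = paired_support x \<union> paired_support y \<union> paired_support (x + y)"
    have fin: "finite S" "finite (paired_support z)"
      using cochain_sum_components x y z P.span_add[OF x y] by (auto simp: S_def)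
    have C: "paired_component n x \<in> C n" "paired_component n y \<in> C n" "paired_component n z \<in> C n" for n
      using cochain_sum_components x y z by auto
    have sub: "paired_support x \<subseteq> S" "paired_support y \<subseteq> S" "paired_support (x + y) \<subseteq> S"
      by (auto simp: S_def)
    show ?thesis
      unfolding pbr_sum[OF P.span_add[OF x y] z fin sub(3) order_refl]
        pbr_sum[OF x z fin sub(1) order_refl] pbr_sum[OF y z fin sub(2) order_refl]
      by (simp add: component_add sum.distrib pbr_homog_bilinear(1)[OF C(1,2) C(3,3)])
  qed
  show "pbr x (y + z) = pbr x y + pbr x z"
    if x: "x \<in> cochain_sum" and y: "y \<in> cochain_sum" and z: "z \<in> cochain_sum" for x y z
  proof -
    define S where "S = paired_support y \<union> paired_support z \<union> paired_support (y + z)"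
    have fin: "finite (paired_support x)" "finite S"
      using cochain_sum_components x y z P.span_add[OF y z] by (auto simp: S_def)
    have C: "paired_component n x \<in> C n" "paired_component n y \<in> C n" "paired_component n z \<in> C n" for n
      using cochain_sum_components x y z by auto
    have sub: "paired_support y \<subseteq> S" "paired_support z \<subseteq> S" "paired_support (y + z) \<subseteq> S"
      by (auto simp: S_def)
    show ?thesis
      unfolding pbr_sum[OF x P.span_add[OF y z] fin order_refl sub(3)]
        pbr_sum[OF x y fin order_refl sub(1)] pbr_sum[OF x z fin order_refl sub(2)]
      by (simp add: component_add sum.distrib pbr_homog_bilinear(2)[OF C(1,1) C(2,3)])
  qed
  show "pbr (ps c x) y = ps c (pbr x y)"
    if x: "x \<in> cochain_sum" and y: "y \<in> cochain_sum" for c x y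
  proof -
    have fin: "finite (paired_support x)" "finite (paired_support y)"
      using cochain_sum_components x y by auto
    have C: "paired_component n x \<in> C n" "paired_component n y \<in> C n" for n
      using cochain_sum_components x y by auto
    have sub: "paired_support (ps c x) \<subseteq> paired_support x"
      by (auto simp: paired_support_def component_scale)
    show ?thesis
      unfolding pbr_sum[OF P.span_scale[OF x] y fin sub order_refl] pbr_sum[OF x y fin order_refl order_refl]
      by (simp add: component_scale P.scale_sum_right pbr_homog_bilinear(3)[OF C(1,1) C(2,2)])
  qed
  show "pbr x (ps c y) = ps c (pbr x y)"
    if x: "x \<in> cochain_sum" and y: "y \<in> cochain_sum" for c x y
  proof -
    have fin: "finite (paired_support x)" "finite (paired_support y)"
      using cochain_sum_components x y by auto
    have C: "paired_component n x \<in> C n" "paired_component n y \<in> C n" for n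
      using cochain_sum_components x y by auto
    have sub: "paired_support (ps c y) \<subseteq> paired_support y"
      by (auto simp: paired_support_def component_scale)
    show ?thesis
      unfolding pbr_sum[OF x P.span_scale[OF y] fin order_refl sub] pbr_sum[OF x y fin order_refl order_refl]
      by (simp add: component_scale P.scale_sum_right pbr_homog_bilinear(4)[OF C(1,1) C(2,2)])
  qed
  show "pd (x + y) = pd x + pd y" if x: "x \<in> cochain_sum" and y: "y \<in> cochain_sum" for x y
  proof -
    define S where "S = paired_support x \<union> paired_support y \<union> paired_support (x + y)"
    have fin: "finite S"
      using cochain_sum_components x y P.span_add[OF x y] by (auto simp: S_def)
    have C: "paired_component n x \<in> C n" "paired_component n y \<in> C n" for n
      using cochain_sum_components x y by auto
    have sub: "paired_support x \<subseteq> S" "paired_support y \<subseteq> S" "paired_support (x + y) \<subseteq> S"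
      by (auto simp: S_def)
    show ?thesis
      unfolding pd_sum[OF fin sub(1)] pd_sum[OF fin sub(2)] pd_sum[OF fin sub(3)]
      by (simp add: component_add sum.distrib pd_homog_linear(1)[OF C])
  qed
  show "pd (ps c x) = ps c (pd x)" if x: "x \<in> cochain_sum" for c x
  proof -
    have fin: "finite (paired_support x)" and C: "paired_component n x \<in> C n" for n
      using cochain_sum_components x by auto
    have sub: "paired_support (ps c x) \<subseteq> paired_support x"
      by (auto simp: paired_support_def component_scale)
    show ?thesis
      unfolding pd_sum[OF fin sub] pd_sum[OF fin order_refl]
      by (simp add: component_scale P.scale_sum_right pd_homog_linear(2)[OF C C])
  qed
  show "pbr x y = - ps ((- 1) ^ (m * n)) (pbr y x)" if "x \<in> C m" "y \<in> C n" for x y m n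
    unfolding P.scale_minus_one_power by (rule pbr_skew[OF that])
  show "pbr x (pbr y z) = pbr (pbr x y) z + ps ((- 1) ^ (m * n)) (pbr y (pbr x z))"
    if "x \<in> C m" "y \<in> C n" "z \<in> C p" for x y z m n p
    unfolding P.scale_minus_one_power by (rule pbr_jacobi[OF that])
  show "pd (pbr x y) = pbr (pd x) y + ps ((- 1) ^ m) (pbr x (pd y))"
    if "x \<in> C m" "y \<in> C n" for x y m n
    unfolding P.scale_minus_one_power by (rule pd_derivation[OF that])
qed (simp_all add: pbr_mem pd_mem pd_square)

section \<open>Maurer-Cartan elements\<close>

context
  fixes T :: "'g \<Rightarrow> 'g" and T' :: "'v \<Rightarrow> 'v"
  assumes T: "Vector_Spaces.linear sg sg T" and T': "Vector_Spaces.linear sv sv T'"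
begin

abbreviation "maps_cochain \<equiv> paired_of_maps T T'"

lemma paired_of_maps_mem: "maps_cochain \<in> C 1"
proof -
  have "(\<lambda>xs. if length xs = 1 then T (hd xs) else 0) \<in> Hom_wedge sg sg 1"
  proof (rule Hom_wedgeI)
    show "Vector_Spaces.linear sg sg (\<lambda>x. if length (xs[i := x]) = 1 then T (hd (xs[i := x])) else 0)"
      if "length xs = 1" "i < 1" for xs i
      using that T by (cases xs) auto
  qed auto
  moreover have "(\<lambda>xs v. if xs = [] then T' v else 0) \<in> Hom_wedge_tensor sg sv 0"
    unfolding Hom_wedge_tensor_def
  proof safe
    show "Vector_Spaces.linear sv sv (\<lambda>v. if xs = [] then T' v else 0)" for xs :: "'g list"
      using T' VV.linear_zero_map by (cases "xs = []") auto
  qed (simp add: Hom_wedge_0_iff)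
  ultimately show ?thesis by (simp add: paired_cochains_def paired_of_maps_def)
qed

lemma paired_embed_of_maps: "paired_embed maps_cochain [l] = in_g (T (pr_g' l)) + in_V (T' (pr_V' l))"
  by (simp add: paired_embed_eq_sum paired_of_maps_def signed_def)

definition mc_lhs where
  "mc_lhs = L.nrb 2 1 \<theta>' (paired_embed maps_cochain) + (\<lambda>ls. qs (1/2) (dbracket 1 1 (paired_embed maps_cochain) (paired_embed maps_cochain) ls))"

text \<open>
  The derived bracket of the cochain with itself contains each term twice, by skew-symmetry of \<open>\<theta>\<close>, which
  the factor \<open>1/2\<close> compensates.
\<close>

lemma mc_lhs_values:
  "mc_lhs [in_g' x, in_g' y] = in_g (T (lie (T x) y + lie x (T y) + sg lam (lie x y)) - lie (T x) (T y))"
  "mc_lhs [in_V' u, in_g' x] = in_V (\<rho> (T x) (T' u) - T' (\<rho> (T x) u + \<rho> x (T' u) + sv lam (\<rho> x u)))"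
proof -
  let ?E = "paired_embed maps_cochain" and ?D = "L.nrb 2 1 \<theta> (paired_embed maps_cochain)"
  have E: "?E \<in> L.cochains 1" by (rule embed_cochain[OF paired_of_maps_mem])
  have D: "?D \<in> L.cochains 2" using L.nr_bracket_closed[OF theta_cochain E] by simp
  have db: "dbracket 1 1 ?E ?E = - L.nrb 2 1 ?D ?E"
    by (simp only: dbracket_def one_add_one signed_def odd_one if_False)
  have mc_lhs: "mc_lhs [a, b] = \<theta>' [?E [a], b] + \<theta>' [a, ?E [b]] - ?E [\<theta>' [a, b]]
      - qs (1/2) (?D [?E [a], b] + ?D [a, ?E [b]] - ?E [?D [a, b]])" for a b
    by (simp only: mc_lhs_def db plus_fun_apply uminus_apply L.nr_bracket_2_1[OF theta'_cochain E]
        L.nr_bracket_2_1[OF D E] L.scale_minus_right add_uminus_conv_diff)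
  note T_simps = GG.linear_add[OF T] GG.linear_neg[OF T] GG.linear_diff[OF T] GG.linear_scale[OF T] GG.linear_0[OF T]
    VV.linear_add[OF T'] VV.linear_neg[OF T'] VV.linear_diff[OF T'] VV.linear_scale[OF T'] VV.linear_0[OF T']
  have half: "qs (1/2) (l + l) = l" for l
    by (simp add: L.double_eq)
  have D_eq: "?D [a, b] = \<theta> [?E [a], b] + \<theta> [a, ?E [b]] - ?E [\<theta> [a, b]]" for a b
    by (rule L.nr_bracket_2_1[OF theta_cochain E])
  have inner_g: "?D [?E [in_g' x], in_g' y] + ?D [in_g' x, ?E [in_g' y]] - ?E [?D [in_g' x, in_g' y]] =
      in_g (lie (T x) (T y) - T (lie (T x) y + lie x (T y)))
      + in_g (lie (T x) (T y) - T (lie (T x) y + lie x (T y)))"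
    unfolding D_eq paired_embed_of_maps unfolding theta_eq L.binary_apply
    using lie_skew[of "T y" x]
    by (simp add: theta_op_def quad_simps lie_bilinear rho_bilinear T_simps algebra_simps)
  show "mc_lhs [in_g' x, in_g' y] = in_g (T (lie (T x) y + lie x (T y) + sg lam (lie x y)) - lie (T x) (T y))"
    unfolding mc_lhs inner_g half unfolding theta'_eq L.binary_apply paired_embed_of_maps
    by (simp add: theta'_op_def quad_simps lie_bilinear rho_bilinear T_simps algebra_simps)
  have inner_V: "?D [?E [in_V' u], in_g' x] + ?D [in_V' u, ?E [in_g' x]] - ?E [?D [in_V' u, in_g' x]] =
      in_V (T' (\<rho> (T x) u + \<rho> x (T' u)) - \<rho> (T x) (T' u))
      + in_V (T' (\<rho> (T x) u + \<rho> x (T' u)) - \<rho> (T x) (T' u))"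
    unfolding D_eq paired_embed_of_maps unfolding theta_eq L.binary_apply
    by (simp add: theta_op_def quad_simps lie_bilinear rho_bilinear T_simps algebra_simps)
  show "mc_lhs [in_V' u, in_g' x] = in_V (\<rho> (T x) (T' u) - T' (\<rho> (T x) u + \<rho> x (T' u) + sv lam (\<rho> x u)))"
    unfolding mc_lhs inner_V half unfolding theta'_eq L.binary_apply paired_embed_of_maps
    by (simp add: theta'_op_def quad_simps lie_bilinear rho_bilinear T_simps algebra_simps)
qed

lemma mc_lhs_embedded: "mc_lhs \<in> embedded 2"
  and mc_lhs_eq: "paired_embed (pd maps_cochain + ps (1/2) (pbr maps_cochain maps_cochain)) = mc_lhs"
proof -
  note mem = paired_of_maps_mem
  show eq: "paired_embed (pd maps_cochain + ps (1/2) (pbr maps_cochain maps_cochain)) = mc_lhs"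
    by (simp only: paired_embed_add paired_embed_scale embed_pd[OF mem] embed_pbr[OF mem mem] mc_lhs_def)
  have "pd maps_cochain + ps (1/2) (pbr maps_cochain maps_cochain) \<in> C 2"
    using pd_mem[OF mem] pbr_mem[OF mem mem] by (intro C_add C_scale) (simp_all add: numeral_2_eq_2)
  then show "mc_lhs \<in> embedded 2" using paired_embed_embedded eq by metis
qed

text \<open>
  In arity 2, the values that determine an embedded cochain are those on \<open>g' \<times> g'\<close> and on \<open>V' \<times> g'\<close>.
\<close>

lemma mc_lhs_eq_0_iff:
  "mc_lhs = 0 \<longleftrightarrow> (\<forall>x y. mc_lhs [in_g' x, in_g' y] = 0) \<and> (\<forall>u x. mc_lhs [in_V' u, in_g' x] = 0)"
proof
  assume *: "(\<forall>x y. mc_lhs [in_g' x, in_g' y] = 0) \<and> (\<forall>u x. mc_lhs [in_V' u, in_g' x] = 0)"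
  have other: "mc_lhs ls = 0" if "length ls \<noteq> 2" for ls
    using Hom_wedge_length[OF embedded_cochain[OF mc_lhs_embedded] that] .
  show "mc_lhs = 0"
  proof (rule embedded_eq_0I[OF mc_lhs_embedded])
    show "mc_lhs (map in_g' xs) = 0" for xs
    proof (cases "length xs = 2")
      case True
      then obtain x y where "xs = [x, y]" by (auto simp: numeral_2_eq_2 length_Suc_conv)
      then show ?thesis using * by simp
    qed (simp add: other)
    show "mc_lhs (in_V' v # map in_g' xs) = 0" for v xs
    proof (cases "length xs = 1")
      case True
      then obtain x where "xs = [x]" by (auto simp: length_Suc_conv)
      then show ?thesis using * by simp
    qed (simp add: other)
  qed
qed simp

theorem rota_baxter_iff_maurer_cartan:
  "rota_baxter_paired sg lie sv \<rho> lam T T' \<longleftrightarrow> maurer_cartan ps C pbr pd maps_cochain"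
proof -
  have "pd maps_cochain + ps (1/2) (pbr maps_cochain maps_cochain) = 0 \<longleftrightarrow> mc_lhs = 0"
  proof
    assume "mc_lhs = 0"
    moreover have "pd maps_cochain + ps (1/2) (pbr maps_cochain maps_cochain) \<in> C 2"
      using pd_mem[OF paired_of_maps_mem] pbr_mem[OF paired_of_maps_mem paired_of_maps_mem]
      by (intro C_add C_scale) (simp_all add: numeral_2_eq_2)
    ultimately show "pd maps_cochain + ps (1/2) (pbr maps_cochain maps_cochain) = 0"
      using embed_inject[of _ 2 0] mc_lhs_eq paired_embed_0 by (metis zero_mem)
  next
    assume "pd maps_cochain + ps (1/2) (pbr maps_cochain maps_cochain) = 0"
    then show "mc_lhs = 0" using mc_lhs_eq paired_embed_0 by metis
  qed
  moreover have "mc_lhs = 0 \<longleftrightarrow>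
      (\<forall>x y. lie (T x) (T y) = T (lie (T x) y + lie x (T y) + sg lam (lie x y))) \<and>
      (\<forall>x u. \<rho> (T x) (T' u) = T' (\<rho> (T x) u + \<rho> x (T' u) + sv lam (\<rho> x u)))"
  proof -
    have "in_g (z - w) = (0 :: ('g, 'v) quad) \<longleftrightarrow> w = z" "in_V (u - v) = (0 :: ('g, 'v) quad) \<longleftrightarrow> u = v"
      for z w u v by (auto simp: quad_simps)
    then show ?thesis unfolding mc_lhs_eq_0_iff mc_lhs_values by blast
  qed
  ultimately show ?thesis
    using T T' paired_of_maps_mem unfolding maurer_cartan_def rota_baxter_paired_def by blast
qed

end

end

theorem theorem5p4:
  fixes sg :: "'k::field_char_0 \<Rightarrow> 'g::ab_group_add \<Rightarrow> 'g"
    and lie :: "'g \<Rightarrow> 'g \<Rightarrow> 'g"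
    and sv :: "'k \<Rightarrow> 'v::ab_group_add \<Rightarrow> 'v"
    and \<rho> :: "'g \<Rightarrow> 'v \<Rightarrow> 'v"
    and lam :: 'k
  assumes "lie_representation sg lie sv \<rho>"
  shows "(\<forall>n. inj_on paired_embed (paired_cochains sg sv n) \<and>
              paired_embed ` paired_cochains sg sv n
                \<subseteq> Hom_wedge (quad_scale sg sv) (quad_scale sg sv) n)
       \<and> (\<forall>m n. \<forall>P\<in>paired_cochains sg sv m. \<forall>Q\<in>paired_cochains sg sv n.
            derived_bracket sg lie sv \<rho> m n P Q \<in> paired_embed ` paired_cochains sg sv (m + n))
       \<and> (\<forall>n. \<forall>P\<in>paired_cochains sg sv n.
            derived_diff sg lie sv \<rho> lam n P \<in> paired_embed ` paired_cochains sg sv (n + 1))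
       \<and> dg_lie_algebra (paired_scale sg sv) (paired_cochains sg sv)
            (paired_bracket sg lie sv \<rho>) (paired_diff sg lie sv \<rho> lam)
       \<and> (\<forall>T T'. Vector_Spaces.linear sg sg T \<and> Vector_Spaces.linear sv sv T' \<longrightarrow>
            (rota_baxter_paired sg lie sv \<rho> lam T T' \<longleftrightarrow>
             maurer_cartan (paired_scale sg sv) (paired_cochains sg sv)
               (paired_bracket sg lie sv \<rho>) (paired_diff sg lie sv \<rho> lam) (paired_of_maps T T')))"
proof -
  interpret lie_representation_char_0 sg lie sv \<rho> lam
    by (rule lie_representation_char_0.intro[OF assms])
  show ?thesis
    using paired_embed_inj embed_cochain derived_bracket_mem derived_diff_mem paired_dg_lie_algebra
      rota_baxter_iff_maurer_cartan
    by blast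
qed

end
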